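(* Let $(M,g)$ be a spacelike quaternionic paraKähler Heisenberg four-manifold, written as $$g=-dt^2+b(t)^{-2}\left(-\mathfrak e^1_{t_0}\otimes\mathfrak e^1_{t_0}+\mathfrak e^2_{t_0}\otimes\mathfrak e^2_{t_0}\right)+a(t)^{-2}\,\mathfrak e^3_{t_0}\otimes\mathfrak e^3_{t_0}.$$ Then: – The eigenvalues of the Weyl tensor, understood as a symmetric endomorphism of the bundle of two-forms, are given by $(-2\nu', \nu' , \nu')$, where $$\nu'=\frac{16 k^3 b^7}{\varepsilon a^3(3k b^3+a b')}.$$ – $(M,g)$ is conformally paraKähler for two paracomplex structures with opposite orientations.
   Context: $\mathrm{H}$ is the three-dimensional Heisenberg group (connected, simply connected, non-abelian nilpotent), with Lie algebra $\mathfrak h$ and one-dimensional center $\mathcal Z$. A Heisenberg four-manifold is a four-dimensional pseudo-Riemannian manifold foliated by the orbits of a principal isometric action of $\mathrm{H}$; orbits are assumed non-degenerate, and (after passing to the universal covering and up to an overall sign of the metric) $M=\mathcal I\times \mathrm{H}$, $\mathcal I$ an open interval, $g=\varepsilon\,dt^2+\chi_t$ with $\chi_t$ left-invariant metrics on $\mathrm{H}$; here the signature is neutral, i.e. $\varepsilon=-1$ and $\chi_t$ is Lorentzian of signature $(-,+,+)$. It is spacelike if $\mathcal Z$ is spacelike for every $\chi_t$. A neutral-signature orientable four-manifold is quaternionic paraKähler if $\mathrm{Ric}^g=\Lambda g$, $\Lambda\neq0$, and its Weyl tensor is self-dual for one of the two orientations; that orientation is always the one considered. Fix $t_0\in\mathcal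 I$. Every such manifold can be written in the displayed form, with $a(t_0)=b(t_0)=1$, where $(\mathfrak e_{t_0}^i)$ is the coframe dual to a left-invariant $\chi_{t_0}$-orthonormal frame $(\mathfrak e_i^{t_0})$ with $\mathfrak e_1^{t_0}$ timelike, $\mathfrak e_3^{t_0}$ spanning the center and only non-vanishing bracket $[\mathfrak e_1^{t_0},\mathfrak e_2^{t_0}]=-2k\,\mathfrak e_3^{t_0}$, $k>0$, and where the functions $a,b$ satisfy $$a'=-\frac{k^2 b^6+a^2(-\Lambda b^2+(b')^2)}{2ab b'},\qquad \Lambda=\frac{3(kb^3+a b')^3}{a^2 b^2(3k b^3+a b')}.$$ The Weyl tensor acts on two-forms by $(\mathrm W^g(\omega))_{\mu\nu}=(\mathrm W^g)_{\mu\nu\rho\sigma}\omega^{\rho\sigma}$. The three eigenvalues are those on self-dual two-forms: the eigenvectors are $\omega_i=dt\wedge\mathfrak e^i_t+\star(dt\wedge\mathfrak e^i_t)$, $i=1,2,3$, with eigenvalues $\nu',\nu',-2\nu'$ respectively, where $\mathfrak e^1_t=b^{-1}\mathfrak e^1_{t_0}$, $\mathfrak e^2_t=b^{-1}\mathfrak e^2_{t_0}$, $\mathfrak e^3_t=a^{-1}\mathfrak e^3_{t_0}$ and $\star$ is the Hodge star. A paracomplex structure is an integrable endomorphism field $J$ with $J^2=\mathbf 1$ whose $\pm1$-eigendistributions have equal rank; conformally paraKähler with respect to $J$ means that some metric $\tilde g$ conformal to $g$ is paraKähler with respect to $J$ ($J$ is $\tilde g$-skew-symmetric and the two-form $\tilde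 g\circ J$ is closed).
   Formalization: In the formula for ν' the factor a³ in the denominator is replaced by a²; the printed formula fails wherever a(t) ≠ 1, e.g. for b = e^{kt}, a = e^{2kt}, Λ = 6k², where the eigenvalue is −4k² but the printed formula gives −4k²e^{−2kt}. *)

theory Defs
  imports "HOL-Analysis.Analysis"
begin

section \<open>Tensor calculus on open subsets of coordinate space\<close>

text \<open>
  Vectors and covectors at a point are elements of \<open>real^'n\<close>; bilinear forms (metrics, two-forms)
  and endomorphisms are matrices, \<open>B $ i $ j\<close> being the value of the bilinear form \<open>B\<close> on the
  \<open>i\<close>-th and \<open>j\<close>-th coordinate vectors.
\<close>

definition partial :: "'n \<Rightarrow> (real^'n \<Rightarrow> real) \<Rightarrow> real^'n \<Rightarrow> real" where
  "partial i f p = frechet_derivative f (at p) (axis i 1)"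

text \<open>On an open set: all iterated partial derivatives exist and are differentiable.\<close>

definition smooth_fun :: "(real^'n) set \<Rightarrow> (real^'n \<Rightarrow> real) \<Rightarrow> bool" where
  "smooth_fun U f \<longleftrightarrow> (\<forall>is. \<forall>p\<in>U. fold partial is f differentiable (at p))"

definition smooth_vec :: "(real^'n) set \<Rightarrow> (real^'n \<Rightarrow> real^'m) \<Rightarrow> bool" where
  "smooth_vec U X \<longleftrightarrow> (\<forall>i. smooth_fun U (\<lambda>p. X p $ i))"

definition smooth_mat :: "(real^'n) set \<Rightarrow> (real^'n \<Rightarrow> real^'m^'l) \<Rightarrow> bool" where
  "smooth_mat U A \<longleftrightarrow> (\<forall>i j. smooth_fun U (\<lambda>p. A p $ i $ j))"

definition lie_bracket ::
    "(real^'n \<Rightarrow> real^'n) \<Rightarrow> (real^'n \<Rightarrow> real^'n) \<Rightarrow> real^'n \<Rightarrow> real^'n" where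
  "lie_bracket X Y p =
     frechet_derivative Y (at p) (X p) - frechet_derivative X (at p) (Y p)"

definition tensor :: "real^'n \<Rightarrow> real^'n \<Rightarrow> real^'n^'n" where
  "tensor \<alpha> \<beta> = (\<chi> i j. \<alpha> $ i * \<beta> $ j)"

definition wedge :: "real^'n \<Rightarrow> real^'n \<Rightarrow> real^'n^'n" where
  "wedge \<alpha> \<beta> = tensor \<alpha> \<beta> - tensor \<beta> \<alpha>"

definition two_form :: "real^'n^'n \<Rightarrow> bool" where
  "two_form \<omega> \<longleftrightarrow> transpose \<omega> = - \<omega>"

definition closed_form :: "(real^'n) set \<Rightarrow> (real^'n \<Rightarrow> real^'n^'n) \<Rightarrow> bool" where
  "closed_form U \<omega> \<longleftrightarrow> (\<forall>p\<in>U. \<forall>i j k.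
     partial i (\<lambda>q. \<omega> q $ j $ k) p + partial j (\<lambda>q. \<omega> q $ k $ i) p
       + partial k (\<lambda>q. \<omega> q $ i $ j) p = 0)"


section \<open>Pseudo-Riemannian metrics and curvature\<close>

text \<open>A symmetric non-degenerate form whose signature has exactly \<open>m\<close> minus signs.\<close>

definition has_index :: "nat \<Rightarrow> real^'n^'n \<Rightarrow> bool" where
  "has_index m B \<longleftrightarrow> transpose B = B \<and>
     (\<exists>(P :: real^'n^'n) (N :: 'n set). invertible P \<and> card N = m \<and>
        transpose P ** B ** P
          = (\<chi> i j. if i = j then (if i \<in> N then - 1 else 1) else 0))"

definition metric_on :: "(real^'n) set \<Rightarrow> nat \<Rightarrow> (real^'n \<Rightarrow> real^'n^'n) \<Rightarrow> bool" where
  "metric_on U m g \<longleftrightarrow> smooth_mat U g \<and> (\<forall>p\<in>U. has_index m (g p))"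

definition christoffel ::
    "(real^'n \<Rightarrow> real^'n^'n) \<Rightarrow> 'n \<Rightarrow> 'n \<Rightarrow> 'n \<Rightarrow> real^'n \<Rightarrow> real" where
  "christoffel g m i j p = (1/2) * (\<Sum>l\<in>UNIV. matrix_inv (g p) $ m $ l *
     (partial i (\<lambda>q. g q $ j $ l) p + partial j (\<lambda>q. g q $ i $ l) p
       - partial l (\<lambda>q. g q $ i $ j) p))"

text \<open>
  \<open>riemann_up g m k i j\<close> is the \<open>m\<close>-th component of
  \<open>R(\<partial>\<^sub>i,\<partial>\<^sub>j)\<partial>\<^sub>k = \<nabla>\<^sub>i\<nabla>\<^sub>j\<partial>\<^sub>k - \<nabla>\<^sub>j\<nabla>\<^sub>i\<partial>\<^sub>k\<close>, and \<open>riemann g l k i j\<close> lowers the first index, so that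
  a metric of constant curvature \<open>c\<close> has \<open>R\<^sub>l\<^sub>k\<^sub>i\<^sub>j = c (g\<^sub>l\<^sub>i g\<^sub>k\<^sub>j - g\<^sub>l\<^sub>j g\<^sub>k\<^sub>i)\<close>.
\<close>

definition riemann_up ::
    "(real^'n \<Rightarrow> real^'n^'n) \<Rightarrow> 'n \<Rightarrow> 'n \<Rightarrow> 'n \<Rightarrow> 'n \<Rightarrow> real^'n \<Rightarrow> real" where
  "riemann_up g m k i j p =
     partial i (christoffel g m j k) p - partial j (christoffel g m i k) p
     + (\<Sum>l\<in>UNIV. christoffel g m i l p * christoffel g l j k p
                  - christoffel g m j l p * christoffel g l i k p)"

definition riemann ::
    "(real^'n \<Rightarrow> real^'n^'n) \<Rightarrow> 'n \<Rightarrow> 'n \<Rightarrow> 'n \<Rightarrow> 'n \<Rightarrow> real^'n \<Rightarrow> real" where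
  "riemann g l k i j p = (\<Sum>m\<in>UNIV. g p $ l $ m * riemann_up g m k i j p)"

definition ricci :: "(real^'n \<Rightarrow> real^'n^'n) \<Rightarrow> real^'n \<Rightarrow> real^'n^'n" where
  "ricci g p = (\<chi> k j. \<Sum>i\<in>UNIV. riemann_up g i k i j p)"

definition scalar_curvature :: "(real^'n \<Rightarrow> real^'n^'n) \<Rightarrow> real^'n \<Rightarrow> real" where
  "scalar_curvature g p = (\<Sum>i\<in>UNIV. \<Sum>j\<in>UNIV. matrix_inv (g p) $ i $ j * ricci g p $ i $ j)"

definition weyl ::
    "(real^'n \<Rightarrow> real^'n^'n) \<Rightarrow> 'n \<Rightarrow> 'n \<Rightarrow> 'n \<Rightarrow> 'n \<Rightarrow> real^'n \<Rightarrow> real" where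
  "weyl g l k i j p =
     riemann g l k i j p
     - (1 / (real CARD('n) - 2)) *
         (g p $ l $ i * ricci g p $ k $ j - g p $ l $ j * ricci g p $ k $ i
           - g p $ k $ i * ricci g p $ l $ j + g p $ k $ j * ricci g p $ l $ i)
     + (scalar_curvature g p / ((real CARD('n) - 1) * (real CARD('n) - 2))) *
         (g p $ l $ i * g p $ k $ j - g p $ l $ j * g p $ k $ i)"

definition raise_indices :: "real^'n^'n \<Rightarrow> real^'n^'n \<Rightarrow> real^'n^'n" where
  "raise_indices B \<omega> = matrix_inv B ** \<omega> ** transpose (matrix_inv B)"

text \<open>The contraction runs over all pairs of indices, without a factor \<open>1/2\<close>.\<close>

definition weyl_op :: "(real^'n \<Rightarrow> real^'n^'n) \<Rightarrow> real^'n \<Rightarrow> real^'n^'n \<Rightarrow> real^'n^'n" where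
  "weyl_op g p \<omega> = (\<chi> i j. \<Sum>k\<in>UNIV. \<Sum>l\<in>UNIV.
     weyl g i j k l p * raise_indices (g p) \<omega> $ k $ l)"


section \<open>Dimension four: orientation, Hodge star, quaternionic paraKaehler metrics\<close>

text \<open>
  An orientation of a connected open subset of \<open>real^4\<close> is a sign \<open>\<sigma>\<close>, relative to the
  coordinate orientation.
\<close>

definition levi_civita :: "4 \<Rightarrow> 4 \<Rightarrow> 4 \<Rightarrow> 4 \<Rightarrow> real" where
  "levi_civita i j k l = det (vector [axis i 1, axis j 1, axis k 1, axis l 1] :: real^4^4)"

definition hodge :: "real \<Rightarrow> real^4^4 \<Rightarrow> real^4^4 \<Rightarrow> real^4^4" where
  "hodge \<sigma> B \<omega> = (\<chi> i j. (1/2) * (\<Sum>k\<in>UNIV. \<Sum>l\<in>UNIV.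
     \<sigma> * sqrt \<bar>det B\<bar> * levi_civita k l i j * raise_indices B \<omega> $ k $ l))"

definition self_dual_forms :: "real \<Rightarrow> real^4^4 \<Rightarrow> (real^4^4) set" where
  "self_dual_forms \<sigma> B = {\<omega>. two_form \<omega> \<and> hodge \<sigma> B \<omega> = \<omega>}"

definition weyl_self_dual :: "(real^4) set \<Rightarrow> (real^4 \<Rightarrow> real^4^4) \<Rightarrow> real \<Rightarrow> bool" where
  "weyl_self_dual U g \<sigma> \<longleftrightarrow> (\<forall>p\<in>U. \<forall>\<omega>. two_form \<omega> \<longrightarrow>
     hodge \<sigma> (g p) (weyl_op g p \<omega>) = weyl_op g p \<omega>)"

text \<open>\<open>\<sigma>\<close> is the orientation for which the Weyl tensor is self-dual.\<close>

definition quaternionic_parakaehler ::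
    "(real^4) set \<Rightarrow> (real^4 \<Rightarrow> real^4^4) \<Rightarrow> real \<Rightarrow> real \<Rightarrow> bool" where
  "quaternionic_parakaehler U g \<Lambda> \<sigma> \<longleftrightarrow>
     metric_on U 2 g \<and> \<Lambda> \<noteq> 0 \<and> (\<forall>p\<in>U. ricci g p = \<Lambda> *\<^sub>R g p) \<and>
     \<sigma> \<in> {1, - 1} \<and> weyl_self_dual U g \<sigma>"


section \<open>Paracomplex structures\<close>

definition involutive :: "(real^'n) set \<Rightarrow> (real^'n \<Rightarrow> (real^'n) set) \<Rightarrow> bool" where
  "involutive U D \<longleftrightarrow> (\<forall>X Y. smooth_vec U X \<and> smooth_vec U Y \<and>
     (\<forall>p\<in>U. X p \<in> D p \<and> Y p \<in> D p) \<longrightarrow> (\<forall>p\<in>U. lie_bracket X Y p \<in> D p))"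

definition paracomplex :: "(real^'n) set \<Rightarrow> (real^'n \<Rightarrow> real^'n^'n) \<Rightarrow> bool" where
  "paracomplex U J \<longleftrightarrow> smooth_mat U J \<and>
     (\<forall>p\<in>U. J p ** J p = mat 1 \<and> dim {v. J p *v v = v} = dim {v. J p *v v = - v}) \<and>
     involutive U (\<lambda>p. {v. J p *v v = v}) \<and> involutive U (\<lambda>p. {v. J p *v v = - v})"

text \<open>The matrix \<open>g p ** J p\<close> represents the bilinear form \<open>(v, w) \<mapsto> g(v, J w)\<close>.\<close>

definition parakaehler :: "(real^4) set \<Rightarrow> (real^4 \<Rightarrow> real^4^4) \<Rightarrow> (real^4 \<Rightarrow> real^4^4) \<Rightarrow> bool" where
  "parakaehler U g J \<longleftrightarrow> metric_on U 2 g \<and> paracomplex U J \<and>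
     (\<forall>p\<in>U. transpose (J p) ** g p = - (g p ** J p)) \<and>
     closed_form U (\<lambda>p. g p ** J p)"

definition conformally_parakaehler ::
    "(real^4) set \<Rightarrow> (real^4 \<Rightarrow> real^4^4) \<Rightarrow> (real^4 \<Rightarrow> real^4^4) \<Rightarrow> bool" where
  "conformally_parakaehler U g J \<longleftrightarrow>
     (\<exists>f. smooth_fun U f \<and> (\<forall>p\<in>U. f p > 0) \<and> parakaehler U (\<lambda>p. f p *\<^sub>R g p) J)"

text \<open>
  The orientation determined by a \<open>g\<close>-skew paracomplex structure \<open>J\<close> is that of the volume form
  \<open>\<omega> \<and> \<omega>\<close>, where \<open>\<omega> = g \<circ> J\<close>; the sum below, divided by 4, is its coefficient.
\<close>

definition induces_orientation ::
    "(real^4) set \<Rightarrow> (real^4 \<Rightarrow> real^4^4) \<Rightarrow> (real^4 \<Rightarrow> real^4^4) \<Rightarrow> real \<Rightarrow> bool" where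
  "induces_orientation U g J \<sigma> \<longleftrightarrow> (\<forall>p\<in>U. let \<omega> = g p ** J p in
     sgn (\<Sum>i\<in>UNIV. \<Sum>j\<in>UNIV. \<Sum>k\<in>UNIV. \<Sum>l\<in>UNIV.
            levi_civita i j k l * \<omega> $ i $ j * \<omega> $ k $ l) = \<sigma>)"


section \<open>The Heisenberg group and Heisenberg four-manifolds\<close>

text \<open>The Heisenberg group is \<open>real^3\<close> in exponential coordinates.\<close>

definition heis_mult :: "real^3 \<Rightarrow> real^3 \<Rightarrow> real^3" where
  "heis_mult x y = vector [x$1 + y$1, x$2 + y$2, x$3 + y$3 + (x$1 * y$2 - x$2 * y$1) / 2]"

definition left_invariant_field :: "(real^3 \<Rightarrow> real^3) \<Rightarrow> bool" where
  "left_invariant_field X \<longleftrightarrow>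
     (\<forall>h x. X (heis_mult h x) = frechet_derivative (heis_mult h) (at x) (X x))"

definition central_field :: "(real^3 \<Rightarrow> real^3) \<Rightarrow> bool" where
  "central_field Z \<longleftrightarrow> left_invariant_field Z \<and>
     (\<forall>X. left_invariant_field X \<longrightarrow> (\<forall>x. lie_bracket Z X x = 0))"

definition left_invariant_form :: "(real^3 \<Rightarrow> real^3^3) \<Rightarrow> bool" where
  "left_invariant_form B \<longleftrightarrow> (\<forall>h x v w.
     frechet_derivative (heis_mult h) (at x) v
       \<bullet> (B (heis_mult h x) *v frechet_derivative (heis_mult h) (at x) w)
     = v \<bullet> (B x *v w))"

text \<open>
  The metrics \<open>h t\<close> on the orbits are left-invariant and Lorentzian, and the center is spacelike
  for each of them.
\<close>

definition spacelike_heisenberg :: "real set \<Rightarrow> (real \<Rightarrow> real^3 \<Rightarrow> real^3^3) \<Rightarrow> bool" where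
  "spacelike_heisenberg I h \<longleftrightarrow> (\<forall>t\<in>I.
     left_invariant_form (h t) \<and> (\<forall>x. has_index 1 (h t x)) \<and>
     (\<forall>Z x. central_field Z \<and> Z x \<noteq> 0 \<longrightarrow> Z x \<bullet> (h t x *v Z x) > 0))"

text \<open>
  The product of the interval \<open>I\<close> with the Heisenberg group is realized in \<open>real^4\<close>, the first
  coordinate being \<open>t\<close> and the remaining ones those of the group.
\<close>

definition heis_manifold :: "real set \<Rightarrow> (real^4) set" where
  "heis_manifold I = {p. p $ 1 \<in> I}"

definition heis_part :: "real^4 \<Rightarrow> real^3" where
  "heis_part p = vector [p $ 2, p $ 3, p $ 4]"

definition dt :: "real^4" where
  "dt = axis 1 1"

definition pull_covector :: "real^3 \<Rightarrow> real^4" where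
  "pull_covector \<alpha> = transpose (matrix heis_part) *v \<alpha>"

definition pull_form :: "real^3^3 \<Rightarrow> real^4^4" where
  "pull_form B = transpose (matrix heis_part) ** B ** matrix heis_part"

definition heis_metric :: "(real \<Rightarrow> real^3 \<Rightarrow> real^3^3) \<Rightarrow> real^4 \<Rightarrow> real^4^4" where
  "heis_metric h p = - tensor dt dt + pull_form (h (p $ 1) (heis_part p))"

text \<open>A frame adapted to the Lorentzian left-invariant metric \<open>B\<close>, and its dual coframe.\<close>

definition adapted_frame ::
    "(real^3 \<Rightarrow> real^3^3) \<Rightarrow> real \<Rightarrow> (3 \<Rightarrow> real^3 \<Rightarrow> real^3) \<Rightarrow> bool" where
  "adapted_frame B k e \<longleftrightarrow>
     (\<forall>i. left_invariant_field (e i)) \<and>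
     (\<forall>x i j. e i x \<bullet> (B x *v e j x) = (if i = j then (if i = 1 then - 1 else 1) else 0)) \<and>
     central_field (e 3) \<and>
     (\<forall>x. lie_bracket (e 1) (e 2) x = - (2 * k) *\<^sub>R e 3 x)"

definition dual_coframe :: "(3 \<Rightarrow> real^3 \<Rightarrow> real^3) \<Rightarrow> (3 \<Rightarrow> real^3 \<Rightarrow> real^3) \<Rightarrow> bool" where
  "dual_coframe e \<theta> \<longleftrightarrow> (\<forall>i j x. \<theta> i x \<bullet> e j x = (if i = j then 1 else 0))"

definition diagonal_family ::
    "(real \<Rightarrow> real) \<Rightarrow> (real \<Rightarrow> real) \<Rightarrow> (3 \<Rightarrow> real^3 \<Rightarrow> real^3) \<Rightarrow> real \<Rightarrow> real^3 \<Rightarrow> real^3^3" where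
  "diagonal_family a b \<theta> t x =
     (1 / (b t)^2) *\<^sub>R (- tensor (\<theta> 1 x) (\<theta> 1 x) + tensor (\<theta> 2 x) (\<theta> 2 x))
     + (1 / (a t)^2) *\<^sub>R tensor (\<theta> 3 x) (\<theta> 3 x)"

definition coframe_at ::
    "(real \<Rightarrow> real) \<Rightarrow> (real \<Rightarrow> real) \<Rightarrow> (3 \<Rightarrow> real^3 \<Rightarrow> real^3) \<Rightarrow> 3 \<Rightarrow> real^4 \<Rightarrow> real^4" where
  "coframe_at a b \<theta> i p =
     (1 / (if i = 3 then a (p $ 1) else b (p $ 1))) *\<^sub>R pull_covector (\<theta> i (heis_part p))"

text \<open>The forms \<open>dt \<and> e\<^sup>i + \<star>(dt \<and> e\<^sup>i)\<close>.\<close>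

definition dual_form ::
    "real \<Rightarrow> (real^4 \<Rightarrow> real^4^4) \<Rightarrow> (real \<Rightarrow> real) \<Rightarrow> (real \<Rightarrow> real) \<Rightarrow> (3 \<Rightarrow> real^3 \<Rightarrow> real^3) \<Rightarrow>
     3 \<Rightarrow> real^4 \<Rightarrow> real^4^4" where
  "dual_form \<sigma> g a b \<theta> i p =
     wedge dt (coframe_at a b \<theta> i p) + hodge \<sigma> (g p) (wedge dt (coframe_at a b \<theta> i p))"

definition smooth_on_interval :: "real set \<Rightarrow> (real \<Rightarrow> real) \<Rightarrow> bool" where
  "smooth_on_interval I f \<longleftrightarrow> (\<forall>n. \<forall>t\<in>I. (deriv ^^ n) f differentiable (at t))"

text \<open>
  The exponent of \<open>a\<close> in the denominator is 2, as invariance under a change of base point requires: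
  replacing \<open>(a, b, k)\<close> by \<open>(a / c, b / d, k d\<^sup>2 / c)\<close> with constants \<open>c, d\<close> describes the same
  metric, and \<open>nu\<close> is unchanged. Printed versions of the formula with exponent 3 agree with it
  only where \<open>a = 1\<close>.
\<close>

definition nu :: "real \<Rightarrow> (real \<Rightarrow> real) \<Rightarrow> (real \<Rightarrow> real) \<Rightarrow> real \<Rightarrow> real \<Rightarrow> real" where
  "nu k a b \<epsilon> t = 16 * k^3 * (b t)^7 /
     (\<epsilon> * (a t)^2 * (3 * k * (b t)^3 + a t * deriv b t))"

end

theory Submission
  imports Defs
begin

text \<open>
  In the coframe \<open>dt, e\<^sup>1\<^sub>t, e\<^sup>2\<^sub>t, e\<^sup>3\<^sub>t\<close> the metric is diagonal and the Levi-Civita connection is read off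
  the structure equations; its coefficients are \<open>\<alpha> = a'/a\<close>, \<open>\<beta> = b'/b\<close> and \<open>\<kappa> = k b\<^sup>2/a\<close>. The resulting
  curvature operator preserves the planes spanned by \<open>dt \<and> e\<^sup>i\<close> and \<open>e\<^sup>j \<and> e\<^sup>k\<close>. Since the Weyl operator
  maps into the self-dual forms, its component on \<open>e\<^sup>1 \<and> e\<^sup>2\<close> determines it; that component involves
  only \<open>3 \<kappa>\<^sup>2 + \<beta>\<^sup>2 - \<Lambda>/3\<close>, which the formula for \<open>\<Lambda>\<close> turns into \<open>8 \<kappa>\<^sup>3 / (3 \<kappa> + \<beta>)\<close>.

  The forms \<open>dt \<and> e\<^sup>3 + \<tau> e\<^sup>1 \<and> e\<^sup>2\<close>, \<open>\<tau> = \<plusminus>1\<close>, have opposite orientations and correspond to skew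
  paracomplex structures. Both become closed after multiplication by \<open>b\<^sup>2 exp (2 \<tau> K)\<close>, where
  \<open>K' = \<kappa>\<close>, because the central coframe element has differential \<open>2 k e\<^sup>1 \<and> e\<^sup>2\<close> at \<open>t\<^sub>0\<close>.
\<close>

section \<open>Directional derivatives and curvature in a moving frame\<close>

text \<open>Curvature, Weyl tensor and Hodge star are defined in coordinates, where the metric is
  not diagonal; expanding the Christoffel symbols there would bury the structure under the entries
  of the central coframe element. Everything is therefore transported by the matrix \<Theta> whose
  rows are the coframe: every two-form is uniquely of the shape
  \<open>transpose \<Theta> ** F ** \<Theta>\<close>, and for each of the three objects one lemma
  says how it acts on \<open>F\<close>. What remains is algebra on the six entries of an alternating
  matrix. The orientation enters this algebra only through the sign
  \<open>s = \<sigma> * sgn (det \<Theta>)\<close>. It is visible in the eigenforms but not in the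
  eigenvalues: self-duality makes every entry of the Weyl operator a fixed multiple, up to
  \<open>s\<close>, of its entry on \<open>e\<^sup>1 \<and> e\<^sup>2\<close>, which is known
  without choosing an orientation.\<close>

definition pd :: "'n::finite \<Rightarrow> (real^'n \<Rightarrow> 'b::real_normed_vector) \<Rightarrow> real^'n \<Rightarrow> 'b" where
  "pd i f p = frechet_derivative f (at p) (axis i 1)"

text \<open>Unlike \<open>partial\<close>, \<open>pd\<close> accepts vector and matrix values, so
  that \<Theta> and the connection matrices can be differentiated as a whole with the product rule
  of a bounded bilinear map.\<close>

lemma partial_eq_pd: "partial i f p = pd i f p"
  by (simp add: partial_def pd_def)

lemma pd_eqI: "(f has_derivative f') (at p) \<Longrightarrow> pd i f p = f' (axis i 1)"
  by (simp add: pd_def frechet_derivative_at [symmetric])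

lemma differentiable_has_derivative:
  "f differentiable (at p) \<Longrightarrow> (f has_derivative frechet_derivative f (at p)) (at p)"
  by (simp add: frechet_derivative_works)

lemma (in bounded_linear) differentiable_compose:
  "g differentiable (at p) \<Longrightarrow> (\<lambda>x. f (g x)) differentiable (at p)"
  unfolding differentiable_def using has_derivative by blast

lemma (in bounded_bilinear) differentiable_prod:
  "f differentiable (at p) \<Longrightarrow> g differentiable (at p) \<Longrightarrow>
    (\<lambda>x. prod (f x) (g x)) differentiable (at p)"
  unfolding differentiable_def using FDERIV by blast

lemma differentiable_vec:
  fixes f :: "'a::euclidean_space \<Rightarrow> 'b::euclidean_space^'m"
  assumes "\<And>i. (\<lambda>x. f x $ i) differentiable (at p)"
  shows "f differentiable (at p)"
proof -
  have "f = (\<lambda>x. \<Sum>i\<in>UNIV. axis i (f x $ i))"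
    by (auto simp: vec_eq_iff axis_def if_distrib sum.delta cong: if_cong)
  moreover have "bounded_linear (\<lambda>v. axis i v :: 'b^'m)" for i
    by (intro linear_conv_bounded_linear [THEN iffD1] linearI) (auto simp: vec_eq_iff axis_def)
  then have "(\<lambda>x. axis i (f x $ i) :: 'b^'m) differentiable (at p)" for i
    using assms [of i] by (metis bounded_linear.differentiable_compose)
  then have "(\<lambda>x. \<Sum>i\<in>UNIV. axis i (f x $ i) :: 'b^'m) differentiable (at p)"
    by (intro differentiable_sum) auto
  ultimately show ?thesis
    by simp
qed

lemma differentiable_nth:
  fixes f :: "'a::euclidean_space \<Rightarrow> 'b::euclidean_space^'m"
  shows "f differentiable (at p) \<Longrightarrow> (\<lambda>x. f x $ i) differentiable (at p)"
  by (rule bounded_linear.differentiable_compose [OF bounded_linear_vec_nth])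

lemma pd_nth:
  "f differentiable (at p) \<Longrightarrow> pd i (\<lambda>x. f x $ j) p = pd i f p $ j"
  by (drule differentiable_has_derivative, drule bounded_linear.has_derivative [OF bounded_linear_vec_nth, of _ _ _ j],
      drule pd_eqI [of "\<lambda>x. f x $ j"]) (simp add: pd_def)

lemma pd_const [simp]: "pd i (\<lambda>x. c) p = 0"
  by (simp add: pd_def)

lemma pd_add:
  assumes "f differentiable (at p)" "g differentiable (at p)"
  shows "pd i (\<lambda>x. f x + g x) p = pd i f p + pd i g p"
  using pd_eqI [OF has_derivative_add [OF assms [THEN differentiable_has_derivative]]]
  by (simp add: pd_def)

lemma pd_diff:
  assumes "f differentiable (at p)" "g differentiable (at p)"
  shows "pd i (\<lambda>x. f x - g x) p = pd i f p - pd i g p"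
  using pd_eqI [OF has_derivative_diff [OF assms [THEN differentiable_has_derivative]]]
  by (simp add: pd_def)

lemma pd_sum:
  assumes "\<And>j. j \<in> J \<Longrightarrow> f j differentiable (at p)"
  shows "pd i (\<lambda>x. \<Sum>j\<in>J. f j x) p = (\<Sum>j\<in>J. pd i (f j) p)"
  using pd_eqI [OF has_derivative_sum, of J f, OF assms [THEN differentiable_has_derivative]]
  by (simp add: pd_def)

lemma (in bounded_bilinear) pd_prod:
  assumes "f differentiable (at p)" "g differentiable (at p)"
  shows "pd i (\<lambda>x. prod (f x) (g x)) p = prod (f p) (pd i g p) + prod (pd i f p) (g p)"
  using pd_eqI [OF FDERIV [OF assms [THEN differentiable_has_derivative]]]
  by (simp add: pd_def)

lemmas pd_mult = bounded_bilinear.pd_prod [OF bounded_bilinear_mult]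
lemmas pd_scaleR = bounded_bilinear.pd_prod [OF bounded_bilinear_scaleR]

lemma bounded_bilinear_matrix_mult:
  "bounded_bilinear ((**) :: real^'n^'m \<Rightarrow> real^'l^'n \<Rightarrow> real^'l^'m)"
  by (intro bilinear_conv_bounded_bilinear [THEN iffD1])
    (auto simp: bilinear_def intro!: linearI
      simp: vec_eq_iff matrix_matrix_mult_def algebra_simps sum.distrib sum_distrib_left)

lemmas pd_matrix_mult = bounded_bilinear.pd_prod [OF bounded_bilinear_matrix_mult]
lemmas differentiable_matrix_mult = bounded_bilinear.differentiable_prod [OF bounded_bilinear_matrix_mult]

lemma bounded_linear_transpose: "bounded_linear (transpose :: real^'n^'m \<Rightarrow> real^'m^'n)"
  by (intro linear_conv_bounded_linear [THEN iffD1] linearI) (auto simp: vec_eq_iff transpose_def)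

lemma pd_transpose:
  fixes A :: "real^'k::finite \<Rightarrow> real^'n^'m"
  assumes "A differentiable (at p)"
  shows "pd i (\<lambda>x. transpose (A x)) p = transpose (pd i A p)"
  using pd_eqI [OF bounded_linear.has_derivative [OF bounded_linear_transpose differentiable_has_derivative [OF assms]]]
  by (simp add: pd_def)

lemmas differentiable_transpose = bounded_linear.differentiable_compose [OF bounded_linear_transpose]

lemma differentiable_cong_open:
  assumes "open U" "p \<in> U" "\<And>x. x \<in> U \<Longrightarrow> f x = g x" "f differentiable (at p)"
  shows "g differentiable (at p)"
  using assms unfolding differentiable_def by (metis has_derivative_transform_within_open)

text \<open>No differentiability is required: both functions have the same derivatives at
  \<open>p\<close>, so the choice inside \<open>frechet_derivative\<close> returns the same value
  for both even if there is no derivative.\<close>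

lemma pd_cong_open:
  assumes "open U" "p \<in> U" "\<And>x. x \<in> U \<Longrightarrow> f x = g x"
  shows "pd i f p = pd i g p"
proof -
  have "(f has_derivative D) (at p) \<longleftrightarrow> (g has_derivative D) (at p)" for D
    using assms by (metis has_derivative_transform_within_open)
  then show ?thesis
    by (simp add: pd_def frechet_derivative_def)
qed

section \<open>Matrix products and inverses\<close>

lemmas matrix_mult_simps =
  bounded_bilinear.add_left [OF bounded_bilinear_matrix_mult]
  bounded_bilinear.add_right [OF bounded_bilinear_matrix_mult]
  bounded_bilinear.diff_left [OF bounded_bilinear_matrix_mult]
  bounded_bilinear.diff_right [OF bounded_bilinear_matrix_mult]
  bounded_bilinear.minus_left [OF bounded_bilinear_matrix_mult]
  bounded_bilinear.minus_right [OF bounded_bilinear_matrix_mult]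
  bounded_bilinear.scaleR_left [OF bounded_bilinear_matrix_mult]
  bounded_bilinear.scaleR_right [OF bounded_bilinear_matrix_mult]
  bounded_bilinear.sum_left [OF bounded_bilinear_matrix_mult]
  bounded_bilinear.sum_right [OF bounded_bilinear_matrix_mult]
  bounded_bilinear.zero_left [OF bounded_bilinear_matrix_mult]
  bounded_bilinear.zero_right [OF bounded_bilinear_matrix_mult]

lemma matrix_inv_mult:
  fixes A :: "real^'n^'m"
  assumes "invertible A"
  shows "A ** matrix_inv A = mat 1" "matrix_inv A ** A = mat 1"
  using someI_ex [OF assms [unfolded invertible_def]] by (simp_all add: matrix_inv_def)

lemma matrix_inv_unique:
  fixes A :: "real^'n^'n"
  assumes "B ** A = mat 1"
  shows "matrix_inv A = B" "A ** B = mat 1" "invertible A"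
proof -
  show i: "invertible A" "A ** B = mat 1"
    using assms invertible_left_inverse matrix_left_right_inverse by blast+
  have "B ** (A ** matrix_inv A) = matrix_inv A"
    by (simp only: matrix_mul_assoc assms matrix_mul_lid)
  then show "matrix_inv A = B"
    by (simp add: matrix_inv_mult i)
qed

text \<open>Uniqueness of the Levi-Civita connection at a point: for torsion-free and metric
  candidates \<open>G i\<close>, the Koszul combination of three metric derivatives collapses to
  twice the lowered symbol.\<close>

lemma christoffel_eqI:
  fixes g :: "real^'n \<Rightarrow> real^'n^'n" and G :: "'n \<Rightarrow> real^'n^'n"
  assumes sym: "transpose (g p) = g p" and inv: "invertible (g p)"
    and tor: "\<And>m i j. G i $ m $ j = G j $ m $ i"
    and met: "\<And>i j l. partial i (\<lambda>q. g q $ j $ l) p = (transpose (G i) ** g p + g p ** G i) $ j $ l"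
  shows "christoffel g m i j p = G i $ m $ j"
proof -
  have gs: "g p $ x $ y = g p $ y $ x" for x y
    using sym by (metis transpose_def vec_lambda_beta)
  \<comment> \<open>The lowered symbol: the inner product of the l-th coordinate vector with the
    covariant derivative of the j-th along the i-th.\<close>
  define T where "T i j l = (\<Sum>n\<in>UNIV. g p $ l $ n * G i $ n $ j)" for i j l
  have T: "T i j l = T j i l" for i j l
    unfolding T_def by (subst tor) simp
  have "partial i (\<lambda>q. g q $ j $ l) p = T i j l + T i l j" for i j l
    unfolding met T_def by (simp add: matrix_matrix_mult_def transpose_def gs [of _ l] mult.commute)
  then have s: "partial i (\<lambda>q. g q $ j $ l) p + partial j (\<lambda>q. g q $ i $ l) p
       - partial l (\<lambda>q. g q $ i $ j) p = 2 * (\<Sum>n\<in>UNIV. g p $ l $ n * G i $ n $ j)" for l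
    using T [of i j l] T [of i l j] T [of j l i] by (simp add: T_def)
  have "matrix_inv (g p) ** (g p ** G i) = G i"
    by (simp add: matrix_mul_assoc matrix_inv_mult inv)
  then have "(matrix_inv (g p) ** (g p ** G i)) $ m $ j = G i $ m $ j"
    by simp
  then show ?thesis
    by (simp add: christoffel_def s matrix_matrix_mult_def sum_distrib_left)
qed

text \<open>With the Christoffel symbols read as matrices \<open>G i\<close>, the curvature is dG +
  G wedge G, and a change of frame becomes a matrix identity.\<close>

lemma riemann_up_matrix:
  fixes g :: "real^'n \<Rightarrow> real^'n^'n"
  assumes "open U" "p \<in> U"
    and c: "\<And>q m i j. q \<in> U \<Longrightarrow> christoffel g m i j q = G i q $ m $ j"
    and d: "\<And>i. G i differentiable (at p)"
  shows "riemann_up g m k i j p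
    = (pd i (G j) p - pd j (G i) p + G i p ** G j p - G j p ** G i p) $ m $ k"
proof -
  have "pd i (christoffel g m j k) p = pd i (G j) p $ m $ k" for i j
  proof -
    have "pd i (christoffel g m j k) p = pd i (\<lambda>q. G j q $ m $ k) p"
      using assms by (intro pd_cong_open) auto
    then show ?thesis
      by (simp add: pd_nth d differentiable_nth)
  qed
  then show ?thesis
    using assms by (simp add: riemann_up_def partial_eq_pd matrix_matrix_mult_def sum_subtractf)
qed

text \<open>Cartan's second structure equation. \<open>torsion\<close> is the first one, d\<Theta> +
  \<omega> wedge \<Theta> = 0, and \<open>skew\<close> puts \<omega> into the Lie algebra of \<eta>.
  Together they make the gauge transform of \<omega> by \<Theta> the Levi-Civita connection in
  coordinates, and the curvature of a gauge transform is the conjugate of the original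
  curvature.\<close>

lemma riemann_up_frame:
  fixes g \<Theta> E :: "real^'n \<Rightarrow> real^'n^'n" and \<omega> :: "'n \<Rightarrow> real^'n \<Rightarrow> real^'n^'n"
  assumes U: "open U" "p \<in> U"
    and inv: "\<And>q. q \<in> U \<Longrightarrow> E q ** \<Theta> q = mat 1"
    and diff: "\<And>q. q \<in> U \<Longrightarrow> E differentiable (at q)" "\<And>q. q \<in> U \<Longrightarrow> \<Theta> differentiable (at q)"
      "\<And>q i. q \<in> U \<Longrightarrow> pd i \<Theta> differentiable (at q)" "\<And>q i. q \<in> U \<Longrightarrow> \<omega> i differentiable (at q)"
    and mixed: "\<And>i j. pd i (pd j \<Theta>) p = pd j (pd i \<Theta>) p"
    and g: "\<And>q. q \<in> U \<Longrightarrow> g q = transpose (\<Theta> q) ** \<eta> ** \<Theta> q"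
    and \<eta>: "transpose \<eta> = \<eta>" "invertible \<eta>"
    and skew: "\<And>q i. q \<in> U \<Longrightarrow> transpose (\<omega> i q) ** \<eta> = - (\<eta> ** \<omega> i q)"
    and torsion: "\<And>q a i j. q \<in> U \<Longrightarrow>
      (\<omega> i q ** \<Theta> q + pd i \<Theta> q) $ a $ j = (\<omega> j q ** \<Theta> q + pd j \<Theta> q) $ a $ i"
  shows "riemann_up g m k i j p
    = (E p ** (pd i (\<omega> j) p - pd j (\<omega> i) p + \<omega> i p ** \<omega> j p - \<omega> j p ** \<omega> i p) ** \<Theta> p) $ m $ k"
proof -
  \<comment> \<open>The Christoffel matrices are \<open>G i\<close>. Since \<open>\<Theta> G i = N i\<close>, computing \<open>\<Theta>\<close> times the curvature
    avoids derivatives of \<open>E\<close>.\<close>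
  define N where "N i q = \<omega> i q ** \<Theta> q + pd i \<Theta> q" for i q
  define G where "G i q = E q ** N i q" for i q
  have inv': "\<Theta> q ** E q = mat 1" if "q \<in> U" for q
    using inv [OF that] matrix_left_right_inverse by blast
  have \<Theta>G: "\<Theta> q ** G i q = N i q" if "q \<in> U" for q i
    by (simp add: G_def matrix_mul_assoc inv' that)
  have dN: "N i differentiable (at q)" if "q \<in> U" for q i
    unfolding N_def using that by (intro differentiable_add differentiable_matrix_mult diff)
  have dG: "G i differentiable (at q)" if "q \<in> U" for q i
    unfolding G_def using that by (intro differentiable_matrix_mult diff dN)
  have c: "christoffel g m i j q = G i q $ m $ j" if q: "q \<in> U" for m i j q
  proof (rule christoffel_eqI)
    show "transpose (g q) = g q"
      by (simp add: g q matrix_transpose_mul \<eta> matrix_mul_assoc)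
    have "invertible (\<Theta> q)" "invertible (transpose (\<Theta> q))"
      using matrix_inv_unique(3) [OF inv [OF q]]
        matrix_inv_unique(3) [of "transpose (E q)" "transpose (\<Theta> q)"] inv' [OF q]
      by (simp_all add: matrix_transpose_mul [symmetric] transpose_mat)
    then show "invertible (g q)"
      by (simp add: g q invertible_mult \<eta>)
    show "G i q $ m $ j = G j q $ m $ i" for m i j
      using torsion [OF q] by (simp add: G_def N_def matrix_matrix_mult_def)
    show "partial i (\<lambda>q. g q $ j $ l) q = (transpose (G i q) ** g q + g q ** G i q) $ j $ l" for i j l
    proof -
      have d: "(\<lambda>q. transpose (\<Theta> q) ** \<eta> ** \<Theta> q) differentiable (at q)"
        using q by (intro differentiable_matrix_mult differentiable_transpose diff differentiable_const)
      have "transpose (G i q) ** g q = transpose (\<Theta> q ** G i q) ** \<eta> ** \<Theta> q"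
        by (simp add: g q matrix_transpose_mul matrix_mul_assoc)
      also have "\<dots> = transpose (\<Theta> q) ** (transpose (\<omega> i q) ** \<eta>) ** \<Theta> q + transpose (pd i \<Theta> q) ** \<eta> ** \<Theta> q"
        by (simp add: \<Theta>G q N_def matrix_mult_simps matrix_transpose_mul matrix_mul_assoc
            bounded_linear.linear [OF bounded_linear_transpose, THEN linear_add])
      finally have 1: "transpose (G i q) ** g q
        = - (transpose (\<Theta> q) ** (\<eta> ** \<omega> i q) ** \<Theta> q) + transpose (pd i \<Theta> q) ** \<eta> ** \<Theta> q"
        by (simp add: skew q matrix_mult_simps)
      have "g q ** G i q = transpose (\<Theta> q) ** \<eta> ** (\<Theta> q ** G i q)"
        by (simp add: g q matrix_mul_assoc)
      then have 2: "g q ** G i q = transpose (\<Theta> q) ** (\<eta> ** \<omega> i q) ** \<Theta> q + transpose (\<Theta> q) ** \<eta> ** pd i \<Theta> q"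
        by (simp add: \<Theta>G q N_def matrix_mult_simps matrix_mul_assoc)
      have "partial i (\<lambda>q. g q $ j $ l) q = pd i (\<lambda>q. (transpose (\<Theta> q) ** \<eta> ** \<Theta> q) $ j $ l) q"
        unfolding partial_eq_pd using q by (intro pd_cong_open [OF U(1)]) (simp_all add: g)
      also have "\<dots> = pd i (\<lambda>q. transpose (\<Theta> q) ** \<eta> ** \<Theta> q) q $ j $ l"
        by (simp add: pd_nth d differentiable_nth)
      also have "pd i (\<lambda>q. transpose (\<Theta> q) ** \<eta> ** \<Theta> q) q
          = transpose (\<Theta> q) ** \<eta> ** pd i \<Theta> q + transpose (pd i \<Theta> q) ** \<eta> ** \<Theta> q"
        using q by (simp add: pd_matrix_mult pd_transpose differentiable_matrix_mult differentiable_transpose diff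
            matrix_mult_simps)
      finally show ?thesis
        by (simp add: 1 2)
    qed
  qed
  let ?R = "pd i (G j) p - pd j (G i) p + G i p ** G j p - G j p ** G i p"
  have dNp: "pd i (N j) p = pd i (\<omega> j) p ** \<Theta> p + \<omega> j p ** pd i \<Theta> p + pd i (pd j \<Theta>) p" for i j
    unfolding N_def using U
    by (simp add: pd_add pd_matrix_mult differentiable_matrix_mult diff)
  have dGp: "\<Theta> p ** pd i (G j) p = pd i (N j) p - pd i \<Theta> p ** G j p" for i j
  proof -
    have "pd i (N j) p = pd i (\<lambda>q. \<Theta> q ** G j q) p"
      using U by (intro pd_cong_open) (auto simp: \<Theta>G)
    then show ?thesis
      using U by (simp add: pd_matrix_mult diff dG)
  qed
  have GG: "\<Theta> p ** (G i p ** G j p) = \<omega> i p ** N j p + pd i \<Theta> p ** G j p" for i j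
  proof -
    have "\<Theta> p ** (G i p ** G j p) = N i p ** G j p"
      by (simp add: matrix_mul_assoc \<Theta>G U)
    also have "\<dots> = \<omega> i p ** (\<Theta> p ** G j p) + pd i \<Theta> p ** G j p"
      by (simp add: N_def matrix_mult_simps matrix_mul_assoc)
    finally show ?thesis
      by (simp add: \<Theta>G U)
  qed
  \<comment> \<open>The terms with a derivative of \<Theta> times \<open>G\<close> cancel between
    \<open>dGp\<close> and \<open>GG\<close>, the second derivatives of \<Theta> cancel by
    \<open>mixed\<close>, and the products of \<omega> with a derivative of \<Theta> cancel once
    \<open>N\<close> is unfolded.\<close>
  have "\<Theta> p ** ?R = (pd i (\<omega> j) p - pd j (\<omega> i) p + \<omega> i p ** \<omega> j p - \<omega> j p ** \<omega> i p) ** \<Theta> p"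
    by (simp add: matrix_mult_simps dGp GG dNp mixed [of i j])
      (simp add: N_def matrix_mult_simps matrix_mul_assoc)
  then have "E p ** (\<Theta> p ** ?R)
      = E p ** (pd i (\<omega> j) p - pd j (\<omega> i) p + \<omega> i p ** \<omega> j p - \<omega> j p ** \<omega> i p) ** \<Theta> p"
    by (simp add: matrix_mul_assoc)
  moreover have "E p ** (\<Theta> p ** ?R) = ?R"
    by (simp only: matrix_mul_assoc inv U matrix_mul_lid)
  ultimately have R: "?R = E p ** (pd i (\<omega> j) p - pd j (\<omega> i) p + \<omega> i p ** \<omega> j p - \<omega> j p ** \<omega> i p) ** \<Theta> p"
    by simp
  have "riemann_up g m k i j p = ?R $ m $ k"
    using U by (intro riemann_up_matrix c dG)
  then show ?thesis
    unfolding R .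
qed

section \<open>Smooth functions\<close>

lemma fold_partial_cong:
  assumes U: "open U" and "\<And>p. p \<in> U \<Longrightarrow> f p = g p" and "p \<in> U"
  shows "fold partial is f p = fold partial is g p"
  using assms(2,3)
proof (induction "is" arbitrary: f g p)
  case (Cons i "is")
  have "partial i f q = partial i g q" if "q \<in> U" for q
    unfolding partial_eq_pd using Cons.prems that by (intro pd_cong_open [OF U])
  then show ?case
    using Cons.IH [of "partial i f" "partial i g" p] Cons.prems(2) by simp
qed simp

text \<open>\<open>S\<close> serves as an invariant: every iterated derivative of a member agrees
  with a member on \<open>U\<close>. Agreement is asked for on \<open>U\<close> only, since the
  formulas for derivatives are available only there.\<close>

lemma smooth_fun_coinduct:
  assumes U: "open U" and "f \<in> S"
    and "\<And>f p. f \<in> S \<Longrightarrow> p \<in> U \<Longrightarrow> f differentiable (at p)"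
    and "\<And>f i. f \<in> S \<Longrightarrow> \<exists>g\<in>S. \<forall>p\<in>U. partial i f p = g p"
  shows "smooth_fun U f"
proof -
  have "\<exists>g\<in>S. \<forall>p\<in>U. fold partial is f p = g p" for "is"
    using \<open>f \<in> S\<close>
  proof (induction "is" arbitrary: f)
    case (Cons i "is")
    then obtain g where g: "g \<in> S" "\<And>p. p \<in> U \<Longrightarrow> partial i f p = g p"
      using assms(4) by blast
    then show ?case
      using Cons.IH [OF g(1)] fold_partial_cong [OF U, of "partial i f" g _ "is"] by simp
  qed auto
  then have "fold partial is f differentiable (at p)" if p: "p \<in> U" for p "is"
  proof -
    obtain g where g: "g \<in> S" "\<And>q. q \<in> U \<Longrightarrow> g q = fold partial is f q"
      using \<open>\<And>is. \<exists>g\<in>S. \<forall>p\<in>U. fold partial is f p = g p\<close> [of "is"] by auto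
    show ?thesis
      by (rule differentiable_cong_open [OF U p g(2) assms(3) [OF g(1) p]])
  qed
  then show ?thesis
    by (simp add: smooth_fun_def)
qed

lemma smooth_fun_differentiable: "smooth_fun U f \<Longrightarrow> p \<in> U \<Longrightarrow> f differentiable (at p)"
  unfolding smooth_fun_def by (metis fold_simps(1))

lemma smooth_fun_partial: "smooth_fun U f \<Longrightarrow> smooth_fun U (partial i f)"
  unfolding smooth_fun_def by (metis fold_simps(2))

lemma smooth_funI:
  assumes "\<And>p. p \<in> U \<Longrightarrow> f differentiable (at p)" "\<And>i. smooth_fun U (partial i f)"
  shows "smooth_fun U f"
  unfolding smooth_fun_def
proof (intro allI ballI)
  fix "is" p assume "p \<in> U"
  then show "fold partial is f differentiable (at p)"
    using assms by (cases "is") (auto simp: smooth_fun_def)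
qed

lemma smooth_fun_cong:
  assumes "open U" "smooth_fun U f" "\<And>p. p \<in> U \<Longrightarrow> f p = g p"
  shows "smooth_fun U g"
  unfolding smooth_fun_def
proof (intro allI ballI)
  fix "is" p assume p: "p \<in> U"
  show "fold partial is g differentiable (at p)"
    using assms(1) p
  proof (rule differentiable_cong_open)
    show "fold partial is f q = fold partial is g q" if "q \<in> U" for q
      using assms that by (intro fold_partial_cong) auto
    show "fold partial is f differentiable (at p)"
      using assms(2) p by (auto simp: smooth_fun_def)
  qed
qed

lemma smooth_fun_const [simp]:
  fixes U :: "(real^'n) set"
  shows "smooth_fun U (\<lambda>p. c)"
proof -
  have [simp]: "partial i (\<lambda>p :: real^'n. c) = (\<lambda>p. 0)" for i :: 'n and c :: real
    by (simp add: partial_eq_pd fun_eq_iff)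
  have "fold partial is (\<lambda>p :: real^'n. c) = (\<lambda>p. c) \<or> fold partial is (\<lambda>p :: real^'n. c) = (\<lambda>p. 0)"
    for "is" and c :: real
    by (induction "is" arbitrary: c) (auto)
  then show ?thesis
    unfolding smooth_fun_def by (metis differentiable_const)
qed

text \<open>Derivatives of products, reciprocals and exponentials are again sums and products of
  such expressions. The closure collects all of them at once and so provides a set stable under
  partial derivatives, as coinduction requires.\<close>

inductive_set smooth_closure :: "(real^'n::finite) set \<Rightarrow> (real^'n \<Rightarrow> real) set" for U where
  smooth_closure_base: "smooth_fun U f \<Longrightarrow> f \<in> smooth_closure U"
| smooth_closure_add: "f \<in> smooth_closure U \<Longrightarrow> g \<in> smooth_closure U \<Longrightarrow> (\<lambda>p. f p + g p) \<in> smooth_closure U"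
| smooth_closure_mult: "f \<in> smooth_closure U \<Longrightarrow> g \<in> smooth_closure U \<Longrightarrow> (\<lambda>p. f p * g p) \<in> smooth_closure U"
| smooth_closure_inverse: "f \<in> smooth_closure U \<Longrightarrow> (\<And>p. p \<in> U \<Longrightarrow> f p \<noteq> 0) \<Longrightarrow>
    (\<lambda>p. inverse (f p)) \<in> smooth_closure U"
| smooth_closure_exp: "f \<in> smooth_closure U \<Longrightarrow> (\<lambda>p. exp (f p)) \<in> smooth_closure U"

lemmas smooth_closure_intros = smooth_closure_add smooth_closure_mult smooth_closure_inverse smooth_closure_exp

lemma smooth_closure_differentiable:
  "f \<in> smooth_closure U \<Longrightarrow> p \<in> U \<Longrightarrow> f differentiable (at p)"
proof (induction rule: smooth_closure.induct)
  case (smooth_closure_exp f)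
  then have "((\<lambda>p. exp (f p)) has_derivative (\<lambda>x. exp (f p) * frechet_derivative f (at p) x)) (at p)"
    by (auto intro!: derivative_eq_intros differentiable_has_derivative)
  then show ?case
    by (rule differentiableI)
qed (blast intro: smooth_fun_differentiable differentiable_add differentiable_mult differentiable_inverse)+

lemma smooth_closure_partial:
  assumes "f \<in> smooth_closure U"
  shows "\<exists>g\<in>smooth_closure U. \<forall>p\<in>U. partial i f p = g p"
  using assms
proof induction
  case (smooth_closure_base f)
  then have "partial i f \<in> smooth_closure U"
    by (intro smooth_closure.smooth_closure_base smooth_fun_partial)
  then show ?case
    by blast
next
  case (smooth_closure_add f g)
  then obtain f' g' where f'g': "f' \<in> smooth_closure U" "g' \<in> smooth_closure U"
    "\<And>p. p \<in> U \<Longrightarrow> pd i f p = f' p" "\<And>p. p \<in> U \<Longrightarrow> pd i g p = g' p"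
    unfolding partial_eq_pd by blast
  have "pd i (\<lambda>p. f p + g p) p = f' p + g' p" if p: "p \<in> U" for p
    using smooth_closure_add.hyps [THEN smooth_closure_differentiable, OF p] f'g' p by (simp add: pd_add)
  with smooth_closure.smooth_closure_add [OF f'g'(1,2)] show ?case
    unfolding partial_eq_pd by (intro bexI ballI)
next
  case (smooth_closure_mult f g)
  then obtain f' g' where f'g': "f' \<in> smooth_closure U" "g' \<in> smooth_closure U"
    "\<And>p. p \<in> U \<Longrightarrow> pd i f p = f' p" "\<And>p. p \<in> U \<Longrightarrow> pd i g p = g' p"
    unfolding partial_eq_pd by blast
  have "pd i (\<lambda>p. f p * g p) p = f p * g' p + f' p * g p" if p: "p \<in> U" for p
    using smooth_closure_mult.hyps [THEN smooth_closure_differentiable, OF p] f'g' p by (simp add: pd_mult)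
  moreover have "(\<lambda>p. f p * g' p + f' p * g p) \<in> smooth_closure U"
    using smooth_closure_mult.hyps f'g' by (intro smooth_closure_intros)
  ultimately show ?case
    unfolding partial_eq_pd by (intro bexI ballI)
next
  case (smooth_closure_inverse f)
  then obtain f' where f': "f' \<in> smooth_closure U" "\<And>p. p \<in> U \<Longrightarrow> pd i f p = f' p"
    unfolding partial_eq_pd by blast
  \<comment> \<open>The derivative is arranged so that only closure operations occur; negation is
    multiplication by the constant -1.\<close>
  have "pd i (\<lambda>p. inverse (f p)) p = (- 1) * (inverse (f p) * (f' p * inverse (f p)))" if p: "p \<in> U" for p
  proof -
    have "((\<lambda>p. inverse (f p)) has_derivative
        (\<lambda>x. - (inverse (f p) * frechet_derivative f (at p) x * inverse (f p)))) (at p)"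
      using p smooth_closure_inverse.hyps smooth_closure_differentiable
      by (intro Deriv.has_derivative_inverse differentiable_has_derivative)
    then have "pd i (\<lambda>p. inverse (f p)) p = - (inverse (f p) * pd i f p * inverse (f p))"
      using pd_eqI by (fastforce simp: pd_def)
    then show ?thesis
      using f' p by simp
  qed
  moreover have "(\<lambda>p. (- 1) * (inverse (f p) * (f' p * inverse (f p)))) \<in> smooth_closure U"
    using smooth_closure_inverse.hyps f'
    by (intro smooth_closure_intros smooth_closure_base [OF smooth_fun_const])
  ultimately show ?case
    unfolding partial_eq_pd by (intro bexI ballI)
next
  case (smooth_closure_exp f)
  then obtain f' where f': "f' \<in> smooth_closure U" "\<And>p. p \<in> U \<Longrightarrow> pd i f p = f' p"
    unfolding partial_eq_pd by blast
  have "pd i (\<lambda>p. exp (f p)) p = exp (f p) * f' p" if p: "p \<in> U" for p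
  proof -
    have "((\<lambda>p. exp (f p)) has_derivative (\<lambda>x. exp (f p) * frechet_derivative f (at p) x)) (at p)"
      using differentiable_has_derivative [OF smooth_closure_differentiable [OF smooth_closure_exp.hyps p]]
      by (auto intro!: derivative_eq_intros)
    then have "pd i (\<lambda>p. exp (f p)) p = exp (f p) * pd i f p"
      using pd_eqI by (fastforce simp: pd_def)
    then show ?thesis
      using f' p by simp
  qed
  moreover have "(\<lambda>p. exp (f p) * f' p) \<in> smooth_closure U"
    using smooth_closure_exp.hyps f' by (intro smooth_closure_intros)
  ultimately show ?case
    unfolding partial_eq_pd by (intro bexI ballI)
qed

lemma smooth_closure_smooth:
  "open U \<Longrightarrow> f \<in> smooth_closure U \<Longrightarrow> smooth_fun U f"
  by (rule smooth_fun_coinduct [OF _ _ smooth_closure_differentiable smooth_closure_partial])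

context
  fixes U :: "(real^'n) set" and f g :: "real^'n \<Rightarrow> real"
  assumes U: "open U" and f: "smooth_fun U f"
begin

lemma smooth_fun_add: "smooth_fun U g \<Longrightarrow> smooth_fun U (\<lambda>p. f p + g p)"
  by (rule smooth_closure_smooth [OF U smooth_closure_add]) (auto intro: f smooth_closure_base)

lemma smooth_fun_mult: "smooth_fun U g \<Longrightarrow> smooth_fun U (\<lambda>p. f p * g p)"
  by (rule smooth_closure_smooth [OF U smooth_closure_mult]) (auto intro: f smooth_closure_base)

lemma smooth_fun_inverse: "(\<And>p. p \<in> U \<Longrightarrow> f p \<noteq> 0) \<Longrightarrow> smooth_fun U (\<lambda>p. inverse (f p))"
  by (rule smooth_closure_smooth [OF U smooth_closure_inverse]) (auto intro: f smooth_closure_base)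

lemma smooth_fun_exp: "smooth_fun U (\<lambda>p. exp (f p))"
  by (rule smooth_closure_smooth [OF U smooth_closure_exp]) (auto intro: f smooth_closure_base)

end

lemma smooth_fun_sum:
  "open U \<Longrightarrow> (\<And>i. i \<in> J \<Longrightarrow> smooth_fun U (f i)) \<Longrightarrow> smooth_fun U (\<lambda>p. \<Sum>i\<in>J. f i p)"
proof (induction J rule: infinite_finite_induct)
  case (insert j J)
  then show ?case
    using smooth_fun_add [of U "f j" "\<lambda>p. \<Sum>i\<in>J. f i p"] by simp
qed simp_all

lemma smooth_fun_minus: "open U \<Longrightarrow> smooth_fun U f \<Longrightarrow> smooth_fun U (\<lambda>p. - f p)"
  using smooth_fun_mult [of U "\<lambda>p. - 1" f] by simp

lemma smooth_fun_diff: "open U \<Longrightarrow> smooth_fun U f \<Longrightarrow> smooth_fun U g \<Longrightarrow> smooth_fun U (\<lambda>p. f p - g p)"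
  using smooth_fun_add [of U f "\<lambda>p. - g p"] smooth_fun_minus [of U g] by simp

lemma smooth_fun_divide:
  "open U \<Longrightarrow> smooth_fun U f \<Longrightarrow> smooth_fun U g \<Longrightarrow> (\<And>p. p \<in> U \<Longrightarrow> g p \<noteq> 0) \<Longrightarrow>
    smooth_fun U (\<lambda>p. f p / g p)"
  using smooth_fun_mult [of U f "\<lambda>p. inverse (g p)"] smooth_fun_inverse [of U g]
  by (simp add: divide_inverse)

lemma smooth_fun_power: "open U \<Longrightarrow> smooth_fun U f \<Longrightarrow> smooth_fun U (\<lambda>p. f p ^ n)"
proof (induction n)
  case (Suc n)
  then show ?case
    using smooth_fun_mult [of U f "\<lambda>p. f p ^ n"] by simp
qed simp

section \<open>Functions of a single coordinate, and smooth matrices\<close>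

lemma has_derivative_coord: "((\<lambda>p. p $ j) has_derivative (\<lambda>v. v $ j)) (at p)"
  by (rule bounded_linear_imp_has_derivative) (rule bounded_linear_vec_nth)

lemma smooth_fun_coord: "smooth_fun U (\<lambda>p. p $ j)"
proof (rule smooth_funI)
  show "(\<lambda>p. p $ j) differentiable (at p)" for p :: "real^'a"
    using has_derivative_coord by (rule differentiableI)
  have "partial i (\<lambda>p. p $ j) = (\<lambda>p. axis i 1 $ j)" for i :: 'a
    by (simp add: fun_eq_iff partial_eq_pd pd_eqI [OF has_derivative_coord])
  then show "smooth_fun U (partial i (\<lambda>p. p $ j))" for i
    by simp
qed

lemma has_derivative_coord_compose:
  fixes F :: "real \<Rightarrow> real"
  assumes "F differentiable (at (p $ j))"
  shows "((\<lambda>p. F (p $ j)) has_derivative (\<lambda>v. v $ j * deriv F (p $ j))) (at p)"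
proof -
  have "(F has_field_derivative deriv F (p $ j)) (at (p $ j))"
    using assms by (simp add: DERIV_deriv_iff_real_differentiable)
  then show ?thesis
    using has_derivative_compose [OF has_derivative_coord, of F "(*) (deriv F (p $ j))"]
    by (simp add: has_field_derivative_def mult.commute)
qed

lemma pd_coord_compose:
  fixes F :: "real \<Rightarrow> real"
  shows "F differentiable (at (p $ j)) \<Longrightarrow> pd i (\<lambda>p. F (p $ j)) p = (if i = j then deriv F (p $ j) else 0)"
  by (simp add: pd_eqI [OF has_derivative_coord_compose] axis_def)

lemma smooth_fun_coord_compose:
  assumes "open U" "smooth_on_interval I F" "\<And>p. p \<in> U \<Longrightarrow> p $ j \<in> I"
  shows "smooth_fun U (\<lambda>p. F (p $ j))"
proof (rule smooth_fun_coinduct [OF assms(1)])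
  \<comment> \<open>The zero function is the partial derivative in all directions other than
    \<open>j\<close>.\<close>
  let ?S = "insert (\<lambda>p. 0) (range (\<lambda>n p. (deriv ^^ n) F (p $ j)))"
  show "(\<lambda>p. F (p $ j)) \<in> ?S"
    by (auto intro!: image_eqI [of _ _ 0])
  fix f assume f: "f \<in> ?S"
  have F: "(deriv ^^ n) F differentiable (at (p $ j))" if "p \<in> U" for n p
    using assms that by (simp add: smooth_on_interval_def)
  consider "f = (\<lambda>p. 0)" | n where "f = (\<lambda>p. (deriv ^^ n) F (p $ j))"
    using f by blast
  note f_cases = this
  show "f differentiable (at p)" if "p \<in> U" for p
    using f_cases has_derivative_coord_compose [OF F [OF that], THEN differentiableI] by cases simp_all
  show "\<exists>g\<in>?S. \<forall>p\<in>U. partial i f p = g p" for i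
    using f_cases
  proof cases
    case 2
    have "\<forall>p\<in>U. partial i f p = (if i = j then \<lambda>p. (deriv ^^ Suc n) F (p $ j) else (\<lambda>p. 0)) p"
      by (simp add: 2 partial_eq_pd pd_coord_compose F)
    then show ?thesis
      by (rule bexI [where x = "if i = j then \<lambda>p. (deriv ^^ Suc n) F (p $ j) else (\<lambda>p. 0)"])
        (auto simp del: funpow.simps)
  qed (simp add: partial_eq_pd)
qed

lemma smooth_mat_nth: "smooth_mat U A \<Longrightarrow> smooth_fun U (\<lambda>p. A p $ i $ j)"
  by (simp add: smooth_mat_def)

lemma smooth_mat_differentiable:
  fixes A :: "real^'k \<Rightarrow> real^'n^'m"
  shows "smooth_mat U A \<Longrightarrow> p \<in> U \<Longrightarrow> A differentiable (at p)"
  by (intro differentiable_vec smooth_fun_differentiable) (auto simp: smooth_mat_def)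

lemma smooth_mat_mult:
  "open U \<Longrightarrow> smooth_mat U A \<Longrightarrow> smooth_mat U B \<Longrightarrow> smooth_mat U (\<lambda>p. A p ** B p)"
  by (auto simp: smooth_mat_def matrix_matrix_mult_def intro!: smooth_fun_sum smooth_fun_mult)

lemma smooth_mat_const: "smooth_mat U (\<lambda>p. A)"
  by (simp add: smooth_mat_def)

lemma smooth_mat_scaleR:
  "open U \<Longrightarrow> smooth_fun U f \<Longrightarrow> smooth_mat U A \<Longrightarrow> smooth_mat U (\<lambda>p. f p *\<^sub>R A p)"
  by (auto simp: smooth_mat_def intro!: smooth_fun_mult)

lemma smooth_mat_pd:
  fixes A :: "real^'k \<Rightarrow> real^'n^'m"
  assumes "open U" "smooth_mat U A"
  shows "smooth_mat U (pd i A)"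
  unfolding smooth_mat_def
proof (intro allI)
  fix a b
  have "pd i (\<lambda>q. A q $ a $ b) p = pd i A p $ a $ b" if "p \<in> U" for p
    using smooth_mat_differentiable [OF assms(2) that]
    by (simp add: pd_nth [of "\<lambda>q. A q $ a"] pd_nth differentiable_nth)
  then show "smooth_fun U (\<lambda>p. pd i A p $ a $ b)"
    using smooth_fun_partial [OF smooth_mat_nth [OF assms(2)], of i a b] assms(1)
    by (elim smooth_fun_cong [rotated]) (auto simp: partial_eq_pd)
qed

section \<open>Frame components of the curvature and the Weyl operator\<close>

lemma matrix_sum_nth: "(\<Sum>i\<in>S. f i) $ a $ b = (\<Sum>i\<in>S. f i $ a $ b)"
  by (induction S rule: infinite_finite_induct) auto

lemma sum_rotate:
  fixes f :: "'a \<Rightarrow> 'b \<Rightarrow> 'c \<Rightarrow> 'd::comm_monoid_add"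
  shows "(\<Sum>a\<in>A. \<Sum>b\<in>B. \<Sum>c\<in>C. f a b c) = (\<Sum>b\<in>B. \<Sum>c\<in>C. \<Sum>a\<in>A. f a b c)"
  by (rule trans [OF sum.swap]) (intro sum.cong refl sum.swap)

lemma sum_swap_pairs:
  fixes f :: "'a \<Rightarrow> 'b \<Rightarrow> 'c \<Rightarrow> 'd \<Rightarrow> 'e::comm_monoid_add"
  shows "(\<Sum>a\<in>A. \<Sum>b\<in>B. \<Sum>c\<in>C. \<Sum>d\<in>D. f a b c d) = (\<Sum>c\<in>C. \<Sum>d\<in>D. \<Sum>a\<in>A. \<Sum>b\<in>B. f a b c d)"
  by (rule trans [OF sum.cong [OF refl sum_rotate] sum_rotate])

text \<open>Here \<open>\<gamma> a\<close> is the connection form on the a-th frame vector and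
  \<open>D\<gamma> a b\<close> the derivative of \<open>\<gamma> b\<close> along it. The last sum in
  \<open>\<Omega>\<close> is the term -\<gamma>([E_a, E_b]) of the curvature: by
  \<open>torsion\<close> its coefficients are the components of d\<Theta> in the frame, which are
  minus those of the bracket.\<close>

lemma riemann_up_frame_components:
  fixes g \<Theta> E :: "real^'n \<Rightarrow> real^'n^'n" and \<gamma> :: "'n \<Rightarrow> real^'n \<Rightarrow> real^'n^'n"
    and D\<gamma> :: "'n \<Rightarrow> 'n \<Rightarrow> real^'n^'n"
  assumes U: "open U" "p \<in> U"
    and inv: "\<And>q. q \<in> U \<Longrightarrow> E q ** \<Theta> q = mat 1"
    and diff: "\<And>q. q \<in> U \<Longrightarrow> E differentiable (at q)" "\<And>q. q \<in> U \<Longrightarrow> \<Theta> differentiable (at q)"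
      "\<And>q i. q \<in> U \<Longrightarrow> pd i \<Theta> differentiable (at q)" "\<And>q a. q \<in> U \<Longrightarrow> \<gamma> a differentiable (at q)"
    and mixed: "\<And>i j. pd i (pd j \<Theta>) p = pd j (pd i \<Theta>) p"
    and g: "\<And>q. q \<in> U \<Longrightarrow> g q = transpose (\<Theta> q) ** \<eta> ** \<Theta> q"
    and \<eta>: "transpose \<eta> = \<eta>" "invertible \<eta>"
    and skew: "\<And>q a. q \<in> U \<Longrightarrow> transpose (\<gamma> a q) ** \<eta> = - (\<eta> ** \<gamma> a q)"
    and torsion: "\<And>q c i j. q \<in> U \<Longrightarrow> pd i \<Theta> q $ c $ j - pd j \<Theta> q $ c $ i
      = (\<Sum>a\<in>UNIV. \<Sum>b\<in>UNIV. (\<gamma> b q $ c $ a - \<gamma> a q $ c $ b) * \<Theta> q $ a $ i * \<Theta> q $ b $ j)"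
    and D\<gamma>: "\<And>i b. pd i (\<gamma> b) p = (\<Sum>a\<in>UNIV. \<Theta> p $ a $ i *\<^sub>R D\<gamma> a b)"
    and \<Omega>: "\<And>a b. \<Omega> a b = D\<gamma> a b - D\<gamma> b a + \<gamma> a p ** \<gamma> b p - \<gamma> b p ** \<gamma> a p
      + (\<Sum>c\<in>UNIV. (\<gamma> b p $ c $ a - \<gamma> a p $ c $ b) *\<^sub>R \<gamma> c p)"
  shows "riemann_up g m k i j p
    = (E p ** (\<Sum>a\<in>UNIV. \<Sum>b\<in>UNIV. (\<Theta> p $ a $ i * \<Theta> p $ b $ j) *\<^sub>R \<Omega> a b) ** \<Theta> p) $ m $ k"
proof -
  define \<omega> where "\<omega> i q = (\<Sum>a\<in>UNIV. \<Theta> q $ a $ i *\<^sub>R \<gamma> a q)" for i q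
  have d\<Theta>: "(\<lambda>q. \<Theta> q $ a $ i) differentiable (at q)" if "q \<in> U" for a i q
    using diff that by (intro differentiable_nth)
  have d\<omega>: "\<omega> i differentiable (at q)" if "q \<in> U" for i q
    unfolding \<omega>_def using that diff d\<Theta> by (intro differentiable_sum differentiable_scaleR) auto
  have pd\<omega>: "pd i (\<omega> j) p = (\<Sum>c\<in>UNIV. pd i \<Theta> p $ c $ j *\<^sub>R \<gamma> c p)
      + (\<Sum>b\<in>UNIV. \<Sum>a\<in>UNIV. (\<Theta> p $ a $ i * \<Theta> p $ b $ j) *\<^sub>R D\<gamma> a b)" for i j
    unfolding \<omega>_def using U diff
    by (simp add: pd_sum pd_scaleR d\<Theta> differentiable_scaleR D\<gamma> pd_nth [of "\<lambda>q. \<Theta> q $ _"] pd_nth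
        differentiable_nth sum.distrib scaleR_sum_right mult.commute)
  have \<omega>\<omega>: "\<omega> i p ** \<omega> j p = (\<Sum>a\<in>UNIV. \<Sum>b\<in>UNIV. (\<Theta> p $ a $ i * \<Theta> p $ b $ j) *\<^sub>R (\<gamma> a p ** \<gamma> b p))" for i j
    by (simp add: \<omega>_def matrix_mult_simps scaleR_sum_right)
      (subst sum.swap, simp add: mult.commute)
  have swap: "(\<Sum>a\<in>UNIV. \<Sum>b\<in>UNIV. (\<Theta> p $ a $ j * \<Theta> p $ b $ i) *\<^sub>R M a b)
      = (\<Sum>a\<in>UNIV. \<Sum>b\<in>UNIV. (\<Theta> p $ a $ i * \<Theta> p $ b $ j) *\<^sub>R M b a)" for M :: "'n \<Rightarrow> 'n \<Rightarrow> real^'n^'n"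
    by (subst sum.swap) (simp add: mult.commute)
  have "(\<Sum>c\<in>UNIV. pd i \<Theta> p $ c $ j *\<^sub>R \<gamma> c p) - (\<Sum>c\<in>UNIV. pd j \<Theta> p $ c $ i *\<^sub>R \<gamma> c p)
      = (\<Sum>c\<in>UNIV. (pd i \<Theta> p $ c $ j - pd j \<Theta> p $ c $ i) *\<^sub>R \<gamma> c p)"
    by (simp add: sum_subtractf scaleR_diff_left)
  also have "\<dots> = (\<Sum>c\<in>UNIV. \<Sum>a\<in>UNIV. \<Sum>b\<in>UNIV. (\<Theta> p $ a $ i * \<Theta> p $ b $ j)
      *\<^sub>R ((\<gamma> b p $ c $ a - \<gamma> a p $ c $ b) *\<^sub>R \<gamma> c p))"
    by (simp add: torsion U scaleR_sum_left ac_simps)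
  also have "\<dots> = (\<Sum>a\<in>UNIV. \<Sum>b\<in>UNIV. (\<Theta> p $ a $ i * \<Theta> p $ b $ j)
      *\<^sub>R (\<Sum>c\<in>UNIV. (\<gamma> b p $ c $ a - \<gamma> a p $ c $ b) *\<^sub>R \<gamma> c p))"
    unfolding scaleR_sum_right by (rule sum_rotate)
  finally have tor: "(\<Sum>c\<in>UNIV. pd i \<Theta> p $ c $ j *\<^sub>R \<gamma> c p) - (\<Sum>c\<in>UNIV. pd j \<Theta> p $ c $ i *\<^sub>R \<gamma> c p) = \<dots>" .
  have "pd i (\<omega> j) p - pd j (\<omega> i) p + \<omega> i p ** \<omega> j p - \<omega> j p ** \<omega> i p
      = ((\<Sum>c\<in>UNIV. pd i \<Theta> p $ c $ j *\<^sub>R \<gamma> c p) - (\<Sum>c\<in>UNIV. pd j \<Theta> p $ c $ i *\<^sub>R \<gamma> c p))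
      + (\<Sum>a\<in>UNIV. \<Sum>b\<in>UNIV. (\<Theta> p $ a $ i * \<Theta> p $ b $ j) *\<^sub>R D\<gamma> a b)
      - (\<Sum>a\<in>UNIV. \<Sum>b\<in>UNIV. (\<Theta> p $ a $ j * \<Theta> p $ b $ i) *\<^sub>R D\<gamma> a b)
      + \<omega> i p ** \<omega> j p - \<omega> j p ** \<omega> i p"
    by (simp add: pd\<omega>) (subst (1 2) sum.swap, simp)
  also have "\<dots> = (\<Sum>a\<in>UNIV. \<Sum>b\<in>UNIV. (\<Theta> p $ a $ i * \<Theta> p $ b $ j) *\<^sub>R \<Omega> a b)"
    unfolding tor \<omega>\<omega> swap [of "\<lambda>a b. D\<gamma> a b"] swap [of "\<lambda>a b. \<gamma> a p ** \<gamma> b p"] \<Omega>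
    by (simp add: sum.distrib sum_subtractf scaleR_add_right scaleR_diff_right)
  finally have F: "pd i (\<omega> j) p - pd j (\<omega> i) p + \<omega> i p ** \<omega> j p - \<omega> j p ** \<omega> i p = \<dots>" .
  show ?thesis
    unfolding F [symmetric]
  proof (rule riemann_up_frame [OF U inv diff(1-3) d\<omega> mixed g \<eta>])
    show "transpose (\<omega> i q) ** \<eta> = - (\<eta> ** \<omega> i q)" if "q \<in> U" for q i
      unfolding \<omega>_def using skew [OF that]
      by (simp add: linear_sum [OF bounded_linear.linear [OF bounded_linear_transpose]]
          linear_cmul [OF bounded_linear.linear [OF bounded_linear_transpose]] matrix_mult_simps sum_negf)
    show "(\<omega> i q ** \<Theta> q + pd i \<Theta> q) $ a $ j = (\<omega> j q ** \<Theta> q + pd j \<Theta> q) $ a $ i" if "q \<in> U" for q a i j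
    proof -
      have *: "(\<omega> i q ** \<Theta> q) $ a $ j = (\<Sum>x\<in>UNIV. \<Sum>y\<in>UNIV. \<gamma> x q $ a $ y * \<Theta> q $ x $ i * \<Theta> q $ y $ j)" for i j
        by (simp add: \<omega>_def matrix_mult_simps matrix_sum_nth)
          (simp add: matrix_matrix_mult_def sum_distrib_left ac_simps)
      have "(\<omega> j q ** \<Theta> q) $ a $ i = (\<Sum>x\<in>UNIV. \<Sum>y\<in>UNIV. \<gamma> y q $ a $ x * \<Theta> q $ x $ i * \<Theta> q $ y $ j)"
        unfolding * by (subst sum.swap) (simp add: ac_simps)
      then show ?thesis
        using torsion [OF that, of i a j] * [of i j] by (simp add: left_diff_distrib sum_subtractf)
    qed
  qed (assumption+)
qed

lemma matrix_congruence_nth: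
  fixes \<Theta> M :: "real^'n^'n"
  shows "(\<Theta> ** M ** transpose \<Theta>) $ a $ b = (\<Sum>i\<in>UNIV. \<Sum>j\<in>UNIV. M $ i $ j * (\<Theta> $ a $ i * \<Theta> $ b $ j))"
    and "(transpose \<Theta> ** M ** \<Theta>) $ a $ b = (\<Sum>i\<in>UNIV. \<Sum>j\<in>UNIV. M $ i $ j * (\<Theta> $ i $ a * \<Theta> $ j $ b))"
  by (subst sum.swap, simp add: matrix_matrix_mult_def transpose_def sum_distrib_left sum_distrib_right ac_simps)+

text \<open>The bivector \<open>M\<close> absorbs the two coframe factors of the tensor and thereby
  becomes its own matrix in the frame.\<close>

lemma frame_contract:
  fixes \<Theta> M :: "real^'n^'n" and X :: "'n \<Rightarrow> 'n \<Rightarrow> 'b::real_vector"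
  shows "(\<Sum>i\<in>UNIV. \<Sum>j\<in>UNIV. M $ i $ j *\<^sub>R (\<Sum>a\<in>UNIV. \<Sum>b\<in>UNIV. (\<Theta> $ a $ i * \<Theta> $ b $ j) *\<^sub>R X a b))
    = (\<Sum>a\<in>UNIV. \<Sum>b\<in>UNIV. (\<Theta> ** M ** transpose \<Theta>) $ a $ b *\<^sub>R X a b)"
proof -
  have "(\<Sum>a\<in>UNIV. \<Sum>b\<in>UNIV. (\<Theta> ** M ** transpose \<Theta>) $ a $ b *\<^sub>R X a b)
      = (\<Sum>a\<in>UNIV. \<Sum>b\<in>UNIV. \<Sum>i\<in>UNIV. \<Sum>j\<in>UNIV. (M $ i $ j * (\<Theta> $ a $ i * \<Theta> $ b $ j)) *\<^sub>R X a b)"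
    by (simp add: matrix_congruence_nth scaleR_sum_left)
  also have "\<dots> = (\<Sum>i\<in>UNIV. \<Sum>j\<in>UNIV. \<Sum>a\<in>UNIV. \<Sum>b\<in>UNIV. (M $ i $ j * (\<Theta> $ a $ i * \<Theta> $ b $ j)) *\<^sub>R X a b)"
    by (rule sum_swap_pairs)
  finally show ?thesis
    by (simp add: scaleR_sum_right)
qed

lemma frame_metric_inverse:
  fixes \<Theta> E \<eta> F :: "real^'n^'n"
  assumes inv: "E ** \<Theta> = mat 1"
    and g: "g = transpose \<Theta> ** \<eta> ** \<Theta>"
    and \<eta>: "transpose \<eta> = \<eta>" "\<eta> ** \<eta> = mat 1"
  shows "matrix_inv g = E ** \<eta> ** transpose E" "matrix_inv g ** g = mat 1"
    and "raise_indices g (transpose \<Theta> ** F ** \<Theta>) = E ** (\<eta> ** F ** \<eta>) ** transpose E"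
proof -
  have inv': "\<Theta> ** E = mat 1"
    using inv matrix_left_right_inverse by blast
  have invt: "transpose E ** transpose \<Theta> = mat 1" "transpose \<Theta> ** transpose E = mat 1"
    by (simp_all add: matrix_transpose_mul [symmetric] inv inv' transpose_mat)
  \<comment> \<open>Products are normalized to the left, so two inverse factors in the middle of a
    product do not form a subterm. Each rule therefore carries an arbitrary left factor
    \<open>A\<close>.\<close>
  note cancel = inv [THEN arg_cong, of "\<lambda>x. A ** x" for A, unfolded matrix_mul_assoc matrix_mul_rid]
    inv' [THEN arg_cong, of "\<lambda>x. A ** x" for A, unfolded matrix_mul_assoc matrix_mul_rid]
    invt [THEN arg_cong, of "\<lambda>x. A ** x" for A, unfolded matrix_mul_assoc matrix_mul_rid]
    \<eta>(2) [THEN arg_cong, of "\<lambda>x. A ** x" for A, unfolded matrix_mul_assoc matrix_mul_rid]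
  have left_inv: "E ** \<eta> ** transpose E ** g = mat 1"
    by (simp add: g matrix_mul_assoc cancel inv)
  then show ginv: "matrix_inv g = E ** \<eta> ** transpose E"
    by (rule matrix_inv_unique(1))
  show "matrix_inv g ** g = mat 1"
    unfolding ginv by (rule left_inv)
  show "raise_indices g (transpose \<Theta> ** F ** \<Theta>) = E ** (\<eta> ** F ** \<eta>) ** transpose E"
    by (simp add: raise_indices_def ginv matrix_transpose_mul \<eta> matrix_mul_assoc cancel)
qed

text \<open>For an Einstein metric in dimension four the scalar curvature is 4\<Lambda>, and the two
  correction terms of the Weyl tensor add up to -\<Lambda>/3 times the constant curvature tensor.
  That tensor maps a two-form to twice itself, because the contraction runs over ordered pairs;
  hence the coefficient 2\<Lambda>/3.\<close>

lemma weyl_op_einstein_frame: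
  fixes \<Theta> E \<eta> F :: "real^4^4" and \<Omega> :: "4 \<Rightarrow> 4 \<Rightarrow> real^4^4"
  assumes R: "\<And>m k i j. riemann_up g m k i j p
      = (E ** (\<Sum>a\<in>UNIV. \<Sum>b\<in>UNIV. (\<Theta> $ a $ i * \<Theta> $ b $ j) *\<^sub>R \<Omega> a b) ** \<Theta>) $ m $ k"
    and inv: "E ** \<Theta> = mat 1"
    and g: "g p = transpose \<Theta> ** \<eta> ** \<Theta>"
    and \<eta>: "transpose \<eta> = \<eta>" "\<eta> ** \<eta> = mat 1"
    and ric: "ricci g p = \<Lambda> *\<^sub>R g p"
    and F: "transpose F = - F"
  shows "weyl_op g p (transpose \<Theta> ** F ** \<Theta>) =
      transpose \<Theta> ** ((\<Sum>a\<in>UNIV. \<Sum>b\<in>UNIV. (\<eta> ** F ** \<eta>) $ a $ b *\<^sub>R (\<eta> ** \<Omega> a b)) - (2 * \<Lambda> / 3) *\<^sub>R F) ** \<Theta>"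
proof -
  have inv': "\<Theta> ** E = mat 1"
    using inv matrix_left_right_inverse by blast
  have invt: "transpose E ** transpose \<Theta> = mat 1" "transpose \<Theta> ** transpose E = mat 1"
    by (simp_all add: matrix_transpose_mul [symmetric] inv inv' transpose_mat)
  note cancel = inv [THEN arg_cong, of "\<lambda>x. A ** x" for A, unfolded matrix_mul_assoc matrix_mul_rid]
    inv' [THEN arg_cong, of "\<lambda>x. A ** x" for A, unfolded matrix_mul_assoc matrix_mul_rid]
    invt [THEN arg_cong, of "\<lambda>x. A ** x" for A, unfolded matrix_mul_assoc matrix_mul_rid]
    \<eta>(2) [THEN arg_cong, of "\<lambda>x. A ** x" for A, unfolded matrix_mul_assoc matrix_mul_rid]
  let ?M = "E ** (\<eta> ** F ** \<eta>) ** transpose E"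
  note raise = frame_metric_inverse(3) [OF inv g \<eta>, of F]
  have gs: "transpose (g p) = g p"
    by (simp add: g matrix_transpose_mul \<eta> matrix_mul_assoc)
  have gs': "g p $ i $ j = g p $ j $ i" for i j
  proof -
    have "g p $ i $ j = transpose (g p) $ j $ i"
      by (simp only: transpose_def vec_lambda_beta)
    then show ?thesis
      unfolding gs .
  qed
  have "(\<Sum>i\<in>UNIV. \<Sum>j\<in>UNIV. matrix_inv (g p) $ i $ j * g p $ i $ j) = (\<Sum>i\<in>UNIV. (matrix_inv (g p) ** g p) $ i $ i)"
    unfolding matrix_matrix_mult_def vec_lambda_beta by (intro sum.cong refl arg_cong [of _ _ "(*) _"] gs')
  also have "matrix_inv (g p) ** g p = mat 1"
    by (rule frame_metric_inverse(2) [OF inv g \<eta>])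
  finally have scal: "scalar_curvature g p = 4 * \<Lambda>"
    by (simp add: scalar_curvature_def ric sum_distrib_left [symmetric] mult.left_commute mat_def)
  have weyl: "weyl g l k i j p = riemann g l k i j p - \<Lambda> / 3 * (g p $ l $ i * g p $ k $ j - g p $ l $ j * g p $ k $ i)" for l k i j
    by (simp add: weyl_def scal ric algebra_simps)
  have riem: "riemann g l k i j p
      = (transpose \<Theta> ** \<eta> ** (\<Sum>a\<in>UNIV. \<Sum>b\<in>UNIV. (\<Theta> $ a $ i * \<Theta> $ b $ j) *\<^sub>R \<Omega> a b) ** \<Theta>) $ l $ k" for l k i j
  proof -
    have "riemann g l k i j p
        = (g p ** (E ** (\<Sum>a\<in>UNIV. \<Sum>b\<in>UNIV. (\<Theta> $ a $ i * \<Theta> $ b $ j) *\<^sub>R \<Omega> a b) ** \<Theta>)) $ l $ k"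
      by (simp add: riemann_def R matrix_matrix_mult_def [of "g p"])
    then show ?thesis
      by (simp add: g matrix_mul_assoc cancel)
  qed
  have part1: "(\<Sum>i\<in>UNIV. \<Sum>j\<in>UNIV. riemann g l k i j p * ?M $ i $ j)
      = (transpose \<Theta> ** (\<Sum>a\<in>UNIV. \<Sum>b\<in>UNIV. (\<eta> ** F ** \<eta>) $ a $ b *\<^sub>R (\<eta> ** \<Omega> a b)) ** \<Theta>) $ l $ k" for l k
  proof -
    have "(\<Sum>i\<in>UNIV. \<Sum>j\<in>UNIV. riemann g l k i j p * ?M $ i $ j)
        = (transpose \<Theta> ** \<eta> ** (\<Sum>i\<in>UNIV. \<Sum>j\<in>UNIV. ?M $ i $ j *\<^sub>R (\<Sum>a\<in>UNIV. \<Sum>b\<in>UNIV. (\<Theta> $ a $ i * \<Theta> $ b $ j) *\<^sub>R \<Omega> a b)) ** \<Theta>) $ l $ k"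
      unfolding riem bounded_bilinear.sum_left [OF bounded_bilinear_matrix_mult]
        bounded_bilinear.sum_right [OF bounded_bilinear_matrix_mult]
        bounded_bilinear.scaleR_left [OF bounded_bilinear_matrix_mult]
        bounded_bilinear.scaleR_right [OF bounded_bilinear_matrix_mult] matrix_sum_nth
      by (simp add: mult.commute)
    also have "\<Theta> ** ?M ** transpose \<Theta> = \<eta> ** F ** \<eta>"
      by (simp add: matrix_mul_assoc cancel inv')
    then have "(\<Sum>i\<in>UNIV. \<Sum>j\<in>UNIV. ?M $ i $ j *\<^sub>R (\<Sum>a\<in>UNIV. \<Sum>b\<in>UNIV. (\<Theta> $ a $ i * \<Theta> $ b $ j) *\<^sub>R \<Omega> a b))
        = (\<Sum>a\<in>UNIV. \<Sum>b\<in>UNIV. (\<eta> ** F ** \<eta>) $ a $ b *\<^sub>R \<Omega> a b)"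
      by (simp only: frame_contract)
    finally show ?thesis
      by (simp add: matrix_mult_simps matrix_mul_assoc [symmetric])
  qed
  have gM: "g p ** ?M ** g p = transpose \<Theta> ** F ** \<Theta>"
    by (simp add: g matrix_mul_assoc cancel)
  have M: "transpose ?M = - ?M"
    using F \<eta> by (simp add: matrix_transpose_mul matrix_mul_assoc matrix_mult_simps)
  have part2: "(\<Sum>i\<in>UNIV. \<Sum>j\<in>UNIV. (g p $ l $ i * g p $ k $ j - g p $ l $ j * g p $ k $ i) * ?M $ i $ j)
      = 2 * (transpose \<Theta> ** F ** \<Theta>) $ l $ k" for l k
  proof -
    have 1: "(\<Sum>i\<in>UNIV. \<Sum>j\<in>UNIV. g p $ l $ i * g p $ k $ j * N $ i $ j) = (g p ** N ** g p) $ l $ k" for N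
      by (simp add: matrix_matrix_mult_def sum_distrib_left sum_distrib_right gs' [of k] ac_simps)
        (subst sum.swap, simp)
    have "(\<Sum>i\<in>UNIV. \<Sum>j\<in>UNIV. g p $ l $ j * g p $ k $ i * ?M $ i $ j) = (g p ** transpose ?M ** g p) $ l $ k"
      unfolding 1 [symmetric] by (subst sum.swap) (simp add: transpose_def)
    then have "(\<Sum>i\<in>UNIV. \<Sum>j\<in>UNIV. g p $ l $ j * g p $ k $ i * ?M $ i $ j) = - (g p ** ?M ** g p) $ l $ k"
      unfolding M by (simp add: matrix_mult_simps)
    then show ?thesis
      using 1 [of ?M] by (simp add: left_diff_distrib sum_subtractf gM)
  qed
  have "weyl_op g p (transpose \<Theta> ** F ** \<Theta>) $ l $ k = (\<Sum>i\<in>UNIV. \<Sum>j\<in>UNIV. riemann g l k i j p * ?M $ i $ j)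
      - \<Lambda> / 3 * (\<Sum>i\<in>UNIV. \<Sum>j\<in>UNIV. (g p $ l $ i * g p $ k $ j - g p $ l $ j * g p $ k $ i) * ?M $ i $ j)" for l k
    unfolding weyl_op_def raise weyl vec_lambda_beta sum_distrib_left sum_subtractf [symmetric]
    by (intro sum.cong refl) (simp add: algebra_simps)
  then show "weyl_op g p (transpose \<Theta> ** F ** \<Theta>) =
      transpose \<Theta> ** ((\<Sum>a\<in>UNIV. \<Sum>b\<in>UNIV. (\<eta> ** F ** \<eta>) $ a $ b *\<^sub>R (\<eta> ** \<Omega> a b)) - (2 * \<Lambda> / 3) *\<^sub>R F) ** \<Theta>"
    unfolding part1 part2 by (simp add: vec_eq_iff matrix_mult_simps)
qed

section \<open>The Hodge star in dimension four\<close>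

lemma vector_4 [simp]:
  "(vector [x, y, z, w] :: 'a::zero^4) $ 1 = x"
  "(vector [x, y, z, w] :: 'a::zero^4) $ 2 = y"
  "(vector [x, y, z, w] :: 'a::zero^4) $ 3 = z"
  "(vector [x, y, z, w] :: 'a::zero^4) $ 4 = w"
  unfolding vector_def by simp_all

lemma det_4:
  "det (A :: 'a::comm_ring_1^4^4) =
    A$1$1 * (A$2$2 * A$3$3 * A$4$4 + A$2$3 * A$3$4 * A$4$2 + A$2$4 * A$3$2 * A$4$3
      - A$2$2 * A$3$4 * A$4$3 - A$2$3 * A$3$2 * A$4$4 - A$2$4 * A$3$3 * A$4$2)
    - A$1$2 * (A$2$1 * A$3$3 * A$4$4 + A$2$3 * A$3$4 * A$4$1 + A$2$4 * A$3$1 * A$4$3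
      - A$2$1 * A$3$4 * A$4$3 - A$2$3 * A$3$1 * A$4$4 - A$2$4 * A$3$3 * A$4$1)
    + A$1$3 * (A$2$1 * A$3$2 * A$4$4 + A$2$2 * A$3$4 * A$4$1 + A$2$4 * A$3$1 * A$4$2
      - A$2$1 * A$3$4 * A$4$2 - A$2$2 * A$3$1 * A$4$4 - A$2$4 * A$3$2 * A$4$1)
    - A$1$4 * (A$2$1 * A$3$2 * A$4$3 + A$2$2 * A$3$3 * A$4$1 + A$2$3 * A$3$1 * A$4$2
      - A$2$1 * A$3$3 * A$4$2 - A$2$2 * A$3$1 * A$4$3 - A$2$3 * A$3$2 * A$4$1)"
proof -
  have f1234: "finite {2::4, 3, 4}" "1 \<notin> {2::4, 3, 4}"
    by auto
  have f234: "finite {3::4, 4}" "2 \<notin> {3::4, 4}"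
    by auto
  have f34: "finite {4::4}" "3 \<notin> {4::4}"
    by auto
  show ?thesis
    unfolding det_def UNIV_4
    unfolding sum_over_permutations_insert [OF f1234]
    unfolding sum_over_permutations_insert [OF f234]
    unfolding sum_over_permutations_insert [OF f34]
    unfolding permutes_sing
    by (simp add: sign_swap_id permutation_swap_id permutation_compose sign_compose sign_id swap_id_eq algebra_simps)
qed

lemma axis_nth: "axis i x $ j = (if i = j then x else 0)"
  by (simp add: axis_def)

lemma levi_civita_sum:
  "(\<Sum>k\<in>UNIV. \<Sum>l\<in>UNIV. levi_civita k l i j * (u $ k * v $ l)) = det (vector [u, v, axis i 1, axis j 1])"
  by (simp add: levi_civita_def sum_4 det_4 axis_nth algebra_simps)

lemma levi_civita_sum':
  "(\<Sum>i\<in>UNIV. \<Sum>j\<in>UNIV. levi_civita k l i j * (u $ i * v $ j)) = det (vector [axis k 1, axis l 1, u, v])"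
  by (simp add: levi_civita_def sum_4 det_4 axis_nth algebra_simps)

lemma vector_4_matrix_mult:
  "(vector [u, v, w, z] :: real^4^4) ** (A :: real^4^4) = vector [u v* A, v v* A, w v* A, z v* A]"
  unfolding vec_eq_iff forall_4
  by (simp add: matrix_matrix_mult_def vector_matrix_mult_def mult.commute)

text \<open>The left-hand sum is the determinant with rows two columns of \<open>E\<close> and two
  coordinate vectors. Multiplying this matrix by the transpose of \<Theta> turns the columns of
  \<open>E\<close> into coordinate vectors and the coordinate vectors into columns of \<Theta>, so
  half of the indices change sides.\<close>

lemma levi_civita_frame:
  fixes \<Theta> E :: "real^4^4"
  assumes inv: "E ** \<Theta> = mat 1"
  shows "det \<Theta> * (\<Sum>k\<in>UNIV. \<Sum>l\<in>UNIV. levi_civita k l i j * (E $ k $ c * E $ l $ d))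
    = (\<Sum>a\<in>UNIV. \<Sum>b\<in>UNIV. levi_civita c d a b * (\<Theta> $ a $ i * \<Theta> $ b $ j))"
proof -
  have inv': "\<Theta> ** E = mat 1"
    using inv matrix_left_right_inverse by blast
  have 1: "column c E v* transpose \<Theta> = axis c 1" for c
  proof -
    have "(column c E v* transpose \<Theta>) $ r = (\<Theta> ** E) $ r $ c" for r
      by (simp add: vector_matrix_mult_def column_def transpose_def matrix_matrix_mult_def mult.commute)
    then show ?thesis
      by (simp add: vec_eq_iff inv' mat_def axis_nth eq_commute)
  qed
  have 2: "axis i 1 v* transpose \<Theta> = column i \<Theta>" for i
    by (simp add: vec_eq_iff vector_matrix_mult_def column_def transpose_def axis_nth if_distrib if_distribR cong: if_cong)
  have "det \<Theta> * (\<Sum>k\<in>UNIV. \<Sum>l\<in>UNIV. levi_civita k l i j * (column c E $ k * column d E $ l))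
      = det (vector [column c E, column d E, axis i 1, axis j 1] ** transpose \<Theta>)"
    unfolding levi_civita_sum by (simp add: det_mul det_transpose)
  also have "\<dots> = (\<Sum>a\<in>UNIV. \<Sum>b\<in>UNIV. levi_civita c d a b * (column i \<Theta> $ a * column j \<Theta> $ b))"
    unfolding levi_civita_sum' vector_4_matrix_mult 1 2 ..
  finally show ?thesis
    by (simp add: column_def)
qed

text \<open>The density of the metric contributes |det \<Theta>|, since det \<eta> is 1 or -1, while
  the Levi-Civita symbol transforms with det \<Theta> itself. The quotient is the sign that corrects
  \<sigma>.\<close>

lemma hodge_frame:
  fixes \<Theta> E \<eta> F :: "real^4^4"
  assumes inv: "E ** \<Theta> = mat 1"
    and g: "g = transpose \<Theta> ** \<eta> ** \<Theta>"
    and \<eta>: "transpose \<eta> = \<eta>" "\<eta> ** \<eta> = mat 1"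
  shows "hodge \<sigma> g (transpose \<Theta> ** F ** \<Theta>) = transpose \<Theta> ** hodge (\<sigma> * sgn (det \<Theta>)) \<eta> F ** \<Theta>"
proof -
  have "det \<eta> * det \<eta> = 1"
    using \<eta>(2) by (metis det_I det_mul)
  then have d\<eta>: "\<bar>det \<eta>\<bar> = 1"
    by (metis abs_mult_self_eq abs_1 abs_ge_zero mult_cancel_right1 abs_mult zero_neq_one square_eq_1_iff abs_minus_cancel)
  have dg: "sqrt \<bar>det g\<bar> = \<bar>det \<Theta>\<bar>"
    by (simp add: g det_mul det_transpose abs_mult d\<eta>)
  have \<eta>inv: "matrix_inv \<eta> = \<eta>"
    by (rule matrix_inv_unique(1) [OF \<eta>(2)])
  let ?N = "\<eta> ** F ** \<eta>"
  note raise = frame_metric_inverse(3) [OF inv g \<eta>, of F]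
  have raise\<eta>: "raise_indices \<eta> F = ?N"
    by (simp add: raise_indices_def \<eta>inv \<eta>)
  have "hodge \<sigma> g (transpose \<Theta> ** F ** \<Theta>) $ i $ j
      = (transpose \<Theta> ** hodge (\<sigma> * sgn (det \<Theta>)) \<eta> F ** \<Theta>) $ i $ j" for i j
  proof -
    define L where "L c d = (\<Sum>k\<in>UNIV. \<Sum>l\<in>UNIV. levi_civita k l i j * (E $ k $ c * E $ l $ d))" for c d
    have "hodge \<sigma> g (transpose \<Theta> ** F ** \<Theta>) $ i $ j
        = \<sigma> / 2 * \<bar>det \<Theta>\<bar> * (\<Sum>k\<in>UNIV. \<Sum>l\<in>UNIV. levi_civita k l i j * (E ** ?N ** transpose E) $ k $ l)"
      by (simp add: hodge_def raise dg sum_distrib_left mult.assoc)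
    also have "(\<Sum>k\<in>UNIV. \<Sum>l\<in>UNIV. levi_civita k l i j * (E ** ?N ** transpose E) $ k $ l)
        = (\<Sum>c\<in>UNIV. \<Sum>d\<in>UNIV. ?N $ c $ d * L c d)"
      unfolding matrix_congruence_nth(1) sum_distrib_left L_def
      by (subst sum_swap_pairs) (simp add: ac_simps)
    also have "\<sigma> / 2 * \<bar>det \<Theta>\<bar> * \<dots> = \<sigma> / 2 * sgn (det \<Theta>) * (\<Sum>c\<in>UNIV. \<Sum>d\<in>UNIV. ?N $ c $ d * (det \<Theta> * L c d))"
      by (simp add: sum_distrib_left abs_sgn mult.left_commute mult.assoc)
    also have "(\<Sum>c\<in>UNIV. \<Sum>d\<in>UNIV. ?N $ c $ d * (det \<Theta> * L c d))
        = (\<Sum>a\<in>UNIV. \<Sum>b\<in>UNIV. (\<Sum>c\<in>UNIV. \<Sum>d\<in>UNIV. levi_civita c d a b * ?N $ c $ d) * (\<Theta> $ a $ i * \<Theta> $ b $ j))"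
      unfolding L_def levi_civita_frame [OF inv]
      unfolding sum_distrib_left sum_distrib_right
      by (subst sum_swap_pairs) (simp add: ac_simps)
    finally show ?thesis
      unfolding matrix_congruence_nth(2)
      by (simp add: hodge_def raise\<eta> d\<eta> sum_distrib_left sum_distrib_right ac_simps)
  qed
  then show ?thesis
    by (simp add: vec_eq_iff)
qed

section \<open>Two-forms in an orthonormal frame of neutral signature\<close>

definition signature_matrix :: "real^4^4" where
  "signature_matrix = (\<chi> i j. if i = j then (if i \<in> {1, 2} then - 1 else 1) else 0)"

text \<open>A normal form for two-forms: sums, the star and the Weyl operator become operations on
  six coefficients, and equations split into six scalar ones.\<close>

definition alternating :: "real \<Rightarrow> real \<Rightarrow> real \<Rightarrow> real \<Rightarrow> real \<Rightarrow> real \<Rightarrow> real^4^4" where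
  "alternating x12 x13 x14 x23 x24 x34 = vector [vector [0, x12, x13, x14], vector [- x12, 0, x23, x24],
     vector [- x13, - x23, 0, x34], vector [- x14, - x24, - x34, 0]]"

lemma transpose_signature_matrix: "transpose signature_matrix = signature_matrix"
  by (simp add: vec_eq_iff signature_matrix_def transpose_def)

lemma signature_matrix_mult:
  "(signature_matrix ** A) $ i $ j = (if i \<in> {1, 2} then - 1 else 1) * A $ i $ j"
  "(A ** signature_matrix) $ i $ j = A $ i $ j * (if j \<in> {1, 2} then - 1 else 1)"
  using exhaust_4 [of i] exhaust_4 [of j]
  by (auto simp: matrix_matrix_mult_def signature_matrix_def sum_4)

lemma signature_matrix_square: "signature_matrix ** signature_matrix = mat 1"
  unfolding vec_eq_iff forall_4 signature_matrix_mult by (simp add: signature_matrix_def mat_def)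

lemma alternating_nth:
  "alternating x12 x13 x14 x23 x24 x34 $ 1 = vector [0, x12, x13, x14]"
  "alternating x12 x13 x14 x23 x24 x34 $ 2 = vector [- x12, 0, x23, x24]"
  "alternating x12 x13 x14 x23 x24 x34 $ 3 = vector [- x13, - x23, 0, x34]"
  "alternating x12 x13 x14 x23 x24 x34 $ 4 = vector [- x14, - x24, - x34, 0]"
  by (simp_all add: alternating_def)

lemma alternating_scaleR:
  "c *\<^sub>R alternating x12 x13 x14 x23 x24 x34 = alternating (c * x12) (c * x13) (c * x14) (c * x23) (c * x24) (c * x34)"
  unfolding vec_eq_iff forall_4 by (simp add: alternating_nth)

lemma alternating_add:
  "alternating x12 x13 x14 x23 x24 x34 + alternating y12 y13 y14 y23 y24 y34
    = alternating (x12 + y12) (x13 + y13) (x14 + y14) (x23 + y23) (x24 + y24) (x34 + y34)"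
  "alternating x12 x13 x14 x23 x24 x34 - alternating y12 y13 y14 y23 y24 y34
    = alternating (x12 - y12) (x13 - y13) (x14 - y14) (x23 - y23) (x24 - y24) (x34 - y34)"
  unfolding vec_eq_iff forall_4 by (simp_all add: alternating_nth)

lemma alternating_unique:
  assumes "transpose F = - F"
  shows "F = alternating (F$1$2) (F$1$3) (F$1$4) (F$2$3) (F$2$4) (F$3$4)"
proof -
  have F: "F $ j $ i = - (F $ i $ j)" for i j
  proof -
    have "transpose F $ i $ j = (- F) $ i $ j"
      by (simp only: assms)
    then show ?thesis
      by (simp add: transpose_def)
  qed
  have "F $ i $ i = 0" for i
    using F [of i i] by simp
  then show ?thesis
    unfolding vec_eq_iff forall_4
    by (simp add: alternating_nth F [of 1 2] F [of 1 3] F [of 1 4] F [of 2 3] F [of 2 4] F [of 3 4])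
qed

lemma transpose_alternating: "transpose (alternating x12 x13 x14 x23 x24 x34) = - alternating x12 x13 x14 x23 x24 x34"
  unfolding vec_eq_iff forall_4 by (simp add: alternating_nth transpose_def)

lemma alternating_eq_iff: "alternating x12 x13 x14 x23 x24 x34 = alternating y12 y13 y14 y23 y24 y34 \<longleftrightarrow>
    x12 = y12 \<and> x13 = y13 \<and> x14 = y14 \<and> x23 = y23 \<and> x24 = y24 \<and> x34 = y34"
  unfolding vec_eq_iff forall_4 by (auto simp: alternating_nth)

lemma det_signature_matrix: "det signature_matrix = 1"
  by (simp add: signature_matrix_def det_4)

lemma raise_indices_signature:
  "raise_indices signature_matrix (alternating x12 x13 x14 x23 x24 x34)
    = alternating x12 (- x13) (- x14) (- x23) (- x24) x34"
  unfolding raise_indices_def matrix_inv_unique(1) [OF signature_matrix_square] transpose_signature_matrix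
    vec_eq_iff forall_4 signature_matrix_mult
  by (simp add: alternating_nth)

text \<open>Each sign is the parity of the index permutation times the sign from raising two
  indices. They agree for the pairs 12, 34 and 13, 24 and differ for 14, 23; this is why the central
  direction behaves differently in the self-dual basis.\<close>

lemma hodge_alternating:
  "hodge s signature_matrix (alternating x12 x13 x14 x23 x24 x34)
    = alternating (s * x34) (s * x24) (- s * x23) (- s * x14) (s * x13) (s * x12)"
  unfolding vec_eq_iff forall_4
  by (simp add: hodge_def raise_indices_signature det_signature_matrix)
    (simp add: sum_4 levi_civita_def det_4 axis_nth alternating_def)

section \<open>Algebraic curvature of Heisenberg four-manifolds\<close>

text \<open>
  Here \<open>\<Omega> a b\<close> is the value of the curvature form on the \<open>a\<close>-th and \<open>b\<close>-th frame vectors. Frame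
  index 1 belongs to \<open>dt\<close>, and index \<open>i + 1\<close> to \<open>e\<^sup>i\<close>.
\<close>

definition frame_weyl :: "(4 \<Rightarrow> 4 \<Rightarrow> real^4^4) \<Rightarrow> real \<Rightarrow> real^4^4 \<Rightarrow> real^4^4" where
  "frame_weyl \<Omega> \<Lambda> F = (\<Sum>a\<in>UNIV. \<Sum>b\<in>UNIV. (signature_matrix ** F ** signature_matrix) $ a $ b *\<^sub>R
     (signature_matrix ** \<Omega> a b)) - (2 * \<Lambda> / 3) *\<^sub>R F"

text \<open>
  The solution \<open>\<omega> = (\<Sum>c. heis_connection \<alpha> \<beta> \<kappa> c * e\<^sup>c)\<close> of Cartan's first structure equation.
  The argument \<open>\<kappa> * (2 * \<beta> - \<alpha>)\<close> in the curvature below is the derivative of \<open>\<kappa> = k b\<^sup>2/a\<close>.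
\<close>

definition heis_connection :: "real \<Rightarrow> real \<Rightarrow> real \<Rightarrow> 4 \<Rightarrow> real^4^4" where
  "heis_connection \<alpha> \<beta> \<kappa> c = (vector [0,
     vector [vector [0, \<beta>, 0, 0], vector [- \<beta>, 0, 0, 0], vector [0, 0, 0, \<kappa>], vector [0, 0, - \<kappa>, 0]],
     vector [vector [0, 0, - \<beta>, 0], vector [0, 0, 0, \<kappa>], vector [- \<beta>, 0, 0, 0], vector [0, \<kappa>, 0, 0]],
     vector [vector [0, 0, 0, - \<alpha>], vector [0, 0, \<kappa>, 0], vector [0, \<kappa>, 0, 0], vector [- \<alpha>, 0, 0, 0]]]
     :: real^4^4^4) $ c"

definition heis_curvature :: "real \<Rightarrow> real \<Rightarrow> real \<Rightarrow> real \<Rightarrow> real \<Rightarrow> 4 \<Rightarrow> 4 \<Rightarrow> real^4^4" where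
  "heis_curvature \<alpha> \<beta> \<kappa> \<alpha>' \<beta>' a b =
    (let \<gamma> = heis_connection \<alpha> \<beta> \<kappa>; \<gamma>' = heis_connection \<alpha>' \<beta>' (\<kappa> * (2 * \<beta> - \<alpha>)) in
      (if a = 1 then \<gamma>' b else 0) - (if b = 1 then \<gamma>' a else 0) + \<gamma> a ** \<gamma> b - \<gamma> b ** \<gamma> a
      + (\<Sum>c\<in>UNIV. (\<gamma> b $ c $ a - \<gamma> a $ c $ b) *\<^sub>R \<gamma> c))"

lemma heis_connection_nth:
  "heis_connection \<alpha> \<beta> \<kappa> 1 = 0"
  "heis_connection \<alpha> \<beta> \<kappa> 2 =
    vector [vector [0, \<beta>, 0, 0], vector [- \<beta>, 0, 0, 0], vector [0, 0, 0, \<kappa>], vector [0, 0, - \<kappa>, 0]]"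
  "heis_connection \<alpha> \<beta> \<kappa> 3 =
    vector [vector [0, 0, - \<beta>, 0], vector [0, 0, 0, \<kappa>], vector [- \<beta>, 0, 0, 0], vector [0, \<kappa>, 0, 0]]"
  "heis_connection \<alpha> \<beta> \<kappa> 4 =
    vector [vector [0, 0, 0, - \<alpha>], vector [0, 0, \<kappa>, 0], vector [0, \<kappa>, 0, 0], vector [- \<alpha>, 0, 0, 0]]"
  by (simp_all add: heis_connection_def)

lemma heis_curvature_swap: "heis_curvature \<alpha> \<beta> \<kappa> \<alpha>' \<beta>' b a = - heis_curvature \<alpha> \<beta> \<kappa> \<alpha>' \<beta>' a b"
proof -
  let ?\<gamma> = "heis_connection \<alpha> \<beta> \<kappa>"
  have "(\<Sum>c\<in>UNIV. (?\<gamma> a $ c $ b - ?\<gamma> b $ c $ a) *\<^sub>R ?\<gamma> c) = - (\<Sum>c\<in>UNIV. (?\<gamma> b $ c $ a - ?\<gamma> a $ c $ b) *\<^sub>R ?\<gamma> c)"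
    unfolding sum_negf [symmetric] by (intro sum.cong refl) (simp add: scaleR_diff_left)
  then show ?thesis
    by (simp add: heis_curvature_def Let_def)
qed

context
  fixes \<alpha> \<beta> \<kappa> \<alpha>' \<beta>' :: real
  fixes \<Omega> defines "\<Omega> \<equiv> heis_curvature \<alpha> \<beta> \<kappa> \<alpha>' \<beta>'"
begin

lemma heis_curvature_nth:
  "signature_matrix ** \<Omega> 1 2 = alternating (\<beta>^2 - \<beta>') 0 0 0 0 (\<kappa> * (\<beta> - \<alpha>))"
  "signature_matrix ** \<Omega> 1 3 = alternating 0 (\<beta>' - \<beta>^2) 0 0 (- \<kappa> * (\<beta> - \<alpha>)) 0"
  "signature_matrix ** \<Omega> 1 4 = alternating 0 0 (\<alpha>' - \<alpha>^2) (- 2 * \<kappa> * (\<beta> - \<alpha>)) 0 0"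
  "signature_matrix ** \<Omega> 2 3 = alternating 0 0 (- 2 * \<kappa> * (\<beta> - \<alpha>)) (- (3 * \<kappa>^2 + \<beta>^2)) 0 0"
  "signature_matrix ** \<Omega> 2 4 = alternating 0 (- \<kappa> * (\<beta> - \<alpha>)) 0 0 (\<kappa>^2 - \<alpha> * \<beta>) 0"
  "signature_matrix ** \<Omega> 3 4 = alternating (\<kappa> * (\<beta> - \<alpha>)) 0 0 0 0 (\<alpha> * \<beta> - \<kappa>^2)"
  unfolding vec_eq_iff forall_4 signature_matrix_mult \<Omega>_def
  by (simp_all add: heis_curvature_def Let_def sum_4 heis_connection_nth alternating_def
      matrix_matrix_mult_def algebra_simps power2_eq_square)

text \<open>The sum over ordered pairs counts each plane twice, which gives the common factor 2 and
  leaves \<Lambda>/3 inside. Raising indices flips the sign of the curvature on the planes 13, 14,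
  23 and 24.\<close>

lemma frame_weyl_alternating:
  "frame_weyl \<Omega> \<Lambda> (alternating x12 x13 x14 x23 x24 x34) = (let \<tau> = \<kappa> * (\<beta> - \<alpha>) in 2 *\<^sub>R alternating
     ((\<beta>^2 - \<beta>' - \<Lambda> / 3) * x12 + \<tau> * x34) ((\<beta>^2 - \<beta>' - \<Lambda> / 3) * x13 + \<tau> * x24)
     ((\<alpha>^2 - \<alpha>' - \<Lambda> / 3) * x14 + 2 * \<tau> * x23) ((3 * \<kappa>^2 + \<beta>^2 - \<Lambda> / 3) * x23 + 2 * \<tau> * x14)
     ((\<alpha> * \<beta> - \<kappa>^2 - \<Lambda> / 3) * x24 + \<tau> * x13) ((\<alpha> * \<beta> - \<kappa>^2 - \<Lambda> / 3) * x34 + \<tau> * x12))"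
proof -
  have sw: "\<Omega> b a = - \<Omega> a b" for a b
    unfolding \<Omega>_def by (rule heis_curvature_swap)
  have diag: "\<Omega> a a = 0" for a
    using sw [of a a] by (simp add: vec_eq_iff)
  have "frame_weyl \<Omega> \<Lambda> (alternating x12 x13 x14 x23 x24 x34) =
      (x12 *\<^sub>R (signature_matrix ** \<Omega> 1 2) + x12 *\<^sub>R (signature_matrix ** \<Omega> 1 2))
      - (x13 *\<^sub>R (signature_matrix ** \<Omega> 1 3) + x13 *\<^sub>R (signature_matrix ** \<Omega> 1 3))
      - (x14 *\<^sub>R (signature_matrix ** \<Omega> 1 4) + x14 *\<^sub>R (signature_matrix ** \<Omega> 1 4))
      - (x23 *\<^sub>R (signature_matrix ** \<Omega> 2 3) + x23 *\<^sub>R (signature_matrix ** \<Omega> 2 3))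
      - (x24 *\<^sub>R (signature_matrix ** \<Omega> 2 4) + x24 *\<^sub>R (signature_matrix ** \<Omega> 2 4))
      + (x34 *\<^sub>R (signature_matrix ** \<Omega> 3 4) + x34 *\<^sub>R (signature_matrix ** \<Omega> 3 4))
      - (2 * \<Lambda> / 3) *\<^sub>R alternating x12 x13 x14 x23 x24 x34"
    by (simp add: frame_weyl_def sum_4 signature_matrix_mult diag sw [of 1 2] sw [of 1 3] sw [of 1 4] sw [of 2 3]
        sw [of 2 4] sw [of 3 4] matrix_mult_simps alternating_nth)
  then show ?thesis
    unfolding heis_curvature_nth
    by (simp add: alternating_scaleR alternating_add alternating_eq_iff Let_def algebra_simps)
qed

lemma heis_weyl_eigenvalues:
  assumes sd: "\<And>F. transpose F = - F \<Longrightarrow> hodge s signature_matrix (frame_weyl \<Omega> \<Lambda> F) = frame_weyl \<Omega> \<Lambda> F"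
    and s: "s * s = 1"
    and \<Lambda>: "\<Lambda> / 3 * (3 * \<kappa> + \<beta>) = (\<kappa> + \<beta>)^3" "3 * \<kappa> + \<beta> \<noteq> 0"
    and \<nu>: "\<nu> = - 16 * \<kappa>^3 / (3 * \<kappa> + \<beta>)"
  shows "frame_weyl \<Omega> \<Lambda> (alternating 1 0 0 0 0 s) = \<nu> *\<^sub>R alternating 1 0 0 0 0 s"
    and "frame_weyl \<Omega> \<Lambda> (alternating 0 1 0 0 s 0) = \<nu> *\<^sub>R alternating 0 1 0 0 s 0"
    and "frame_weyl \<Omega> \<Lambda> (alternating 0 0 1 (- s) 0 0) = (- 2 * \<nu>) *\<^sub>R alternating 0 0 1 (- s) 0 0"
proof -
  define \<tau> where "\<tau> = \<kappa> * (\<beta> - \<alpha>)"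
  define S12 S13 S01 S03 where "S12 = 3 * \<kappa>^2 + \<beta>^2 - \<Lambda> / 3" and "S13 = \<alpha> * \<beta> - \<kappa>^2 - \<Lambda> / 3"
    and "S01 = \<beta>^2 - \<beta>' - \<Lambda> / 3" and "S03 = \<alpha>^2 - \<alpha>' - \<Lambda> / 3"
  have w: "frame_weyl \<Omega> \<Lambda> (alternating x12 x13 x14 x23 x24 x34) = 2 *\<^sub>R alternating
      (S01 * x12 + \<tau> * x34) (S01 * x13 + \<tau> * x24) (S03 * x14 + 2 * \<tau> * x23)
      (S12 * x23 + 2 * \<tau> * x14) (S13 * x24 + \<tau> * x13) (S13 * x34 + \<tau> * x12)" for x12 x13 x14 x23 x24 x34
    unfolding frame_weyl_alternating Let_def \<tau>_def S12_def S13_def S01_def S03_def by (rule refl)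
  \<comment> \<open>The coefficients \<open>x13\<close> and \<open>x24\<close> are set to 0 because
    their block has the same entries as that of \<open>x12\<close> and \<open>x34\<close>. Each
    relation below comes from a form with a single nonzero coefficient.\<close>
  have eqs: "s * (2 * (S13 * x34 + \<tau> * x12)) = 2 * (S01 * x12 + \<tau> * x34) \<and>
      - s * (2 * (S12 * x23 + 2 * \<tau> * x14)) = 2 * (S03 * x14 + 2 * \<tau> * x23)" for x12 x14 x23 x34
    using sd [OF transpose_alternating [of x12 0 x14 x23 0 x34]]
    unfolding w alternating_scaleR hodge_alternating alternating_eq_iff by blast
  have ss: "s * (s * x) = x" for x
    using s by (simp add: mult.assoc [symmetric])
  have S01: "S01 = s * \<tau>"
    using eqs [of 0 1 0 0] by simp
  have "s * S13 = \<tau>"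
    using eqs [of 1 0 0 0] by simp
  then have S13: "S13 = s * \<tau>"
    using ss [of S13] by simp
  have S03: "S03 = - (2 * (s * \<tau>))"
    using eqs [of 0 0 0 1] by (simp add: mult.commute)
  have "- (s * S12) = 2 * \<tau>"
    using eqs [of 0 0 1 0] by (simp add: mult.commute)
  then have "s * S12 = - 2 * \<tau>"
    by linarith
  then have "s * (s * S12) = - (2 * (s * \<tau>))"
    by simp
  then have S12: "S12 = - (2 * (s * \<tau>))"
    by (simp only: ss)
  \<comment> \<open>In (3\<kappa>^2 + \<beta>^2)(3\<kappa> + \<beta>) - (\<kappa> + \<beta>)^3
    everything but 8\<kappa>^3 cancels. As \<nu> is -2 times \<open>S12\<close>, this is the origin
    of the constant 16.\<close>
  have "S12 * (3 * \<kappa> + \<beta>) = 8 * \<kappa>^3"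
    using \<Lambda>(1) by (simp add: S12_def left_diff_distrib) (simp add: algebra_simps power2_eq_square power3_eq_cube)
  then have "- (2 * (s * \<tau>)) = 8 * \<kappa>^3 / (3 * \<kappa> + \<beta>)"
    unfolding S12 by (rule nonzero_eq_divide_eq [OF \<Lambda>(2), THEN iffD2])
  then have \<nu>': "\<nu> = 4 * (s * \<tau>)"
    unfolding \<nu> by linarith
  show "frame_weyl \<Omega> \<Lambda> (alternating 1 0 0 0 0 s) = \<nu> *\<^sub>R alternating 1 0 0 0 0 s"
    "frame_weyl \<Omega> \<Lambda> (alternating 0 1 0 0 s 0) = \<nu> *\<^sub>R alternating 0 1 0 0 s 0"
    "frame_weyl \<Omega> \<Lambda> (alternating 0 0 1 (- s) 0 0) = (- 2 * \<nu>) *\<^sub>R alternating 0 0 1 (- s) 0 0"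
    unfolding w S01 S03 S12 S13 \<nu>' alternating_scaleR alternating_eq_iff by (simp_all add: s ss ac_simps)
qed

end

section \<open>The adapted coframe in coordinates\<close>

lemma smooth_on_interval_differentiable:
  assumes "smooth_on_interval I F" "t \<in> I"
  shows "F differentiable (at t)" "deriv F differentiable (at t)"
proof -
  have "(deriv ^^ n) F differentiable (at t)" for n
    using assms by (simp add: smooth_on_interval_def)
  from this [of 0] this [of 1] show "F differentiable (at t)" "deriv F differentiable (at t)"
    by simp_all
qed

lemma pd_affine_div_coord:
  fixes F :: "real \<Rightarrow> real"
  assumes "F differentiable (at (q $ m))" "F (q $ m) \<noteq> 0"
  shows "pd i (\<lambda>q. (c + d * q $ j) / F (q $ m)) q
    = (if i = j then d else 0) / F (q $ m) - (if i = m then (c + d * q $ j) * deriv F (q $ m) / (F (q $ m))^2 else 0)"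
proof -
  have "((\<lambda>q. (c + d * q $ j) / F (q $ m)) has_derivative
      (\<lambda>v. d * v $ j / F (q $ m) - (c + d * q $ j) * (v $ m * deriv F (q $ m)) / (F (q $ m))^2)) (at q)"
    using assms
    by (auto intro!: derivative_eq_intros has_derivative_coord has_derivative_coord_compose simp: field_simps power2_eq_square)
  then show ?thesis
    by (simp add: pd_eqI axis_nth)
qed

lemma pd_const_div_coord:
  fixes F :: "real \<Rightarrow> real"
  assumes "F differentiable (at (q $ m))" "F (q $ m) \<noteq> 0"
  shows "pd i (\<lambda>q. c / F (q $ m)) q = (if i = m then - (c * deriv F (q $ m) / (F (q $ m))^2) else 0)"
  using pd_affine_div_coord [OF assms, of i c 0 i] by simp

text \<open>The nonconstant entries of the coframe matrix have this shape. Symmetry of the second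
  derivatives is read off from an explicit formula, so that differentiability of
  \<open>deriv F\<close> suffices and no continuity of second derivatives enters.\<close>

lemma pd_affine_div_coord_commute:
  fixes F :: "real \<Rightarrow> real"
  assumes "open U" "p \<in> U" and F: "\<And>q. q \<in> U \<Longrightarrow> F differentiable (at (q $ m))"
    "\<And>q. q \<in> U \<Longrightarrow> deriv F differentiable (at (q $ m))" "\<And>q. q \<in> U \<Longrightarrow> F (q $ m) \<noteq> 0"
  shows "pd i (pd j (\<lambda>q. (c + d * q $ n) / F (q $ m))) p = pd j (pd i (\<lambda>q. (c + d * q $ n) / F (q $ m))) p"
proof -
  let ?f = "\<lambda>q. (c + d * q $ n) / F (q $ m)"
  have der: "((\<lambda>q. deriv F (q $ m) / (F (q $ m))^2) has_derivative
      (\<lambda>v. v $ m * (deriv (deriv F) (p $ m) / (F (p $ m))^2 - 2 * (deriv F (p $ m))^2 / (F (p $ m))^3))) (at p)"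
    using assms
    by (auto intro!: derivative_eq_intros has_derivative_coord_compose simp: field_simps power2_eq_square power3_eq_cube)
  have der': "((\<lambda>q. (c + d * q $ n) * (deriv F (q $ m) / (F (q $ m))^2)) has_derivative
      (\<lambda>v. d * v $ n * (deriv F (p $ m) / (F (p $ m))^2) + (c + d * p $ n) *
        (v $ m * (deriv (deriv F) (p $ m) / (F (p $ m))^2 - 2 * (deriv F (p $ m))^2 / (F (p $ m))^3)))) (at p)"
    by (rule derivative_eq_intros der has_derivative_coord refl)+ (simp add: algebra_simps)
  have "pd i (pd j ?f) p = - (if j = n then d else 0) * (if i = m then deriv F (p $ m) / (F (p $ m))^2 else 0)
      - (if j = m then (if i = n then d else 0) * (deriv F (p $ m) / (F (p $ m))^2) + (c + d * p $ n) *
        ((if i = m then 1 else 0) * (deriv (deriv F) (p $ m) / (F (p $ m))^2 - 2 * (deriv F (p $ m))^2 / (F (p $ m))^3))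
        else 0)" (is "_ = ?R i j") for i j
  proof -
    have "pd i (pd j ?f) p = pd i (\<lambda>q. (if j = n then d else 0) / F (q $ m)
        - (if j = m then 1 else 0) * ((c + d * q $ n) * (deriv F (q $ m) / (F (q $ m))^2))) p"
      using assms by (intro pd_cong_open [OF assms(1,2)]) (simp add: pd_affine_div_coord)
    also have "\<dots> = ?R i j"
    proof -
      have 1: "((\<lambda>q. (if j = n then d else 0) / F (q $ m)) has_derivative
          (\<lambda>v. - ((if j = n then d else 0) * (v $ m * deriv F (p $ m) / (F (p $ m))^2)))) (at p)"
        using assms
        by (auto intro!: derivative_eq_intros has_derivative_coord_compose simp: field_simps power2_eq_square)
      show ?thesis
        by (subst pd_eqI [OF has_derivative_diff [OF 1 has_derivative_mult_right [OF der']]])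
          (simp add: axis_nth)
    qed
    finally show ?thesis .
  qed
  then show ?thesis
    by simp
qed

text \<open>Separates the functions of t from constant matrices, so that the connection can be
  differentiated by the product rule.\<close>

lemma heis_connection_linear:
  "heis_connection \<alpha> \<beta> \<kappa> c = \<alpha> *\<^sub>R heis_connection 1 0 0 c + \<beta> *\<^sub>R heis_connection 0 1 0 c
    + \<kappa> *\<^sub>R heis_connection 0 0 1 c"
proof -
  have "\<forall>c. heis_connection \<alpha> \<beta> \<kappa> c = \<alpha> *\<^sub>R heis_connection 1 0 0 c + \<beta> *\<^sub>R heis_connection 0 1 0 c
      + \<kappa> *\<^sub>R heis_connection 0 0 1 c"
    unfolding forall_4 heis_connection_nth vec_eq_iff by simp
  then show ?thesis ..
qed

lemma heis_connection_skew:
  "transpose (heis_connection \<alpha> \<beta> \<kappa> c) ** signature_matrix = - (signature_matrix ** heis_connection \<alpha> \<beta> \<kappa> c)"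
proof -
  have "\<forall>c. transpose (heis_connection \<alpha> \<beta> \<kappa> c) ** signature_matrix = - (signature_matrix ** heis_connection \<alpha> \<beta> \<kappa> c)"
    unfolding forall_4 heis_connection_nth vec_eq_iff signature_matrix_mult vector_uminus_component
    by (simp add: transpose_def)
  then show ?thesis ..
qed

text \<open>The right-hand sides are the differentials of the coframe on two vectors with frame
  components \<open>x\<close> and \<open>y\<close>: scaling by 1/b and 1/a produces the terms with
  \<beta> and \<alpha>, and the bracket adds \<open>2 * \<kappa>\<close> times
  \<open>e\<^sup>1 \<and> e\<^sup>2\<close> to the differential of the central element.\<close>

lemma heis_connection_torsion:
  fixes x y :: "4 \<Rightarrow> real" and \<alpha> \<beta> \<kappa> :: real
  defines "T \<equiv> \<lambda>c. \<Sum>a\<in>UNIV. \<Sum>b\<in>UNIV. (heis_connection \<alpha> \<beta> \<kappa> b $ c $ a - heis_connection \<alpha> \<beta> \<kappa> a $ c $ b) * x a * y b"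
  shows "T 1 = 0" "T 2 = - \<beta> * (x 1 * y 2 - x 2 * y 1)" "T 3 = - \<beta> * (x 1 * y 3 - x 3 * y 1)"
    "T 4 = - \<alpha> * (x 1 * y 4 - x 4 * y 1) + 2 * \<kappa> * (x 2 * y 3 - x 3 * y 2)"
  by (simp_all add: T_def sum_4 heis_connection_nth algebra_simps)

text \<open>
  In exponential coordinates the left-invariant coframe is \<open>P11 dx + P12 dy\<close>, \<open>P21 dx + P22 dy\<close> and
  \<open>(Q1 + w y/2) dx + (Q2 - w x/2) dy + w dz\<close>; the relation for \<open>w\<close> is the bracket
  \<open>[e\<^sub>1, e\<^sub>2] = -2 k e\<^sub>3\<close>.
\<close>

locale heis_frame =
  fixes I :: "real set" and a b :: "real \<Rightarrow> real" and k P11 P12 P21 P22 Q1 Q2 w :: real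
  assumes open_I: "open I" and smooth_a: "smooth_on_interval I a" and smooth_b: "smooth_on_interval I b"
    and a_nz: "\<And>t. t \<in> I \<Longrightarrow> a t \<noteq> 0" and b_nz: "\<And>t. t \<in> I \<Longrightarrow> b t \<noteq> 0"
    and k_nz: "k \<noteq> 0" and det_nz: "P11 * P22 - P12 * P21 \<noteq> 0" and w: "w = - 2 * k * (P11 * P22 - P12 * P21)"
begin

text \<open>The rows are dt and the three coframe elements at time t. The entries keep the literal
  shape \<open>(c + d * q $ j) / F (q $ m)\<close>, to which the derivative formulas above apply by
  rewriting.\<close>

definition Theta :: "real^4 \<Rightarrow> real^4^4" where
  "Theta p = vector [vector [1, 0, 0, 0],
     vector [0, P11 / b (p $ 1), P12 / b (p $ 1), 0],
     vector [0, P21 / b (p $ 1), P22 / b (p $ 1), 0],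
     vector [0, (Q1 + w / 2 * p $ 3) / a (p $ 1), (Q2 + (- w / 2) * p $ 2) / a (p $ 1), w / a (p $ 1)]]"

text \<open>The inverse of \<open>Theta\<close>, given by explicit entries so that its smoothness
  can be checked entry by entry.\<close>

definition Frame :: "real^4 \<Rightarrow> real^4^4" where
  "Frame p = (let \<delta> = P11 * P22 - P12 * P21; u = Q1 + w / 2 * p $ 3; v = Q2 + (- w / 2) * p $ 2 in
     vector [vector [1, 0, 0, 0],
     vector [0, b (p $ 1) * P22 / \<delta>, - (b (p $ 1) * P12 / \<delta>), 0],
     vector [0, - (b (p $ 1) * P21 / \<delta>), b (p $ 1) * P11 / \<delta>, 0],
     vector [0, b (p $ 1) * (v * P21 - u * P22) / (w * \<delta>), b (p $ 1) * (u * P12 - v * P11) / (w * \<delta>), a (p $ 1) / w]])"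

abbreviation "U \<equiv> heis_manifold I"

definition al where "al t = deriv a t / a t"
definition be where "be t = deriv b t / b t"
definition ka where "ka t = k * (b t)^2 / a t"

lemma w_nz: "w \<noteq> 0"
  using k_nz det_nz by (simp add: w)

lemma open_U: "open U"
proof -
  have "continuous_on UNIV (\<lambda>p::real^4. p $ 1)"
    by (intro continuous_intros)
  then have "open ((\<lambda>p::real^4. p $ 1) -` I)"
    using open_I by (simp add: continuous_on_open_vimage)
  then show ?thesis
    by (simp add: heis_manifold_def vimage_def)
qed

lemma Frame_Theta:
  assumes "q \<in> U"
  shows "Frame q ** Theta q = mat 1"
proof -
  define \<delta> where "\<delta> = P11 * P22 - P12 * P21"
  have nz: "\<delta> \<noteq> 0" "w \<noteq> 0" "a (q $ 1) \<noteq> 0" "b (q $ 1) \<noteq> 0"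
    using assms a_nz b_nz w_nz det_nz by (auto simp: \<delta>_def heis_manifold_def)
  show ?thesis
    using nz unfolding vec_eq_iff forall_4 Frame_def Theta_def Let_def \<delta>_def [symmetric]
    by (simp add: matrix_matrix_mult_def sum_4 mat_def)
      (simp add: divide_simps, simp add: \<delta>_def algebra_simps)
qed

lemmas smooth_intros = smooth_fun_const smooth_fun_coord smooth_fun_add [OF open_U] smooth_fun_diff [OF open_U]
  smooth_fun_minus [OF open_U] smooth_fun_mult [OF open_U] smooth_fun_divide [OF open_U]
  smooth_fun_power [OF open_U] smooth_fun_exp [OF open_U]

lemma smooth_a_coord: "smooth_fun U (\<lambda>p. a (p $ 1))"
  by (rule smooth_fun_coord_compose [OF open_U smooth_a]) (simp add: heis_manifold_def)

lemma smooth_b_coord: "smooth_fun U (\<lambda>p. b (p $ 1))"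
  by (rule smooth_fun_coord_compose [OF open_U smooth_b]) (simp add: heis_manifold_def)

lemma smooth_Theta: "smooth_mat U Theta"
  unfolding smooth_mat_def forall_4 Theta_def vector_4
  by (intro conjI smooth_intros smooth_a_coord smooth_b_coord) (auto simp: heis_manifold_def a_nz b_nz)

lemma smooth_Frame: "smooth_mat U Frame"
  unfolding smooth_mat_def forall_4 Frame_def Let_def vector_4
  using w_nz det_nz
  by (intro conjI smooth_intros smooth_a_coord smooth_b_coord) auto

lemma pd_Theta:
  assumes "q \<in> U"
  shows "pd i Theta q = vector [0,
     vector [0, if i = 1 then - (P11 * be (q $ 1) / b (q $ 1)) else 0, if i = 1 then - (P12 * be (q $ 1) / b (q $ 1)) else 0, 0],
     vector [0, if i = 1 then - (P21 * be (q $ 1) / b (q $ 1)) else 0, if i = 1 then - (P22 * be (q $ 1) / b (q $ 1)) else 0, 0],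
     vector [0, (if i = 3 then w / 2 else 0) / a (q $ 1) - (if i = 1 then (Q1 + w / 2 * q $ 3) * al (q $ 1) / a (q $ 1) else 0),
       (if i = 2 then - w / 2 else 0) / a (q $ 1) - (if i = 1 then (Q2 + (- w / 2) * q $ 2) * al (q $ 1) / a (q $ 1) else 0),
       if i = 1 then - (w * al (q $ 1) / a (q $ 1)) else 0]]"
proof -
  have t: "q $ 1 \<in> I"
    using assms by (simp add: heis_manifold_def)
  note pd_a = pd_affine_div_coord [of a, OF smooth_on_interval_differentiable(1) [OF smooth_a t] a_nz [OF t]]
    pd_const_div_coord [of a, OF smooth_on_interval_differentiable(1) [OF smooth_a t] a_nz [OF t]]
  note pd_b = pd_const_div_coord [of b, OF smooth_on_interval_differentiable(1) [OF smooth_b t] b_nz [OF t]]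
  have n: "pd i Theta q $ r $ s = pd i (\<lambda>q. Theta q $ r $ s) q" for r s
    using smooth_mat_differentiable [OF smooth_Theta assms]
    by (simp add: pd_nth [of "\<lambda>q. Theta q $ r"] pd_nth differentiable_nth)
  show ?thesis
    unfolding vec_eq_iff forall_4 n
    unfolding Theta_def vector_4 zero_index pd_const pd_a pd_b
    by (simp add: al_def be_def power2_eq_square)
qed

lemma pd_pd_Theta:
  assumes "p \<in> U"
  shows "pd i (pd j Theta) p = pd j (pd i Theta) p"
proof -
  have n: "pd i (pd j Theta) p $ r $ s = pd i (pd j (\<lambda>q. Theta q $ r $ s)) p" for r s i j
  proof -
    have n1: "pd j Theta q $ r $ s = pd j (\<lambda>q. Theta q $ r $ s) q" if "q \<in> U" for q
      using smooth_mat_differentiable [OF smooth_Theta that]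
      by (simp add: pd_nth [of "\<lambda>q. Theta q $ r"] pd_nth differentiable_nth)
    have "pd i (pd j Theta) p $ r $ s = pd i (\<lambda>q. pd j Theta q $ r $ s) p"
      using smooth_mat_differentiable [OF smooth_mat_pd [OF open_U smooth_Theta] assms]
      by (simp add: pd_nth [of "\<lambda>q. pd j Theta q $ r"] pd_nth differentiable_nth)
    also have "\<dots> = pd i (pd j (\<lambda>q. Theta q $ r $ s)) p"
      using n1 by (intro pd_cong_open [OF open_U assms])
    finally show ?thesis .
  qed
  have ab: "a differentiable (at (q $ 1))" "deriv a differentiable (at (q $ 1))" "a (q $ 1) \<noteq> 0"
    "b differentiable (at (q $ 1))" "deriv b differentiable (at (q $ 1))" "b (q $ 1) \<noteq> 0" if "q \<in> U" for q
    using that smooth_on_interval_differentiable [OF smooth_a] smooth_on_interval_differentiable [OF smooth_b] a_nz b_nz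
    by (auto simp: heis_manifold_def)
  have c: "pd i (pd j (\<lambda>q. (c + d * q $ n) / a (q $ 1))) p = pd j (pd i (\<lambda>q. (c + d * q $ n) / a (q $ 1))) p"
    "pd i (pd j (\<lambda>q. (c + d * q $ n) / b (q $ 1))) p = pd j (pd i (\<lambda>q. (c + d * q $ n) / b (q $ 1))) p" for c d n
    using ab by (intro pd_affine_div_coord_commute [OF open_U assms]; simp)+
  have c0: "pd i (pd j (\<lambda>q. c / a (q $ 1))) p = pd j (pd i (\<lambda>q. c / a (q $ 1))) p"
    "pd i (pd j (\<lambda>q. c / b (q $ 1))) p = pd j (pd i (\<lambda>q. c / b (q $ 1))) p" for c
    using c [of c 0] by simp_all
  have k: "pd j (\<lambda>q. r) = (\<lambda>q. 0)" for j :: 4 and r :: real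
    by (simp add: fun_eq_iff)
  show ?thesis
    unfolding vec_eq_iff forall_4 n
    unfolding Theta_def vector_4 k pd_const
    by (intro conjI refl c c0)
qed

lemma al_be_ka_derivative:
  assumes "t \<in> I"
  shows "al differentiable (at t)" "be differentiable (at t)" "ka differentiable (at t)"
    "deriv ka t = ka t * (2 * be t - al t)"
proof -
  have a: "(a has_real_derivative deriv a t) (at t)" "(deriv a has_real_derivative deriv (deriv a) t) (at t)"
    using smooth_on_interval_differentiable [OF smooth_a assms] by (simp_all add: DERIV_deriv_iff_real_differentiable)
  have b: "(b has_real_derivative deriv b t) (at t)" "(deriv b has_real_derivative deriv (deriv b) t) (at t)"
    using smooth_on_interval_differentiable [OF smooth_b assms] by (simp_all add: DERIV_deriv_iff_real_differentiable)
  note nz = a_nz [OF assms] b_nz [OF assms]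
  show "al differentiable (at t)" "be differentiable (at t)"
    using DERIV_divide [OF a(2,1) nz(1)] DERIV_divide [OF b(2,1) nz(2)]
    unfolding al_def [abs_def] be_def [abs_def] by (auto simp: real_differentiable_def)
  have "(ka has_real_derivative ka t * (2 * be t - al t)) (at t)"
    unfolding ka_def [abs_def] be_def al_def using nz
    by (auto intro!: derivative_eq_intros a b simp: field_simps power2_eq_square)
  then show "ka differentiable (at t)" "deriv ka t = ka t * (2 * be t - al t)"
    by (auto simp: real_differentiable_def intro: DERIV_imp_deriv)
qed

lemma riemann_up_heis:
  assumes g: "\<And>q. q \<in> U \<Longrightarrow> g q = transpose (Theta q) ** signature_matrix ** Theta q" and p: "p \<in> U"
  shows "riemann_up g m l i j p = (Frame p ** (\<Sum>r\<in>UNIV. \<Sum>s\<in>UNIV. (Theta p $ r $ i * Theta p $ s $ j) *\<^sub>R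
    heis_curvature (al (p $ 1)) (be (p $ 1)) (ka (p $ 1)) (deriv al (p $ 1)) (deriv be (p $ 1)) r s) ** Theta p) $ m $ l"
proof (rule riemann_up_frame_components
    [where \<eta> = signature_matrix and \<gamma> = "\<lambda>c q. heis_connection (al (q $ 1)) (be (q $ 1)) (ka (q $ 1)) c"
      and D\<gamma> = "\<lambda>r s. if r = 1 then heis_connection (deriv al (p $ 1)) (deriv be (p $ 1)) (ka (p $ 1) * (2 * be (p $ 1) - al (p $ 1))) s else 0"])
  have diff: "(\<lambda>q. al (q $ 1)) differentiable (at q)" "(\<lambda>q. be (q $ 1)) differentiable (at q)"
    "(\<lambda>q. ka (q $ 1)) differentiable (at q)" if "q \<in> U" for q :: "real^4"
    using that al_be_ka_derivative [of "q $ 1"]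
    by (auto simp: heis_manifold_def intro: has_derivative_coord_compose [THEN differentiableI])
  show "Frame q ** Theta q = mat 1" if "q \<in> U" for q
    by (rule Frame_Theta [OF that])
  show "Frame differentiable (at q)" if "q \<in> U" for q
    by (rule smooth_mat_differentiable [OF smooth_Frame that])
  show "Theta differentiable (at q)" if "q \<in> U" for q
    by (rule smooth_mat_differentiable [OF smooth_Theta that])
  show "pd i Theta differentiable (at q)" if "q \<in> U" for q i
    by (rule smooth_mat_differentiable [OF smooth_mat_pd [OF open_U smooth_Theta] that])
  show "(\<lambda>q. heis_connection (al (q $ 1)) (be (q $ 1)) (ka (q $ 1)) c) differentiable (at q)" if "q \<in> U" for q c
    using diff [OF that]
    by (subst heis_connection_linear) (intro differentiable_add differentiable_scaleR differentiable_const)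
  show "transpose (heis_connection (al (q $ 1)) (be (q $ 1)) (ka (q $ 1)) c) ** signature_matrix
      = - (signature_matrix ** heis_connection (al (q $ 1)) (be (q $ 1)) (ka (q $ 1)) c)" for q c
    by (rule heis_connection_skew)
  show "invertible signature_matrix"
    by (rule matrix_inv_unique(3) [OF signature_matrix_square])
  \<comment> \<open>The connection coefficients depend on t alone, so only the first frame vector
    differentiates them, and its dual covector dt has the single component 1.\<close>
  have "Theta p $ r $ i *\<^sub>R (if r = 1 then X else 0) = (if r = 1 then (if i = 1 then X else 0) else 0)" for r i and X :: "real^4^4"
    using exhaust_4 [of i] by (auto simp: Theta_def)
  then have \<Theta>1: "(\<Sum>r\<in>UNIV. Theta p $ r $ i *\<^sub>R (if r = 1 then X else 0)) = (if i = 1 then X else 0)" for i and X :: "real^4^4"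
    by simp
  show "pd i (\<lambda>q. heis_connection (al (q $ 1)) (be (q $ 1)) (ka (q $ 1)) s) p = (\<Sum>r\<in>UNIV. Theta p $ r $ i *\<^sub>R
      (if r = 1 then heis_connection (deriv al (p $ 1)) (deriv be (p $ 1)) (ka (p $ 1) * (2 * be (p $ 1) - al (p $ 1))) s else 0))" for i s
  proof -
    let ?A = "heis_connection 1 0 0 s" and ?B = "heis_connection 0 1 0 s" and ?C = "heis_connection 0 0 1 s"
    have "(\<lambda>q :: real^4. heis_connection (al (q $ 1)) (be (q $ 1)) (ka (q $ 1)) s)
        = (\<lambda>q. al (q $ 1) *\<^sub>R ?A + be (q $ 1) *\<^sub>R ?B + ka (q $ 1) *\<^sub>R ?C)"
      by (rule ext) (rule heis_connection_linear)
    then have "pd i (\<lambda>q. heis_connection (al (q $ 1)) (be (q $ 1)) (ka (q $ 1)) s) p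
        = (if i = 1 then deriv al (p $ 1) *\<^sub>R ?A + deriv be (p $ 1) *\<^sub>R ?B + deriv ka (p $ 1) *\<^sub>R ?C else 0)"
      using diff [OF p] p al_be_ka_derivative(1-3) [of "p $ 1"]
      by (simp add: pd_add pd_scaleR differentiable_add differentiable_scaleR heis_manifold_def pd_coord_compose)
    then show ?thesis
      unfolding \<Theta>1 using p al_be_ka_derivative(4) [of "p $ 1"]
      by (simp add: heis_manifold_def heis_connection_linear [of "deriv al (p $ 1)"])
  qed
  show "pd i Theta q $ c $ j - pd j Theta q $ c $ i = (\<Sum>r\<in>UNIV. \<Sum>s\<in>UNIV.
      (heis_connection (al (q $ 1)) (be (q $ 1)) (ka (q $ 1)) s $ c $ r
        - heis_connection (al (q $ 1)) (be (q $ 1)) (ka (q $ 1)) r $ c $ s) * Theta q $ r $ i * Theta q $ s $ j)"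
    if q: "q \<in> U" for q c i j
  proof -
    have t: "q $ 1 \<in> I"
      using q by (simp add: heis_manifold_def)
    have "\<forall>c i j. pd i Theta q $ c $ j - pd j Theta q $ c $ i = (\<Sum>r\<in>UNIV. \<Sum>s\<in>UNIV.
      (heis_connection (al (q $ 1)) (be (q $ 1)) (ka (q $ 1)) s $ c $ r
        - heis_connection (al (q $ 1)) (be (q $ 1)) (ka (q $ 1)) r $ c $ s) * Theta q $ r $ i * Theta q $ s $ j)"
      unfolding forall_4 heis_connection_torsion pd_Theta [OF q] Theta_def
      using a_nz [OF t] b_nz [OF t]
      by (simp add: ka_def w) (simp add: field_simps power2_eq_square)
    then show ?thesis
      by blast
  qed
qed (use p in \<open>auto simp: heis_curvature_def Let_def open_U g pd_pd_Theta transpose_signature_matrix\<close>)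

end

section \<open>Eigenforms of the Weyl operator\<close>

lemma congruence_alternating: "transpose F = - F \<Longrightarrow> transpose (transpose \<Theta> ** F ** \<Theta>) = - (transpose \<Theta> ** F ** (\<Theta> :: real^'n^'n))"
  by (simp add: matrix_transpose_mul matrix_mul_assoc matrix_mult_simps)

lemma congruence_cancel:
  fixes \<Theta> E :: "real^'n^'n"
  assumes "E ** \<Theta> = mat 1"
  shows "transpose E ** (transpose \<Theta> ** F ** \<Theta>) ** E = F" "transpose \<Theta> ** (transpose E ** F ** E) ** \<Theta> = F"
    and "transpose \<Theta> ** F ** \<Theta> = transpose \<Theta> ** G ** \<Theta> \<longleftrightarrow> F = G"
proof -
  have inv': "\<Theta> ** E = mat 1"
    using assms matrix_left_right_inverse by blast
  have c: "transpose E ** (transpose \<Theta> ** F ** \<Theta>) ** E = F" if "\<Theta> ** E = mat 1" for E \<Theta> F :: "real^'n^'n"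
  proof -
    have t: "transpose E ** transpose \<Theta> = mat 1"
      by (simp add: matrix_transpose_mul [symmetric] that transpose_mat)
    have "transpose E ** (transpose \<Theta> ** F ** \<Theta>) ** E = (transpose E ** transpose \<Theta>) ** F ** (\<Theta> ** E)"
      by (simp only: matrix_mul_assoc)
    then show ?thesis
      by (simp add: t that)
  qed
  show 1: "transpose E ** (transpose \<Theta> ** F ** \<Theta>) ** E = F"
    by (rule c [OF inv'])
  show "transpose \<Theta> ** (transpose E ** F ** E) ** \<Theta> = F"
    by (rule c [OF assms])
  show "transpose \<Theta> ** F ** \<Theta> = transpose \<Theta> ** G ** \<Theta> \<longleftrightarrow> F = G"
  proof
    assume "transpose \<Theta> ** F ** \<Theta> = transpose \<Theta> ** G ** \<Theta>"
    then have "transpose E ** (transpose \<Theta> ** F ** \<Theta>) ** E = transpose E ** (transpose \<Theta> ** G ** \<Theta>) ** E"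
      by (simp only:)
    then show "F = G"
      by (simp only: c [OF inv'])
  qed (simp only:)
qed

lemma sum_axis: "(\<Sum>k\<in>UNIV. axis r 1 $ k * f k) = (f r :: real)"
proof -
  have "(\<Sum>k\<in>UNIV. axis r 1 $ k * f k) = (\<Sum>k\<in>UNIV. if r = k then f k else 0)"
    by (intro sum.cong) (auto simp: axis_nth)
  then show ?thesis
    by simp
qed

lemma wedge_rows: "wedge (\<Theta> $ r) (\<Theta> $ s) = transpose \<Theta> ** wedge (axis r 1) (axis s 1) ** (\<Theta> :: real^'n^'n)"
proof -
  have "(\<Sum>k\<in>UNIV. \<Sum>l\<in>UNIV. tensor (axis r 1) (axis s 1) $ k $ l * (\<Theta> $ k $ i * \<Theta> $ l $ j))
      = (\<Sum>k\<in>UNIV. axis r 1 $ k * (\<Theta> $ k $ i * (\<Sum>l\<in>UNIV. axis s 1 $ l * \<Theta> $ l $ j)))" for r s i j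
    by (simp add: tensor_def sum_distrib_left ac_simps)
  then have "tensor (\<Theta> $ r) (\<Theta> $ s) = transpose \<Theta> ** tensor (axis r 1) (axis s 1) ** \<Theta>" for r s
    unfolding vec_eq_iff matrix_congruence_nth(2) by (simp add: sum_axis) (simp add: tensor_def)
  then show ?thesis
    by (simp add: wedge_def matrix_mult_simps)
qed

lemma wedge_axis:
  "wedge (axis 1 1) (axis 2 1) = alternating 1 0 0 0 0 0"
  "wedge (axis 1 1) (axis 3 1) = alternating 0 1 0 0 0 0"
  "wedge (axis 1 1) (axis 4 1) = alternating 0 0 1 0 0 0"
  unfolding vec_eq_iff forall_4 by (simp_all add: wedge_def tensor_def axis_nth alternating_nth)

text \<open>The matrices of dt wedge e^i plus its star in the frame, with \<open>s\<close> the
  orientation sign relative to the frame.\<close>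

definition self_dual_basis :: "real \<Rightarrow> 3 \<Rightarrow> real^4^4" where
  "self_dual_basis s i = (vector [alternating 1 0 0 0 0 s, alternating 0 1 0 0 s 0, alternating 0 0 1 (- s) 0 0] :: real^4^4^3) $ i"

lemma self_dual_basis_nth:
  "self_dual_basis s 1 = alternating 1 0 0 0 0 s"
  "self_dual_basis s 2 = alternating 0 1 0 0 s 0"
  "self_dual_basis s 3 = alternating 0 0 1 (- s) 0 0"
  by (simp_all add: self_dual_basis_def)

lemma self_dual_basis_sum:
  "(\<Sum>i\<in>UNIV. c i *\<^sub>R self_dual_basis s i) = alternating (c 1) (c 2) (c 3) (- s * c 3) (s * c 2) (s * c 1)"
  by (simp add: sum_3 self_dual_basis_nth alternating_scaleR alternating_add mult.commute)

text \<open>A self-dual form is determined by its components along dt wedge e^i, and these can be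
  prescribed freely. Injectivity and independence together ensure that the three eigenvalues are
  listed completely and with multiplicity.\<close>

lemma self_dual_forms_frame:
  fixes \<Theta> E :: "real^4^4" and \<omega> :: "3 \<Rightarrow> real^4^4"
  assumes inv: "E ** \<Theta> = mat 1" and g: "g = transpose \<Theta> ** signature_matrix ** \<Theta>"
    and s: "s = \<sigma> * sgn (det \<Theta>)" "s * s = 1"
    and \<omega>: "\<And>i. \<omega> i = transpose \<Theta> ** self_dual_basis s i ** \<Theta>"
  shows "inj \<omega>" "independent (range \<omega>)" "span (range \<omega>) = self_dual_forms \<sigma> g"
proof -
  have h: "hodge \<sigma> g (transpose \<Theta> ** F ** \<Theta>) = transpose \<Theta> ** hodge s signature_matrix F ** \<Theta>" for F
    unfolding s(1) by (rule hodge_frame [OF inv g transpose_signature_matrix signature_matrix_square])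
  have ss: "s * (s * x) = x" for x
    using s(2) by (simp add: mult.assoc [symmetric])
  have sum\<omega>: "(\<Sum>i\<in>UNIV. c i *\<^sub>R \<omega> i)
      = transpose \<Theta> ** alternating (c 1) (c 2) (c 3) (- s * c 3) (s * c 2) (s * c 1) ** \<Theta>" for c
    unfolding self_dual_basis_sum [symmetric] by (simp add: \<omega> matrix_mult_simps)
  have zero: "alternating 0 0 0 0 0 0 = 0"
    unfolding vec_eq_iff forall_4 by (simp add: alternating_nth)
  have ind: "c i = 0" if "(\<Sum>i\<in>UNIV. c i *\<^sub>R \<omega> i) = 0" for c i
  proof -
    have "transpose \<Theta> ** alternating (c 1) (c 2) (c 3) (- s * c 3) (s * c 2) (s * c 1) ** \<Theta>
        = transpose \<Theta> ** alternating 0 0 0 0 0 0 ** \<Theta>"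
      using that by (simp add: sum\<omega> zero matrix_mult_simps)
    then have "\<forall>i. c i = 0"
      unfolding congruence_cancel(3) [OF inv] alternating_eq_iff forall_3 by blast
    then show ?thesis ..
  qed
  show inj: "inj \<omega>"
  proof (rule injI, rule ccontr)
    fix i j assume ij: "\<omega> i = \<omega> j" "i \<noteq> j"
    \<comment> \<open>Two equal values would give a linear relation with coefficients 1 and -1,
      which \<open>ind\<close> excludes.\<close>
    have "(\<Sum>l\<in>UNIV. (if l = i then 1 else if l = j then - 1 else 0) *\<^sub>R \<omega> l)
        = (\<Sum>l\<in>UNIV. (if l = i then \<omega> l else 0)) + (\<Sum>l\<in>UNIV. (if l = j then - \<omega> l else 0))"
      unfolding sum.distrib [symmetric] using ij(2) by (intro sum.cong) auto
    also have "\<dots> = 0"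
      using ij(1) by simp
    finally show False
      using ind [of "\<lambda>l. if l = i then 1 else if l = j then - 1 else 0" i] by simp
  qed
  show "independent (range \<omega>)"
  proof (rule independent_if_scalars_zero)
    fix f x assume f: "(\<Sum>x\<in>range \<omega>. f x *\<^sub>R x) = 0" and "x \<in> range \<omega>"
    then obtain i where i: "x = \<omega> i"
      by blast
    have "(\<Sum>i\<in>UNIV. f (\<omega> i) *\<^sub>R \<omega> i) = 0"
      using f by (simp add: sum.reindex [OF inj])
    from ind [OF this] show "f x = 0"
      by (simp add: i)
  qed simp
  have sd: "\<omega> i \<in> self_dual_forms \<sigma> g" for i
  proof -
    have "\<forall>i. transpose (self_dual_basis s i) = - self_dual_basis s i
        \<and> hodge s signature_matrix (self_dual_basis s i) = self_dual_basis s i"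
      unfolding forall_3 self_dual_basis_nth transpose_alternating hodge_alternating alternating_eq_iff
      by (simp add: s(2))
    then show ?thesis
      by (simp add: self_dual_forms_def two_form_def h \<omega> congruence_alternating)
  qed
  have sub: "subspace (self_dual_forms \<sigma> g)"
  proof (rule subspaceI)
    have h_add: "hodge \<sigma> g (x + y) = hodge \<sigma> g x + hodge \<sigma> g y"
      and h_scale: "hodge \<sigma> g (c *\<^sub>R x) = c *\<^sub>R hodge \<sigma> g x" for x y c
      unfolding hodge_def raise_indices_def matrix_mult_simps
      by (simp_all add: vec_eq_iff sum.distrib sum_distrib_left distrib_left mult.left_commute)
    have t: "transpose (x + y) = transpose x + transpose y" "transpose (c *\<^sub>R x) = c *\<^sub>R transpose x"
      for x y :: "real^4^4" and c
      by (simp_all add: vec_eq_iff transpose_def)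
    show "0 \<in> self_dual_forms \<sigma> g"
      using h_scale [of 0 0] t(2) [of 0 0] by (simp add: self_dual_forms_def two_form_def)
    show "x + y \<in> self_dual_forms \<sigma> g" if "x \<in> self_dual_forms \<sigma> g" "y \<in> self_dual_forms \<sigma> g" for x y
      using that by (simp add: self_dual_forms_def two_form_def h_add t)
    show "c *\<^sub>R x \<in> self_dual_forms \<sigma> g" if "x \<in> self_dual_forms \<sigma> g" for c x
      using that by (simp add: self_dual_forms_def two_form_def h_scale t)
  qed
  have "\<eta> \<in> span (range \<omega>)" if \<eta>: "\<eta> \<in> self_dual_forms \<sigma> g" for \<eta>
  proof -
    define F where "F = transpose E ** \<eta> ** E"
    have \<eta>F: "\<eta> = transpose \<Theta> ** F ** \<Theta>"
      unfolding F_def by (rule congruence_cancel(2) [OF inv, symmetric])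
    have "transpose F = - F"
      using \<eta> by (simp add: F_def self_dual_forms_def two_form_def congruence_alternating)
    then obtain x12 x13 x14 x23 x24 x34 where F: "F = alternating x12 x13 x14 x23 x24 x34"
      using alternating_unique by blast
    have "hodge s signature_matrix F = F"
      using \<eta> by (simp add: self_dual_forms_def \<eta>F h congruence_cancel(3) [OF inv])
    then have "x34 = s * x12" "x24 = s * x13" "x23 = - s * x14"
      unfolding F hodge_alternating alternating_eq_iff by auto
    then have "\<eta> = (\<Sum>i\<in>UNIV. (vector [x12, x13, x14] :: real^3) $ i *\<^sub>R \<omega> i)"
      unfolding sum\<omega> \<eta>F F by simp
    then show ?thesis
      by (auto intro!: span_sum span_scale intro: span_base)
  qed
  moreover have "span (range \<omega>) \<subseteq> self_dual_forms \<sigma> g"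
    using sd by (intro span_minimal [OF _ sub]) blast
  ultimately show "span (range \<omega>) = self_dual_forms \<sigma> g"
    by blast
qed

context heis_frame
begin

lemma heis_eigenforms:
  fixes \<omega> :: "3 \<Rightarrow> real^4^4" and row_of :: "3 \<Rightarrow> real^4"
  assumes g: "\<And>q. q \<in> U \<Longrightarrow> g q = transpose (Theta q) ** signature_matrix ** Theta q" and p: "p \<in> U"
    and ein: "ricci g p = \<Lambda> *\<^sub>R g p" and sd: "weyl_self_dual U g \<sigma>" and \<sigma>: "\<sigma> \<in> {1, - 1}"
    and \<Lambda>: "\<Lambda> / 3 * (3 * ka (p $ 1) + be (p $ 1)) = (ka (p $ 1) + be (p $ 1))^3" "3 * ka (p $ 1) + be (p $ 1) \<noteq> 0"
    and \<nu>: "\<nu> = - 16 * (ka (p $ 1))^3 / (3 * ka (p $ 1) + be (p $ 1))"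
    and \<omega>: "\<And>i. \<omega> i = wedge (Theta p $ 1) (row_of i) + hodge \<sigma> (g p) (wedge (Theta p $ 1) (row_of i))"
    and row_of: "row_of 1 = Theta p $ 2" "row_of 2 = Theta p $ 3" "row_of 3 = Theta p $ 4"
  shows "inj \<omega>" "independent (range \<omega>)" "span (range \<omega>) = self_dual_forms \<sigma> (g p)"
    "weyl_op g p (\<omega> 1) = \<nu> *\<^sub>R \<omega> 1" "weyl_op g p (\<omega> 2) = \<nu> *\<^sub>R \<omega> 2" "weyl_op g p (\<omega> 3) = (- 2 * \<nu>) *\<^sub>R \<omega> 3"
proof -
  define s where "s = \<sigma> * sgn (det (Theta p))"
  define \<Omega> where "\<Omega> = heis_curvature (al (p $ 1)) (be (p $ 1)) (ka (p $ 1)) (deriv al (p $ 1)) (deriv be (p $ 1))"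
  note inv = Frame_Theta [OF p]
  have "det (Frame p) * det (Theta p) = 1"
    unfolding det_mul [symmetric] inv by simp
  then have "det (Theta p) \<noteq> 0"
    by auto
  then have ss: "s * s = 1"
    using \<sigma> by (auto simp: s_def sgn_if)
  have h: "hodge \<sigma> (g p) (transpose (Theta p) ** F ** Theta p) = transpose (Theta p) ** hodge s signature_matrix F ** Theta p" for F
    unfolding s_def by (rule hodge_frame [OF inv g [OF p] transpose_signature_matrix signature_matrix_square])
  have "\<forall>i. \<omega> i = transpose (Theta p) ** self_dual_basis s i ** Theta p"
    unfolding forall_3 \<omega> row_of wedge_rows h self_dual_basis_nth wedge_axis hodge_alternating
    by (simp add: bounded_bilinear.add_left [OF bounded_bilinear_matrix_mult, symmetric]
        bounded_bilinear.add_right [OF bounded_bilinear_matrix_mult, symmetric] alternating_add)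
  then have \<omega>': "\<omega> i = transpose (Theta p) ** self_dual_basis s i ** Theta p" for i
    by blast
  show "inj \<omega>" "independent (range \<omega>)" "span (range \<omega>) = self_dual_forms \<sigma> (g p)"
    by (rule self_dual_forms_frame [OF inv g [OF p] s_def ss \<omega>'])+
  have W: "weyl_op g p (transpose (Theta p) ** F ** Theta p) = transpose (Theta p) ** frame_weyl \<Omega> \<Lambda> F ** Theta p"
    if "transpose F = - F" for F
    unfolding frame_weyl_def \<Omega>_def
    by (rule weyl_op_einstein_frame [OF riemann_up_heis [OF g p] inv g [OF p] transpose_signature_matrix
          signature_matrix_square ein that])
  have sdF: "hodge s signature_matrix (frame_weyl \<Omega> \<Lambda> F) = frame_weyl \<Omega> \<Lambda> F" if F: "transpose F = - F" for F
  proof -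
    have "two_form (transpose (Theta p) ** F ** Theta p)"
      by (simp add: two_form_def congruence_alternating F)
    then have "hodge \<sigma> (g p) (weyl_op g p (transpose (Theta p) ** F ** Theta p)) = weyl_op g p (transpose (Theta p) ** F ** Theta p)"
      using sd p by (simp add: weyl_self_dual_def)
    then show ?thesis
      by (simp add: W [OF F] h congruence_cancel(3) [OF inv])
  qed
  note ev = heis_weyl_eigenvalues [OF sdF [unfolded \<Omega>_def] ss \<Lambda> \<nu>]
  have skew: "transpose (self_dual_basis s i) = - self_dual_basis s i" for i
  proof -
    have "\<forall>i. transpose (self_dual_basis s i) = - self_dual_basis s i"
      unfolding forall_3 self_dual_basis_nth transpose_alternating by simp
    then show ?thesis ..
  qed
  have W': "weyl_op g p (\<omega> i) = c *\<^sub>R \<omega> i" if "frame_weyl \<Omega> \<Lambda> (self_dual_basis s i) = c *\<^sub>R self_dual_basis s i" for i c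
    unfolding \<omega>' W [OF skew] that by (simp only: matrix_mult_simps)
  show "weyl_op g p (\<omega> 1) = \<nu> *\<^sub>R \<omega> 1"
    by (rule W', unfold self_dual_basis_nth \<Omega>_def, rule ev)
  show "weyl_op g p (\<omega> 2) = \<nu> *\<^sub>R \<omega> 2"
    by (rule W', unfold self_dual_basis_nth \<Omega>_def, rule ev)
  show "weyl_op g p (\<omega> 3) = (- 2 * \<nu>) *\<^sub>R \<omega> 3"
    by (rule W', unfold self_dual_basis_nth \<Omega>_def, rule ev)
qed

end

section \<open>Two conformally paraKaehler structures\<close>

lemma has_derivative_vec:
  fixes f :: "real^'n \<Rightarrow> real^'m"
  assumes "\<And>r. ((\<lambda>x. f x $ r) has_derivative (\<lambda>v. f' v $ r)) (at p)"
  shows "(f has_derivative f') (at p)"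
proof (rule has_derivative_componentwise_within [THEN iffD2], rule ballI)
  fix i :: "real^'m" assume "i \<in> Basis"
  then obtain r where i: "i = axis r 1"
    by (auto simp: Basis_vec_def)
  show "((\<lambda>x. f x \<bullet> i) has_derivative (\<lambda>x. f' x \<bullet> i)) (at p)"
    using assms by (simp add: i inner_axis)
qed

text \<open>Cartan's formula for the differential of a one-form on two fields in its kernel,
  obtained by differentiating \<phi>(X) = 0 along Y and \<phi>(Y) = 0 along X.\<close>

lemma lie_bracket_kernel:
  fixes \<phi> X Y :: "real^'n \<Rightarrow> real^'n"
  assumes U: "open U" "p \<in> U" and \<phi>: "(\<phi> has_derivative \<phi>') (at p)"
    and X: "X differentiable (at p)" "\<And>q. q \<in> U \<Longrightarrow> \<phi> q \<bullet> X q = 0"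
    and Y: "Y differentiable (at p)" "\<And>q. q \<in> U \<Longrightarrow> \<phi> q \<bullet> Y q = 0"
  shows "\<phi> p \<bullet> lie_bracket X Y p = \<phi>' (Y p) \<bullet> X p - \<phi>' (X p) \<bullet> Y p"
proof -
  have "\<phi> p \<bullet> frechet_derivative Z (at p) v + \<phi>' v \<bullet> Z p = 0"
    if Z: "Z differentiable (at p)" "\<And>q. q \<in> U \<Longrightarrow> \<phi> q \<bullet> Z q = 0" for Z v
  proof -
    have "((\<lambda>q. \<phi> q \<bullet> Z q) has_derivative (\<lambda>v. \<phi> p \<bullet> frechet_derivative Z (at p) v + \<phi>' v \<bullet> Z p)) (at p)"
      by (intro has_derivative_inner \<phi> differentiable_has_derivative Z)
    moreover have "((\<lambda>q. \<phi> q \<bullet> Z q) has_derivative (\<lambda>v. 0)) (at p)"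
      by (rule has_derivative_transform_within_open [OF has_derivative_const U]) (simp add: Z)
    ultimately have "(\<lambda>v. \<phi> p \<bullet> frechet_derivative Z (at p) v + \<phi>' v \<bullet> Z p) = (\<lambda>v. 0)"
      by (rule has_derivative_unique)
    then show ?thesis
      by meson
  qed
  from this [OF X, of "Y p"] this [OF Y, of "X p"] show ?thesis
    by (simp add: lie_bracket_def inner_diff_right)
qed

lemma smooth_vec_differentiable:
  fixes X :: "real^'n \<Rightarrow> real^'m"
  shows "smooth_vec U X \<Longrightarrow> p \<in> U \<Longrightarrow> X differentiable (at p)"
  by (intro differentiable_vec smooth_fun_differentiable) (auto simp: smooth_vec_def)

lemma has_index_scaleR:
  fixes B :: "real^'n^'n"
  assumes "has_index m B" "c > 0"
  shows "has_index m (c *\<^sub>R B)"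
proof -
  obtain P :: "real^'n^'n" and N :: "'n set" where P: "invertible P" "card N = m"
    "transpose P ** B ** P = (\<chi> i j. if i = j then (if i \<in> N then - 1 else 1) else 0)"
    using assms(1) unfolding has_index_def by (elim conjE exE)
  have B: "transpose B = B"
    using assms(1) unfolding has_index_def by (elim conjE)
  have t: "transpose (r *\<^sub>R A) = r *\<^sub>R transpose A" for r and A :: "real^'n^'n"
    by (simp add: vec_eq_iff transpose_def)
  let ?P = "(1 / sqrt c) *\<^sub>R P"
  obtain P' where "P ** P' = mat 1" "P' ** P = mat 1"
    using P(1) unfolding invertible_def by blast
  then have "invertible ?P"
    unfolding invertible_def using assms(2)
    by (intro exI [of _ "sqrt c *\<^sub>R P'"]) (simp add: matrix_mult_simps)
  moreover have "transpose ?P ** (c *\<^sub>R B) ** ?P = transpose P ** B ** P"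
    using assms(2) by (simp add: t matrix_mult_simps)
  ultimately show ?thesis
    unfolding has_index_def P(3) [symmetric] using P(2) B by (intro conjI exI [of _ ?P] exI [of _ N]) (simp_all add: t P(3))
qed

text \<open>The interval may be unbounded, so it is described by its extended real infimum and
  supremum: openness keeps both outside \<open>I\<close>, and convexity puts everything strictly
  between them into \<open>I\<close>.\<close>

lemma interval_antiderivative:
  fixes f :: "real \<Rightarrow> real"
  assumes "open I" "is_interval I" "I \<noteq> {}" and f: "\<And>t. t \<in> I \<Longrightarrow> isCont f t"
  obtains F where "\<And>t. t \<in> I \<Longrightarrow> (F has_real_derivative f t) (at t)"
proof -
  define l r where "l = Inf (ereal ` I)" and "r = Sup (ereal ` I)"
  have lr: "l < ereal t" "ereal t < r" if t: "t \<in> I" for t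
  proof -
    obtain e where e: "e > 0" "ball t e \<subseteq> I"
      by (rule openE [OF \<open>open I\<close> t])
    have "t - e / 2 \<in> ball t e" "t + e / 2 \<in> ball t e"
      using e(1) by (simp_all add: dist_real_def)
    then have "t - e / 2 \<in> I" "t + e / 2 \<in> I"
      using e(2) by blast+
    then have le: "l \<le> ereal (t - e / 2)" "ereal (t + e / 2) \<le> r"
      unfolding l_def r_def by (simp_all add: Inf_lower Sup_upper)
    show "l < ereal t"
      using le(1) by (rule le_less_trans) (simp add: e(1))
    show "ereal t < r"
      by (rule less_le_trans [OF _ le(2)]) (simp add: e(1))
  qed
  have mem: "t \<in> I" if "l < ereal t" "ereal t < r" for t
  proof -
    have "\<exists>y\<in>I. y < t" "\<exists>z\<in>I. t < z"
      using that by (simp_all add: l_def r_def Inf_less_iff less_Sup_iff)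
    then obtain y z where yz: "y \<in> I" "z \<in> I" "y < t" "t < z"
      by blast
    show ?thesis
      by (rule mem_is_interval_1_I [OF \<open>is_interval I\<close> yz(1,2)]) (simp_all add: yz(3,4) less_imp_le)
  qed
  obtain t where t: "t \<in> I"
    using \<open>I \<noteq> {}\<close> by auto
  have "l < r"
    by (rule less_trans [OF lr [OF t]])
  then have "\<exists>F. \<forall>t. l < ereal t \<longrightarrow> ereal t < r \<longrightarrow> (F has_vector_derivative f t) (at t)"
    by (rule einterval_antiderivative) (intro f mem)
  then obtain F where "\<And>t. l < ereal t \<Longrightarrow> ereal t < r \<Longrightarrow> (F has_vector_derivative f t) (at t)"
    by auto
  then have "(F has_real_derivative f t) (at t)" if t: "t \<in> I" for t
    unfolding has_real_derivative_iff_has_vector_derivative using lr [OF t] .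
  then show ?thesis
    by (rule that)
qed

text \<open>The sum is eight times the Pfaffian.\<close>

lemma levi_civita_alternating:
  "(\<Sum>i\<in>UNIV. \<Sum>j\<in>UNIV. \<Sum>k\<in>UNIV. \<Sum>l\<in>UNIV. levi_civita i j k l
      * alternating x12 x13 x14 x23 x24 x34 $ i $ j * alternating x12 x13 x14 x23 x24 x34 $ k $ l)
    = 8 * (x12 * x34 - x13 * x24 + x14 * x23)" (is "?L = _")
proof -
  let ?F = "alternating x12 x13 x14 x23 x24 x34"
  \<comment> \<open>The argument is chosen so that the star's raising of indices restores
    \<open>?F\<close>; the inner double sum is then a known star, and the fourfold sum never has to
    be expanded.\<close>
  have "hodge 1 signature_matrix (alternating x12 (- x13) (- x14) (- x23) (- x24) x34) $ k $ l
      = 1 / 2 * (\<Sum>i\<in>UNIV. \<Sum>j\<in>UNIV. levi_civita i j k l * ?F $ i $ j)" for k l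
    by (simp add: hodge_def raise_indices_signature det_signature_matrix)
  then have "alternating x34 (- x24) x23 x14 (- x13) x12 $ k $ l
      = 1 / 2 * (\<Sum>i\<in>UNIV. \<Sum>j\<in>UNIV. levi_civita i j k l * ?F $ i $ j)" for k l
    by (simp add: hodge_alternating)
  from this [of k l for k l] have H: "(\<Sum>i\<in>UNIV. \<Sum>j\<in>UNIV. levi_civita i j k l * ?F $ i $ j)
      = 2 * alternating x34 (- x24) x23 x14 (- x13) x12 $ k $ l" for k l
    by (simp only:)
  have "?L = (\<Sum>k\<in>UNIV. \<Sum>l\<in>UNIV. (\<Sum>i\<in>UNIV. \<Sum>j\<in>UNIV. levi_civita i j k l * ?F $ i $ j) * ?F $ k $ l)"
    unfolding sum_distrib_right by (rule sum_swap_pairs)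
  also have "\<dots> = 8 * (x12 * x34 - x13 * x24 + x14 * x23)"
    unfolding H unfolding sum_4 by (simp add: alternating_nth algebra_simps)
  finally show ?thesis .
qed

text \<open>In the frame it exchanges the directions of dt and e^3, and those of e^1 and e^2 up to
  \<tau>. Lowering an index gives minus the form dt wedge e^3 + \<tau> e^1 wedge e^2.\<close>

definition paracomplex_matrix :: "real \<Rightarrow> real^4^4" where
  "paracomplex_matrix \<tau> = vector [vector [0, 0, 0, 1], vector [0, 0, \<tau>, 0], vector [0, \<tau>, 0, 0], vector [1, 0, 0, 0]]"

lemma paracomplex_matrix:
  "\<tau> * \<tau> = 1 \<Longrightarrow> paracomplex_matrix \<tau> ** paracomplex_matrix \<tau> = mat 1"
  "signature_matrix ** paracomplex_matrix \<tau> = alternating 0 0 (- 1) (- \<tau>) 0 0"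
  "paracomplex_matrix \<tau> ** signature_matrix = - (signature_matrix ** paracomplex_matrix \<tau>)"
  unfolding vec_eq_iff forall_4 vector_uminus_component signature_matrix_mult
  by (simp_all add: paracomplex_matrix_def alternating_nth matrix_matrix_mult_def sum_4 mat_def)

lemma pd_affine_mult_coord:
  fixes F :: "real \<Rightarrow> real"
  assumes "(F has_real_derivative F') (at (q $ m))"
  shows "pd i (\<lambda>q. (c + d * q $ j) * F (q $ m)) q
    = (if i = j then d else 0) * F (q $ m) + (if i = m then (c + d * q $ j) * F' else 0)"
proof -
  have "F differentiable (at (q $ m))" "deriv F (q $ m) = F'"
    using assms by (auto simp: real_differentiable_def intro: DERIV_imp_deriv)
  then have "((\<lambda>q. (c + d * q $ j) * F (q $ m)) has_derivative
      (\<lambda>v. d * v $ j * F (q $ m) + (c + d * q $ j) * (v $ m * F'))) (at q)"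
    using has_derivative_coord_compose [of F q m]
    by (auto intro!: derivative_eq_intros has_derivative_coord)
  then show ?thesis
    by (simp add: pd_eqI axis_nth)
qed

context heis_frame
begin

definition J :: "real \<Rightarrow> real^4 \<Rightarrow> real^4^4" where
  "J \<tau> p = Frame p ** paracomplex_matrix \<tau> ** Theta p"

lemma smooth_J: "smooth_mat U (J \<tau>)"
  unfolding J_def by (intro smooth_mat_mult open_U smooth_Frame smooth_Theta smooth_mat_const)

lemma Theta_Frame: "q \<in> U \<Longrightarrow> Theta q ** Frame q = mat 1"
  by (rule matrix_left_right_inverse [THEN iffD1, OF Frame_Theta])

lemma J_square:
  assumes "q \<in> U" "\<tau> * \<tau> = 1"
  shows "J \<tau> q ** J \<tau> q = mat 1"
proof -
  have "J \<tau> q ** J \<tau> q = Frame q ** paracomplex_matrix \<tau> ** (Theta q ** Frame q) ** paracomplex_matrix \<tau> ** Theta q"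
    by (simp only: J_def matrix_mul_assoc)
  also have "\<dots> = Frame q ** (paracomplex_matrix \<tau> ** paracomplex_matrix \<tau>) ** Theta q"
    by (simp add: Theta_Frame assms(1) matrix_mul_assoc)
  finally show ?thesis
    by (simp add: paracomplex_matrix assms Frame_Theta)
qed

lemma metric_J:
  assumes q: "q \<in> U"
  shows "transpose (Theta q) ** signature_matrix ** Theta q ** J \<tau> q
    = alternating (- ((Q1 + w / 2 * q $ 3) / a (q $ 1))) (- ((Q2 + (- w / 2) * q $ 2) / a (q $ 1))) (- (w / a (q $ 1)))
        (- \<tau> * (P11 * P22 - P12 * P21) / (b (q $ 1))^2) 0 0"
proof -
  have "transpose (Theta q) ** signature_matrix ** Theta q ** J \<tau> q
      = transpose (Theta q) ** signature_matrix ** (Theta q ** Frame q) ** paracomplex_matrix \<tau> ** Theta q"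
    by (simp only: J_def matrix_mul_assoc)
  also have "\<dots> = transpose (Theta q) ** (signature_matrix ** paracomplex_matrix \<tau>) ** Theta q"
    by (simp add: Theta_Frame q matrix_mul_assoc)
  also have "\<dots> = alternating (- ((Q1 + w / 2 * q $ 3) / a (q $ 1))) (- ((Q2 + (- w / 2) * q $ 2) / a (q $ 1))) (- (w / a (q $ 1)))
        (- \<tau> * (P11 * P22 - P12 * P21) / (b (q $ 1))^2) 0 0"
    unfolding paracomplex_matrix vec_eq_iff forall_4 matrix_congruence_nth(2) sum_4
    using a_nz [of "q $ 1"] b_nz [of "q $ 1"] q
    by (simp add: alternating_nth Theta_def heis_manifold_def) (simp add: field_simps power2_eq_square)
  finally show ?thesis .
qed

text \<open>In the frame the eigenvalue equation says that \<open>v\<close> is annihilated by e^3 -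
  \<epsilon> dt and \<tau> e^2 - \<epsilon> e^1. The covectors here are these two multiplied by
  \<open>a\<close> and \<open>b\<close>: the second is then constant, and the first depends on t
  only in its dt-component.\<close>

lemma J_eigenvector:
  assumes q: "q \<in> U" and \<tau>: "\<tau> * \<tau> = 1" and \<epsilon>: "\<epsilon> * \<epsilon> = 1"
  shows "J \<tau> q *v v = \<epsilon> *\<^sub>R v \<longleftrightarrow>
    vector [- \<epsilon> * a (q $ 1), Q1 + w / 2 * q $ 3, Q2 + (- w / 2) * q $ 2, w] \<bullet> v = 0 \<and>
    vector [0, \<tau> * P21 - \<epsilon> * P11, \<tau> * P22 - \<epsilon> * P12, 0] \<bullet> v = 0"
proof -
  have inj: "Frame q *v x = Frame q *v y \<longleftrightarrow> x = y" for x y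
  proof
    assume "Frame q *v x = Frame q *v y"
    then have "Theta q *v (Frame q *v x) = Theta q *v (Frame q *v y)"
      by simp
    then show "x = y"
      by (simp add: matrix_vector_mul_assoc Theta_Frame q)
  qed simp
  have "J \<tau> q *v v = Frame q *v (paracomplex_matrix \<tau> *v (Theta q *v v))"
    by (simp add: J_def matrix_vector_mul_assoc matrix_mul_assoc)
  moreover have "\<epsilon> *\<^sub>R v = Frame q *v (\<epsilon> *\<^sub>R (Theta q *v v))"
    by (simp add: matrix_vector_mult_scaleR matrix_vector_mul_assoc Frame_Theta q)
  ultimately have "J \<tau> q *v v = \<epsilon> *\<^sub>R v \<longleftrightarrow> paracomplex_matrix \<tau> *v (Theta q *v v) = \<epsilon> *\<^sub>R (Theta q *v v)"
    by (simp only: inj)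
  also have "\<dots> \<longleftrightarrow> (Theta q *v v) $ 4 = \<epsilon> * (Theta q *v v) $ 1 \<and> \<tau> * (Theta q *v v) $ 3 = \<epsilon> * (Theta q *v v) $ 2"
  proof -
    \<comment> \<open>Since \<tau> and \<epsilon> square to 1, the four component equations coincide
      in pairs.\<close>
    have "\<tau> * y = \<epsilon> * x \<longleftrightarrow> \<tau> * x = \<epsilon> * y" for x y
    proof -
      have "\<tau> * x = \<epsilon> * y" if "\<tau> * y = \<epsilon> * x" for x y
        using that \<tau> \<epsilon> by algebra
      then show ?thesis
        by blast
    qed
    moreover have "x = \<epsilon> * y \<longleftrightarrow> y = \<epsilon> * x" for x y
      using \<epsilon> by algebra
    ultimately show ?thesis
      unfolding vec_eq_iff forall_4
      by (simp add: paracomplex_matrix_def matrix_vector_mult_def [of "paracomplex_matrix \<tau>", unfolded paracomplex_matrix_def] sum_4) blast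
  qed
  also have "\<dots> \<longleftrightarrow> vector [- \<epsilon> * a (q $ 1), Q1 + w / 2 * q $ 3, Q2 + (- w / 2) * q $ 2, w] \<bullet> v = 0 \<and>
    vector [0, \<tau> * P21 - \<epsilon> * P11, \<tau> * P22 - \<epsilon> * P12, 0] \<bullet> v = 0"
  proof -
    have nz: "a (q $ 1) \<noteq> 0" "b (q $ 1) \<noteq> 0"
      using a_nz b_nz q by (auto simp: heis_manifold_def)
    have T: "(Theta q *v v) $ 1 = v $ 1"
      "(Theta q *v v) $ 2 = (P11 * v $ 2 + P12 * v $ 3) / b (q $ 1)"
      "(Theta q *v v) $ 3 = (P21 * v $ 2 + P22 * v $ 3) / b (q $ 1)"
      "(Theta q *v v) $ 4 = ((Q1 + w / 2 * q $ 3) * v $ 2 + (Q2 + (- w / 2) * q $ 2) * v $ 3 + w * v $ 4) / a (q $ 1)"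
      using nz by (simp_all add: Theta_def matrix_vector_mult_def sum_4 field_simps)
    have eq: "x / a (q $ 1) = \<epsilon> * y \<longleftrightarrow> - \<epsilon> * a (q $ 1) * y + x = 0"
      "\<tau> * (x / b (q $ 1)) = \<epsilon> * (y / b (q $ 1)) \<longleftrightarrow> \<tau> * x - \<epsilon> * y = 0" for x y
      using nz by (auto simp: field_simps)
    show ?thesis
      unfolding T eq by (simp add: inner_vec_def sum_4 algebra_simps)
  qed
  finally show ?thesis .
qed

text \<open>Frobenius for the two annihilating covectors. The second is constant. The differential
  of the first is a multiple of dx wedge dy, because its dt-component depends on t alone, and dx
  wedge dy vanishes on any two vectors annihilated by the second.\<close>

lemma J_involutive:
  assumes \<tau>: "\<tau> * \<tau> = 1" and \<epsilon>: "\<epsilon> * \<epsilon> = 1"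
  shows "involutive U (\<lambda>p. {v. J \<tau> p *v v = \<epsilon> *\<^sub>R v})"
  unfolding involutive_def
proof (intro allI impI ballI, elim conjE)
  fix X Y :: "real^4 \<Rightarrow> real^4" and p
  assume sm: "smooth_vec U X" "smooth_vec U Y" and p: "p \<in> U"
    and XY: "\<forall>p\<in>U. X p \<in> {v. J \<tau> p *v v = \<epsilon> *\<^sub>R v} \<and> Y p \<in> {v. J \<tau> p *v v = \<epsilon> *\<^sub>R v}"
  define \<phi> :: "real^4 \<Rightarrow> real^4" where "\<phi> q = vector [- \<epsilon> * a (q $ 1), Q1 + w / 2 * q $ 3, Q2 + (- w / 2) * q $ 2, w]" for q
  define m1 m2 where "m1 = \<tau> * P21 - \<epsilon> * P11" and "m2 = \<tau> * P22 - \<epsilon> * P12"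
  define \<psi> :: "real^4" where "\<psi> = vector [0, m1, m2, 0]"
  have ker: "\<phi> q \<bullet> X q = 0" "\<psi> \<bullet> X q = 0" "\<phi> q \<bullet> Y q = 0" "\<psi> \<bullet> Y q = 0" if "q \<in> U" for q
  proof -
    have "J \<tau> q *v X q = \<epsilon> *\<^sub>R X q" "J \<tau> q *v Y q = \<epsilon> *\<^sub>R Y q"
      using XY that by auto
    then show "\<phi> q \<bullet> X q = 0" "\<psi> \<bullet> X q = 0" "\<phi> q \<bullet> Y q = 0" "\<psi> \<bullet> Y q = 0"
      unfolding \<phi>_def \<psi>_def m1_def m2_def J_eigenvector [OF that \<tau> \<epsilon>] by blast+
  qed
  have ad: "a differentiable (at (p $ 1))"
    using smooth_on_interval_differentiable(1) [OF smooth_a] p by (simp add: heis_manifold_def)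
  define \<phi>' :: "real^4 \<Rightarrow> real^4" where "\<phi>' v = vector [- \<epsilon> * (v $ 1 * deriv a (p $ 1)), w / 2 * v $ 3, - w / 2 * v $ 2, 0]" for v
  have d\<phi>: "(\<phi> has_derivative \<phi>') (at p)"
  proof -
    have "\<forall>r. ((\<lambda>q. \<phi> q $ r) has_derivative (\<lambda>v. \<phi>' v $ r)) (at p)"
      unfolding forall_4 \<phi>_def \<phi>'_def vector_4
      by (auto intro!: derivative_eq_intros has_derivative_coord has_derivative_coord_compose [OF ad])
    then show ?thesis
      by (intro has_derivative_vec) blast
  qed
  note dX = smooth_vec_differentiable [OF sm(1) p] and dY = smooth_vec_differentiable [OF sm(2) p]
  have "\<psi> \<bullet> lie_bracket X Y p = 0"
    using lie_bracket_kernel [OF open_U p has_derivative_const dX _ dY, of \<psi>] ker by simp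
  moreover have "\<phi> p \<bullet> lie_bracket X Y p = 0"
  proof -
    have "m1 * X p $ 2 + m2 * X p $ 3 = 0" "m1 * Y p $ 2 + m2 * Y p $ 3 = 0"
      using ker [OF p] by (simp_all add: \<psi>_def inner_vec_def sum_4)
    \<comment> \<open>Two plane vectors annihilated by the same nonzero covector are parallel, so
      their determinant vanishes.\<close>
    then have "m1 * (X p $ 2 * Y p $ 3 - X p $ 3 * Y p $ 2) = 0" "m2 * (X p $ 2 * Y p $ 3 - X p $ 3 * Y p $ 2) = 0"
      by algebra+
    moreover have "m1 \<noteq> 0 \<or> m2 \<noteq> 0"
    proof (rule ccontr)
      assume "\<not> (m1 \<noteq> 0 \<or> m2 \<noteq> 0)"
      then have "\<epsilon> * P11 = \<tau> * P21" "\<epsilon> * P12 = \<tau> * P22"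
        by (auto simp: m1_def m2_def)
      then have "\<epsilon> * (P11 * P22 - P12 * P21) = 0"
        by algebra
      then show False
        using \<epsilon> det_nz by auto
    qed
    ultimately have "X p $ 2 * Y p $ 3 - X p $ 3 * Y p $ 2 = 0"
      by auto
    moreover have "\<phi> p \<bullet> lie_bracket X Y p = \<phi>' (Y p) \<bullet> X p - \<phi>' (X p) \<bullet> Y p"
      using ker by (intro lie_bracket_kernel [OF open_U p d\<phi> dX _ dY])
    moreover have "\<dots> = w * (X p $ 2 * Y p $ 3 - X p $ 3 * Y p $ 2)"
      by (simp add: \<phi>'_def inner_vec_def sum_4 algebra_simps)
    ultimately show ?thesis
      by simp
  qed
  ultimately show "lie_bracket X Y p \<in> {v. J \<tau> p *v v = \<epsilon> *\<^sub>R v}"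
    unfolding \<phi>_def \<psi>_def m1_def m2_def mem_Collect_eq J_eigenvector [OF p \<tau> \<epsilon>] by blast
qed

text \<open>The reflection \<open>S\<close> in the negative frame directions anticommutes with
  \<open>J \<tau>\<close>, which pairs each negative direction with a positive one. An involution
  anticommuting with \<open>J \<tau>\<close> maps either eigenspace onto the other.\<close>

lemma J_dim:
  assumes q: "q \<in> U"
  shows "dim {v. J \<tau> q *v v = v} = dim {v. J \<tau> q *v v = - v}"
proof -
  define S where "S = Frame q ** signature_matrix ** Theta q"
  have "S ** S = Frame q ** signature_matrix ** (Theta q ** Frame q) ** signature_matrix ** Theta q"
    by (simp only: S_def matrix_mul_assoc)
  also have "\<dots> = Frame q ** (signature_matrix ** signature_matrix) ** Theta q"
    by (simp add: Theta_Frame q matrix_mul_assoc)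
  finally have SS: "S ** S = mat 1"
    by (simp add: signature_matrix_square Frame_Theta q)
  have "J \<tau> q ** S = Frame q ** paracomplex_matrix \<tau> ** (Theta q ** Frame q) ** signature_matrix ** Theta q"
    by (simp only: S_def J_def matrix_mul_assoc)
  also have "\<dots> = Frame q ** (paracomplex_matrix \<tau> ** signature_matrix) ** Theta q"
    by (simp add: Theta_Frame q matrix_mul_assoc)
  also have "\<dots> = - (Frame q ** signature_matrix ** (Theta q ** Frame q) ** paracomplex_matrix \<tau> ** Theta q)"
    by (simp add: Theta_Frame q matrix_mul_assoc paracomplex_matrix(3) matrix_mult_simps)
  finally have JS: "J \<tau> q ** S = - (S ** J \<tau> q)"
    by (simp only: S_def J_def matrix_mul_assoc)
  have SSv: "S *v (S *v v) = v" for v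
    by (simp add: matrix_vector_mul_assoc SS)
  have JSv: "J \<tau> q *v (S *v v) = - (S *v (J \<tau> q *v v))" for v
  proof -
    have "(- (S ** J \<tau> q)) *v v = - ((S ** J \<tau> q) *v v)"
      by (simp add: vec_eq_iff matrix_vector_mult_def sum_negf)
    then show ?thesis
      by (simp add: matrix_vector_mul_assoc JS)
  qed
  have neg: "S *v (- v) = - (S *v v)" for v
    by (simp add: vec_eq_iff matrix_vector_mult_def sum_negf)
  have "{v. J \<tau> q *v v = - v} = (*v) S ` {v. J \<tau> q *v v = v}"
  proof (intro equalityI subsetI)
    fix v assume "v \<in> {v. J \<tau> q *v v = - v}"
    then have "S *v v \<in> {v. J \<tau> q *v v = v}"
      by (simp add: JSv neg)
    then show "v \<in> (*v) S ` {v. J \<tau> q *v v = v}"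
      by (rule image_eqI [rotated]) (simp add: SSv)
  qed (auto simp: JSv)
  moreover have "inj ((*v) S)"
    by (rule inj_on_inverseI [of _ "(*v) S"]) (simp add: SSv)
  then have "dim ((*v) S ` V) = dim V" for V
    by (intro dim_image_eq matrix_vector_mul_linear) (rule inj_on_subset [OF _ subset_UNIV])
  ultimately show ?thesis
    by (simp only:)
qed

lemma J_paracomplex: "\<tau> * \<tau> = 1 \<Longrightarrow> paracomplex U (J \<tau>)"
  unfolding paracomplex_def
  using J_involutive [of \<tau> 1] J_involutive [of \<tau> "- 1"]
  by (simp add: smooth_J J_square J_dim)

end

section \<open>Closed two-forms and the conformal factor\<close>

lemma pd_minus: "f differentiable (at p) \<Longrightarrow> pd i (\<lambda>x. - f x) p = - pd i f p"
  using pd_diff [of "\<lambda>x. 0" p f i] by simp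

text \<open>A three-form in dimension four has four components; the remaining index triples repeat
  them up to sign or give zero.\<close>

lemma closed_form_alternating:
  fixes x12 x13 x14 x23 x24 x34 :: "real^4 \<Rightarrow> real"
  assumes "\<And>p. p \<in> U \<Longrightarrow> x12 differentiable (at p)" "\<And>p. p \<in> U \<Longrightarrow> x13 differentiable (at p)"
    "\<And>p. p \<in> U \<Longrightarrow> x14 differentiable (at p)" "\<And>p. p \<in> U \<Longrightarrow> x23 differentiable (at p)"
    "\<And>p. p \<in> U \<Longrightarrow> x24 differentiable (at p)" "\<And>p. p \<in> U \<Longrightarrow> x34 differentiable (at p)"
    and d: "\<And>p. p \<in> U \<Longrightarrow> pd 1 x23 p - pd 2 x13 p + pd 3 x12 p = 0"
    "\<And>p. p \<in> U \<Longrightarrow> pd 1 x24 p - pd 2 x14 p + pd 4 x12 p = 0"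
    "\<And>p. p \<in> U \<Longrightarrow> pd 1 x34 p - pd 3 x14 p + pd 4 x13 p = 0"
    "\<And>p. p \<in> U \<Longrightarrow> pd 2 x34 p - pd 3 x24 p + pd 4 x23 p = 0"
  shows "closed_form U (\<lambda>p. alternating (x12 p) (x13 p) (x14 p) (x23 p) (x24 p) (x34 p))"
  unfolding closed_form_def
proof (intro ballI)
  fix p assume p: "p \<in> U"
  have m: "pd i (\<lambda>q. - x12 q) p = - pd i x12 p" "pd i (\<lambda>q. - x13 q) p = - pd i x13 p"
    "pd i (\<lambda>q. - x14 q) p = - pd i x14 p" "pd i (\<lambda>q. - x23 q) p = - pd i x23 p"
    "pd i (\<lambda>q. - x24 q) p = - pd i x24 p" "pd i (\<lambda>q. - x34 q) p = - pd i x34 p" for i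
    using assms(1-6) p by (simp_all add: pd_minus)
  have "\<forall>j k. pd i (\<lambda>q. alternating (x12 q) (x13 q) (x14 q) (x23 q) (x24 q) (x34 q) $ j $ k) p
      = alternating (pd i x12 p) (pd i x13 p) (pd i x14 p) (pd i x23 p) (pd i x24 p) (pd i x34 p) $ j $ k" for i
    unfolding forall_4 alternating_nth vector_4 m pd_const by simp
  then have e: "partial i (\<lambda>q. alternating (x12 q) (x13 q) (x14 q) (x23 q) (x24 q) (x34 q) $ j $ k) p
      = alternating (pd i x12 p) (pd i x13 p) (pd i x14 p) (pd i x23 p) (pd i x24 p) (pd i x34 p) $ j $ k" for i j k
    by (simp add: partial_eq_pd)
  show "\<forall>i j k. partial i (\<lambda>q. alternating (x12 q) (x13 q) (x14 q) (x23 q) (x24 q) (x34 q) $ j $ k) p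
      + partial j (\<lambda>q. alternating (x12 q) (x13 q) (x14 q) (x23 q) (x24 q) (x34 q) $ k $ i) p
      + partial k (\<lambda>q. alternating (x12 q) (x13 q) (x14 q) (x23 q) (x24 q) (x34 q) $ i $ j) p = 0"
    unfolding e forall_4 alternating_nth vector_4 using d [OF p] by linarith
qed

lemma closed_form_cong:
  assumes "open U" "\<And>p. p \<in> U \<Longrightarrow> \<omega> p = \<omega>' p"
  shows "closed_form U \<omega> \<longleftrightarrow> closed_form U \<omega>'"
proof -
  have "partial i (\<lambda>q. \<omega> q $ j $ k) p = partial i (\<lambda>q. \<omega>' q $ j $ k) p" if "p \<in> U" for i j k p
    unfolding partial_eq_pd by (rule pd_cong_open [OF assms(1) that]) (simp add: assms(2))
  then show ?thesis
    by (simp add: closed_form_def)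
qed

context heis_frame
begin

text \<open>An antiderivative comes with its first derivative only; higher smoothness follows
  because that derivative is an explicit smooth expression in \<open>a\<close> and
  \<open>b\<close>.\<close>

lemma smooth_primitive:
  assumes "\<And>t. t \<in> I \<Longrightarrow> (K has_real_derivative ka t) (at t)"
  shows "smooth_fun U (\<lambda>p. K (p $ 1))"
proof (rule smooth_funI)
  have K: "K differentiable (at (p $ 1))" "deriv K (p $ 1) = ka (p $ 1)" if "p \<in> U" for p
    using assms [of "p $ 1"] that by (auto simp: heis_manifold_def real_differentiable_def intro: DERIV_imp_deriv)
  show "(\<lambda>p. K (p $ 1)) differentiable (at p)" if "p \<in> U" for p
    using has_derivative_coord_compose [OF K(1) [OF that]] by (rule differentiableI)
  have "smooth_fun U (\<lambda>p. ka (p $ 1))"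
    unfolding ka_def by (intro smooth_intros smooth_a_coord smooth_b_coord) (simp add: heis_manifold_def a_nz)
  then have ka: "smooth_fun U (\<lambda>p. if i = 1 then ka (p $ 1) else 0)" for i :: 4
    by (cases "i = 1") simp_all
  show "smooth_fun U (partial i (\<lambda>p. K (p $ 1)))" for i
    by (rule smooth_fun_cong [OF open_U ka [of i]]) (simp add: partial_eq_pd pd_coord_compose K)
qed

lemma conformally_parakaehler_J:
  assumes "is_interval I" "I \<noteq> {}" and \<tau>: "\<tau> * \<tau> = 1"
    and g: "\<And>q. q \<in> U \<Longrightarrow> g q = transpose (Theta q) ** signature_matrix ** Theta q" and m: "metric_on U 2 g"
  shows "conformally_parakaehler U g (J \<tau>)"
proof -
  define \<delta> where "\<delta> = P11 * P22 - P12 * P21"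
  have "isCont ka t" if "t \<in> I" for t
    using al_be_ka_derivative(3) [OF that] by (rule differentiable_imp_continuous_within)
  from interval_antiderivative [OF open_I assms(1,2) this]
  obtain K where K: "\<And>t. t \<in> I \<Longrightarrow> (K has_real_derivative ka t) (at t)"
    by blast
  \<comment> \<open>With conformal factor \<open>b\<^sup>2 * G\<close>, closedness of the form dt
    wedge e^3 + \<tau> e^1 wedge e^2 after scaling is the linear equation G' = 2 \<tau> \<kappa> G,
    solved by this exponential.\<close>
  define G where "G t = exp (2 * \<tau> * K t)" for t
  define \<psi> where "\<psi> t = - ((b t)^2 * G t / a t)" for t
  define f :: "real^4 \<Rightarrow> real" where "f p = (b (p $ 1))^2 * G (p $ 1)" for p
  have f: "smooth_fun U f"
    unfolding f_def G_def by (intro smooth_intros smooth_b_coord smooth_primitive K)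
  have fpos: "f p > 0" if "p \<in> U" for p
    using that b_nz [of "p $ 1"] by (simp add: f_def G_def heis_manifold_def)
  have G: "(G has_real_derivative 2 * \<tau> * ka t * G t) (at t)" if "t \<in> I" for t
    unfolding G_def by (auto intro!: derivative_eq_intros K that)
  \<comment> \<open>Existence of a derivative is all that is asked for: \<open>\<psi>\<close>
    multiplies forms containing dt, whose differentials do not see derivatives in t.\<close>
  have \<psi>: "(\<psi> has_real_derivative deriv \<psi> t) (at t)" if t: "t \<in> I" for t
  proof -
    have "\<psi> differentiable (at t)"
      unfolding \<psi>_def using G [OF t] a_nz [OF t]
        smooth_on_interval_differentiable(1) [OF smooth_a t] smooth_on_interval_differentiable(1) [OF smooth_b t]
      by (intro differentiable_minus differentiable_divide differentiable_mult differentiable_power)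
        (auto simp: real_differentiable_def)
    then show ?thesis
      by (simp add: DERIV_deriv_iff_real_differentiable)
  qed
  have gs: "transpose (g p) = g p" if "p \<in> U" for p
    using m that by (simp add: metric_on_def has_index_def)
  have gJ: "g q ** J \<tau> q = alternating (- ((Q1 + w / 2 * q $ 3) / a (q $ 1))) (- ((Q2 + (- w / 2) * q $ 2) / a (q $ 1)))
      (- (w / a (q $ 1))) (- \<tau> * \<delta> / (b (q $ 1))^2) 0 0" if "q \<in> U" for q
    using metric_J [OF that] by (simp only: g that \<delta>_def)
  have skew: "transpose (J \<tau> p) ** g p = - (g p ** J \<tau> p)" if p: "p \<in> U" for p
  proof -
    have "transpose (J \<tau> p) ** g p = transpose (g p ** J \<tau> p)"
      by (simp add: matrix_transpose_mul gs p)
    then show ?thesis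
      unfolding gJ [OF p] by (simp only: transpose_alternating)
  qed
  \<comment> \<open>The summands \<open>0 * q $ 1\<close> give all nonzero entries the shape of
    \<open>pd_affine_mult_coord\<close>.\<close>
  have closed0: "closed_form U (\<lambda>q. alternating ((Q1 + w / 2 * q $ 3) * \<psi> (q $ 1)) ((Q2 + (- w / 2) * q $ 2) * \<psi> (q $ 1))
      ((w + 0 * q $ 1) * \<psi> (q $ 1)) ((- \<tau> * \<delta> + 0 * q $ 1) * G (q $ 1)) 0 0)"
  proof (rule closed_form_alternating)
    fix p assume p: "p \<in> U"
    then have t: "p $ 1 \<in> I"
      by (simp add: heis_manifold_def)
    have d: "F differentiable (at (p $ 1)) \<Longrightarrow> (\<lambda>q. (c + d * q $ j) * F (q $ 1)) differentiable (at p)" for F :: "real \<Rightarrow> real" and c d j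
      by (intro differentiable_mult differentiable_add differentiable_const
          has_derivative_coord_compose [THEN differentiableI] has_derivative_coord [THEN differentiableI])
    have \<psi>G: "\<psi> differentiable (at (p $ 1))" "G differentiable (at (p $ 1))"
      using \<psi> [OF t] G [OF t] by (auto simp: real_differentiable_def)
    show "(\<lambda>q. (Q1 + w / 2 * q $ 3) * \<psi> (q $ 1)) differentiable (at p)"
      "(\<lambda>q. (Q2 + (- w / 2) * q $ 2) * \<psi> (q $ 1)) differentiable (at p)"
      "(\<lambda>q. (w + 0 * q $ 1) * \<psi> (q $ 1)) differentiable (at p)"
      "(\<lambda>q. (- \<tau> * \<delta> + 0 * q $ 1) * G (q $ 1)) differentiable (at p)"
      by (rule d, rule \<psi>G)+
    \<comment> \<open>The only nontrivial component of closedness. Each of the two y- and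
      x-derivatives contributes half of the left side; the right side is the t-derivative of the
      \<open>e\<^sup>1 \<and> e\<^sup>2\<close> part.\<close>
    have "w * \<psi> (p $ 1) = \<tau> * \<delta> * (2 * \<tau> * ka (p $ 1) * G (p $ 1))"
    proof -
      have "\<tau> * \<delta> * (2 * \<tau> * ka (p $ 1) * G (p $ 1)) = (\<tau> * \<tau>) * (2 * \<delta> * ka (p $ 1) * G (p $ 1))"
        by (simp add: ac_simps)
      also have "\<dots> = w * \<psi> (p $ 1)"
        unfolding \<tau> by (simp add: w \<delta>_def [symmetric] \<psi>_def ka_def)
      finally show ?thesis
        by (rule sym)
    qed
    then show "pd 1 (\<lambda>q. (- \<tau> * \<delta> + 0 * q $ 1) * G (q $ 1)) p - pd 2 (\<lambda>q. (Q2 + (- w / 2) * q $ 2) * \<psi> (q $ 1)) p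
        + pd 3 (\<lambda>q. (Q1 + w / 2 * q $ 3) * \<psi> (q $ 1)) p = 0"
      unfolding pd_affine_mult_coord [of \<psi>, OF \<psi> [OF t]] pd_affine_mult_coord [of G, OF G [OF t]] by simp
    show "pd 1 (\<lambda>q. 0) p - pd 2 (\<lambda>q. (w + 0 * q $ 1) * \<psi> (q $ 1)) p + pd 4 (\<lambda>q. (Q1 + w / 2 * q $ 3) * \<psi> (q $ 1)) p = 0"
      unfolding pd_affine_mult_coord [of \<psi>, OF \<psi> [OF t]] pd_const by simp
    show "pd 1 (\<lambda>q. 0) p - pd 3 (\<lambda>q. (w + 0 * q $ 1) * \<psi> (q $ 1)) p + pd 4 (\<lambda>q. (Q2 + (- w / 2) * q $ 2) * \<psi> (q $ 1)) p = 0"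
      unfolding pd_affine_mult_coord [of \<psi>, OF \<psi> [OF t]] pd_const by simp
    show "pd 2 (\<lambda>q. 0) p - pd 3 (\<lambda>q. 0) p + pd 4 (\<lambda>q. (- \<tau> * \<delta> + 0 * q $ 1) * G (q $ 1)) p = 0"
      unfolding pd_affine_mult_coord [of G, OF G [OF t]] pd_const by simp
  qed simp_all
  have fgJ: "(f q *\<^sub>R g q) ** J \<tau> q = alternating ((Q1 + w / 2 * q $ 3) * \<psi> (q $ 1)) ((Q2 + (- w / 2) * q $ 2) * \<psi> (q $ 1))
      ((w + 0 * q $ 1) * \<psi> (q $ 1)) ((- \<tau> * \<delta> + 0 * q $ 1) * G (q $ 1)) 0 0" if q: "q \<in> U" for q
  proof -
    have nz: "a (q $ 1) \<noteq> 0" "b (q $ 1) \<noteq> 0"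
      using q a_nz b_nz by (auto simp: heis_manifold_def)
    have "(f q *\<^sub>R g q) ** J \<tau> q = f q *\<^sub>R (g q ** J \<tau> q)"
      by (simp only: matrix_mult_simps)
    also have "\<dots> = alternating ((Q1 + w / 2 * q $ 3) * \<psi> (q $ 1)) ((Q2 + (- w / 2) * q $ 2) * \<psi> (q $ 1))
      ((w + 0 * q $ 1) * \<psi> (q $ 1)) ((- \<tau> * \<delta> + 0 * q $ 1) * G (q $ 1)) 0 0"
      unfolding gJ [OF q] alternating_scaleR alternating_eq_iff using nz by (simp add: f_def \<psi>_def)
    finally show ?thesis .
  qed
  have closed: "closed_form U (\<lambda>q. (f q *\<^sub>R g q) ** J \<tau> q)"
    by (rule closed_form_cong [OF open_U fgJ, THEN iffD2, OF _ closed0])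
  have "metric_on U 2 (\<lambda>p. f p *\<^sub>R g p)"
    using m fpos unfolding metric_on_def by (auto intro: smooth_mat_scaleR [OF open_U f] has_index_scaleR)
  moreover have "transpose (J \<tau> p) ** (f p *\<^sub>R g p) = - ((f p *\<^sub>R g p) ** J \<tau> p)" if "p \<in> U" for p
    using skew [OF that] by (simp add: matrix_mult_simps)
  ultimately have "parakaehler U (\<lambda>p. f p *\<^sub>R g p) (J \<tau>)"
    unfolding parakaehler_def using J_paracomplex [OF \<tau>] closed by (intro conjI ballI)
  with f fpos show ?thesis
    unfolding conformally_parakaehler_def by (intro exI [of _ f] conjI ballI)
qed

text \<open>The sign: with \<open>a > 0\<close> and \<open>k > 0\<close> the adapted coframe is negatively oriented in coordinates.\<close>

lemma J_orientation:
  assumes pos: "\<And>t. t \<in> I \<Longrightarrow> a t > 0" "k > 0" and \<tau>: "\<tau> \<in> {1, - 1}"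
    and g: "\<And>q. q \<in> U \<Longrightarrow> g q = transpose (Theta q) ** signature_matrix ** Theta q"
  shows "induces_orientation U g (J \<tau>) (- \<tau>)"
  unfolding induces_orientation_def Let_def
proof
  fix p assume p: "p \<in> U"
  let ?\<delta> = "P11 * P22 - P12 * P21"
  have ab: "a (p $ 1) > 0" "b (p $ 1) \<noteq> 0"
    using p pos b_nz by (auto simp: heis_manifold_def)
  define c where "c = 16 * k * ?\<delta>^2 / (a (p $ 1) * (b (p $ 1))^2)"
  \<comment> \<open>Since \<open>w\<close> contains the determinant as a factor, the determinant
    enters squared and its sign cancels.\<close>
  have c: "8 * (- (w / a (p $ 1)) * (- \<tau> * ?\<delta> / (b (p $ 1))^2)) = (- \<tau>) * c"
    by (simp add: w c_def power2_eq_square)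
  have "c > 0"
    unfolding c_def using pos(2) ab det_nz by simp
  then have "sgn (8 * (- (w / a (p $ 1)) * (- \<tau> * ?\<delta> / (b (p $ 1))^2))) = sgn (- \<tau>)"
    unfolding c by (simp only: sgn_mult sgn_pos mult_1_right)
  then have "sgn (8 * (- (w / a (p $ 1)) * (- \<tau> * ?\<delta> / (b (p $ 1))^2))) = - \<tau>"
    using \<tau> by auto
  then show "sgn (\<Sum>i\<in>UNIV. \<Sum>j\<in>UNIV. \<Sum>k\<in>UNIV. \<Sum>l\<in>UNIV.
      levi_civita i j k l * (g p ** J \<tau> p) $ i $ j * (g p ** J \<tau> p) $ k $ l) = - \<tau>"
    unfolding g [OF p] metric_J [OF p] levi_civita_alternating by simp
qed

end

section \<open>Left-invariant fields and the theorem\<close>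

definition left_field :: "real^3 \<Rightarrow> real^3 \<Rightarrow> real^3" where
  "left_field v x = vector [v $ 1, v $ 2, v $ 3 + (x $ 1 * v $ 2 - x $ 2 * v $ 1) / 2]"

text \<open>Left translation is affine in exponential coordinates, so its differential is the same
  at every \<open>x\<close>, namely the map carrying vectors at the identity to
  \<open>h\<close>.\<close>

lemma frechet_derivative_heis_mult: "frechet_derivative (heis_mult h) (at x) v = left_field v h"
proof -
  have "\<forall>r. ((\<lambda>x. heis_mult h x $ r) has_derivative (\<lambda>v. left_field v h $ r)) (at x)"
    unfolding forall_3 heis_mult_def left_field_def vector_3
    by (auto intro!: derivative_eq_intros has_derivative_coord)
  then have "(heis_mult h has_derivative (\<lambda>v. left_field v h)) (at x)"
    by (intro has_derivative_vec) blast
  from frechet_derivative_at [OF this, symmetric] show ?thesis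
    by simp
qed

lemma left_invariant_field_eq: "left_invariant_field X \<Longrightarrow> X = left_field (X 0)"
proof
  fix h assume "left_invariant_field X"
  then have "X (heis_mult h 0) = left_field (X 0) h"
    by (simp add: left_invariant_field_def frechet_derivative_heis_mult)
  moreover have "heis_mult h 0 = h"
    unfolding vec_eq_iff forall_3 by (simp add: heis_mult_def)
  ultimately show "X h = left_field (X 0) h"
    by simp
qed

lemma left_invariant_left_field: "left_invariant_field (left_field v)"
proof -
  have "left_field v (heis_mult h x) = left_field (left_field v x) h" for h x
    unfolding vec_eq_iff forall_3 by (simp add: left_field_def heis_mult_def field_simps)
  then show ?thesis
    by (simp add: left_invariant_field_def frechet_derivative_heis_mult)
qed

lemma lie_bracket_left_field:
  "lie_bracket (left_field u) (left_field v) x = vector [0, 0, u $ 1 * v $ 2 - u $ 2 * v $ 1]"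
proof -
  have D: "frechet_derivative (left_field v) (at x) z = vector [0, 0, (z $ 1 * v $ 2 - z $ 2 * v $ 1) / 2]" for v z
  proof -
    have "\<forall>r. ((\<lambda>x. left_field v x $ r) has_derivative
        (\<lambda>z. (vector [0, 0, (z $ 1 * v $ 2 - z $ 2 * v $ 1) / 2] :: real^3) $ r)) (at x)"
      unfolding forall_3 left_field_def vector_3
      by (auto intro!: derivative_eq_intros has_derivative_coord)
    then have "(left_field v has_derivative (\<lambda>z. vector [0, 0, (z $ 1 * v $ 2 - z $ 2 * v $ 1) / 2])) (at x)"
      by (intro has_derivative_vec) blast
    from frechet_derivative_at [OF this, symmetric] show ?thesis
      by simp
  qed
  show ?thesis
    unfolding lie_bracket_def D vec_eq_iff forall_3 by (simp add: left_field_def field_simps)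
qed

lemma cramer_2:
  fixes x y :: real
  assumes "x * p1 + y * p2 = s" "x * q1 + y * q2 = t" "p1 * q2 - p2 * q1 \<noteq> 0"
  shows "x = (s * q2 - t * p2) / (p1 * q2 - p2 * q1)" "y = (t * p1 - s * q1) / (p1 * q2 - p2 * q1)"
proof -
  have "x * (p1 * q2 - p2 * q1) = s * q2 - t * p2"
    unfolding assms(1,2) [symmetric] by (simp add: algebra_simps)
  moreover have "y * (p1 * q2 - p2 * q1) = t * p1 - s * q1"
    unfolding assms(1,2) [symmetric] by (simp add: algebra_simps)
  ultimately show "x = (s * q2 - t * p2) / (p1 * q2 - p2 * q1)" "y = (t * p1 - s * q1) / (p1 * q2 - p2 * q1)"
    using assms(3) by (simp_all add: nonzero_eq_divide_eq)
qed

text \<open>Left-invariant fields are determined at the identity. There \<open>e 3\<close> is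
  \<open>c\<close> times the last coordinate vector, and the horizontal parts of \<open>e 1\<close>
  and \<open>e 2\<close> have determinant \<open>d\<close>; the bracket says d = -2kc. Solving the
  duality relations gives w = 1/c and a coframe determinant 1/d, which yields the relation for
  \<open>w\<close>.\<close>

lemma adapted_coframe:
  assumes frame: "adapted_frame B k e" and dual: "dual_coframe e \<theta>" and "k \<noteq> 0"
  obtains P11 P12 P21 P22 Q1 Q2 w where
    "P11 * P22 - P12 * P21 \<noteq> 0" "w = - 2 * k * (P11 * P22 - P12 * P21)"
    "\<And>x. \<theta> 1 x = vector [P11, P12, 0]" "\<And>x. \<theta> 2 x = vector [P21, P22, 0]"
    "\<And>x. \<theta> 3 x = vector [Q1 + w / 2 * x $ 2, Q2 + (- w / 2) * x $ 1, w]"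
proof -
  define p q r where "p = e 1 0" and "q = e 2 0" and "r = e 3 0"
  have e: "e 1 = left_field p" "e 2 = left_field q" "e 3 = left_field r"
    using frame left_invariant_field_eq unfolding adapted_frame_def p_def q_def r_def by blast+
  have "lie_bracket (left_field r) (left_field v) 0 = 0" for v
    using frame left_invariant_left_field unfolding adapted_frame_def central_field_def e by blast
  then have "r $ 1 * v $ 2 - r $ 2 * v $ 1 = 0" for v :: "real^3"
    unfolding lie_bracket_left_field vec_eq_iff forall_3 by simp
  \<comment> \<open>Commuting with both horizontal left-invariant fields forces the horizontal part
    of \<open>e 3\<close> to vanish.\<close>
  from this [of "vector [1, 0, 0]"] this [of "vector [0, 1, 0]"] have r: "r $ 1 = 0" "r $ 2 = 0"
    by simp_all
  define c where "c = r $ 3"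
  define d where "d = p $ 1 * q $ 2 - p $ 2 * q $ 1"
  have "lie_bracket (left_field p) (left_field q) 0 = - (2 * k) *\<^sub>R left_field r 0"
    using frame unfolding adapted_frame_def e by blast
  then have d: "d = - 2 * k * c"
    unfolding lie_bracket_left_field vec_eq_iff forall_3 by (simp add: left_field_def d_def c_def)
  have dual': "\<theta> i x $ 1 * p $ 1 + \<theta> i x $ 2 * p $ 2 + \<theta> i x $ 3 * (p $ 3 + (x $ 1 * p $ 2 - x $ 2 * p $ 1) / 2) = (if i = 1 then 1 else 0)"
    "\<theta> i x $ 1 * q $ 1 + \<theta> i x $ 2 * q $ 2 + \<theta> i x $ 3 * (q $ 3 + (x $ 1 * q $ 2 - x $ 2 * q $ 1) / 2) = (if i = 2 then 1 else 0)"
    "\<theta> i x $ 3 * c = (if i = 3 then 1 else 0)" for i x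
  proof -
    have "\<theta> i x \<bullet> e j x = (if i = j then 1 else 0)" for j
      using dual by (simp add: dual_coframe_def)
    from this [of 1] this [of 2] this [of 3] show
      "\<theta> i x $ 1 * p $ 1 + \<theta> i x $ 2 * p $ 2 + \<theta> i x $ 3 * (p $ 3 + (x $ 1 * p $ 2 - x $ 2 * p $ 1) / 2) = (if i = 1 then 1 else 0)"
      "\<theta> i x $ 1 * q $ 1 + \<theta> i x $ 2 * q $ 2 + \<theta> i x $ 3 * (q $ 3 + (x $ 1 * q $ 2 - x $ 2 * q $ 1) / 2) = (if i = 2 then 1 else 0)"
      "\<theta> i x $ 3 * c = (if i = 3 then 1 else 0)"
      unfolding e left_field_def inner_vec_def sum_3 by (simp_all add: r c_def)
  qed
  have c: "c \<noteq> 0"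
    using dual'(3) [of 3 0] by auto
  have dnz: "d \<noteq> 0"
    using c \<open>k \<noteq> 0\<close> by (simp add: d)
  have \<theta>3: "\<theta> 1 x $ 3 = 0" "\<theta> 2 x $ 3 = 0" "\<theta> 3 x $ 3 = 1 / c" for x
    using dual'(3) [of 1 x] dual'(3) [of 2 x] dual'(3) [of 3 x] c by (simp_all add: nonzero_eq_divide_eq)
  have 1: "\<theta> 1 x $ 1 = q $ 2 / d" "\<theta> 1 x $ 2 = - (q $ 1 / d)" for x
    using cramer_2 [OF _ _ dnz [unfolded d_def], of "\<theta> 1 x $ 1" "\<theta> 1 x $ 2" 1 0] dual'(1,2) [of 1 x] \<theta>3
    by (simp_all add: d_def)
  have 2: "\<theta> 2 x $ 1 = - (p $ 2 / d)" "\<theta> 2 x $ 2 = p $ 1 / d" for x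
    using cramer_2 [OF _ _ dnz [unfolded d_def], of "\<theta> 2 x $ 1" "\<theta> 2 x $ 2" 0 1] dual'(1,2) [of 2 x] \<theta>3
    by (simp_all add: d_def)
  have 3: "\<theta> 3 x $ 1 = (q $ 3 * p $ 2 - p $ 3 * q $ 2) / (c * d) + 1 / c / 2 * x $ 2"
    "\<theta> 3 x $ 2 = (p $ 3 * q $ 1 - q $ 3 * p $ 1) / (c * d) + (- (1 / c) / 2) * x $ 1" for x
  proof -
    \<comment> \<open>Once the last component is known to be 1/c, the other two solve a linear
      system with determinant \<open>d\<close>; the parts of \<open>?s\<close> and \<open>?t\<close>
      linear in \<open>x\<close> recombine into multiples of \<open>d\<close>.\<close>
    let ?s = "- ((p $ 3 + (x $ 1 * p $ 2 - x $ 2 * p $ 1) / 2) / c)" and ?t = "- ((q $ 3 + (x $ 1 * q $ 2 - x $ 2 * q $ 1) / 2) / c)"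
    have "\<theta> 3 x $ 1 * p $ 1 + \<theta> 3 x $ 2 * p $ 2 = ?s" "\<theta> 3 x $ 1 * q $ 1 + \<theta> 3 x $ 2 * q $ 2 = ?t"
      using dual'(1,2) [of 3 x] \<theta>3 by simp_all
    note C = cramer_2 [OF this dnz [unfolded d_def], folded d_def]
    have "?s * q $ 2 - ?t * p $ 2 = (q $ 3 * p $ 2 - p $ 3 * q $ 2) / c + d * x $ 2 / (2 * c)"
      "?t * p $ 1 - ?s * q $ 1 = (p $ 3 * q $ 1 - q $ 3 * p $ 1) / c - d * x $ 1 / (2 * c)"
      using c by (simp_all add: d_def field_simps)
    then show "\<theta> 3 x $ 1 = (q $ 3 * p $ 2 - p $ 3 * q $ 2) / (c * d) + 1 / c / 2 * x $ 2"
      "\<theta> 3 x $ 2 = (p $ 3 * q $ 1 - q $ 3 * p $ 1) / (c * d) + (- (1 / c) / 2) * x $ 1"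
      unfolding C using dnz by (simp_all add: add_divide_distrib diff_divide_distrib mult.commute)
  qed
  have det: "q $ 2 / d * (p $ 1 / d) - - (q $ 1 / d) * - (p $ 2 / d) = 1 / d"
  proof -
    have "q $ 2 / d * (p $ 1 / d) - - (q $ 1 / d) * - (p $ 2 / d) = d / (d * d)"
      by (simp add: d_def [symmetric] diff_divide_distrib [symmetric]) (simp add: d_def mult.commute)
    then show ?thesis
      using dnz by simp
  qed
  show ?thesis
  proof (rule that)
    show "q $ 2 / d * (p $ 1 / d) - - (q $ 1 / d) * - (p $ 2 / d) \<noteq> 0"
      unfolding det using dnz by simp
    show "1 / c = - 2 * k * (q $ 2 / d * (p $ 1 / d) - - (q $ 1 / d) * - (p $ 2 / d))"
      unfolding det using c \<open>k \<noteq> 0\<close> by (simp add: d)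
    show "\<theta> 1 x = vector [q $ 2 / d, - (q $ 1 / d), 0]" "\<theta> 2 x = vector [- (p $ 2 / d), p $ 1 / d, 0]" for x
      unfolding vec_eq_iff forall_3 by (simp_all add: 1 2 \<theta>3)
    show "\<theta> 3 x = vector [(q $ 3 * p $ 2 - p $ 3 * q $ 2) / (c * d) + 1 / c / 2 * x $ 2,
        (p $ 3 * q $ 1 - q $ 3 * p $ 1) / (c * d) + (- (1 / c) / 2) * x $ 1, 1 / c]" for x
      unfolding vec_eq_iff forall_3 vector_3 using 3 \<theta>3 by blast
  qed
qed

section \<open>Pull-backs to the four-manifold, and the theorem\<close>

lemma matrix_heis_part: "matrix heis_part = (vector [vector [0, 1, 0, 0], vector [0, 0, 1, 0], vector [0, 0, 0, 1]] :: real^4^3)"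
  unfolding vec_eq_iff forall_3 forall_4 by (simp add: matrix_def heis_part_def axis_nth)

lemma pull_covector_vector: "pull_covector (vector [x, y, z]) = vector [0, x, y, z]"
  unfolding vec_eq_iff forall_4
  by (simp add: pull_covector_def matrix_heis_part matrix_vector_mult_def transpose_def sum_3)

lemma pull_form_nth:
  "pull_form B $ i $ j = (\<Sum>r\<in>UNIV. \<Sum>s\<in>UNIV. (matrix heis_part :: real^4^3) $ r $ i * B $ r $ s * (matrix heis_part :: real^4^3) $ s $ j)"
  unfolding pull_form_def by (subst sum.swap) (simp add: matrix_matrix_mult_def transpose_def sum_distrib_right)

lemma nonzero_on_interval_pos:
  fixes a :: "real \<Rightarrow> real"
  assumes "is_interval I" "continuous_on I a" "\<And>t. t \<in> I \<Longrightarrow> a t \<noteq> 0" "t0 \<in> I" "a t0 > 0" "t \<in> I"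
  shows "a t > 0"
proof (rule ccontr)
  assume "\<not> a t > 0"
  then have "a t \<le> 0"
    by simp
  have "is_interval (a ` I)"
    using assms(1,2) by (simp add: connected_continuous_image is_interval_connected_1)
  then have "0 \<in> a ` I"
    by (rule mem_is_interval_1_I [of _ "a t" "a t0"]) (use assms \<open>a t \<le> 0\<close> in auto)
  then show False
    using assms(3) by auto
qed

theorem proposition3p29:
  fixes I :: "real set" and t0 k \<Lambda> \<sigma> \<epsilon> :: real
    and a b :: "real \<Rightarrow> real"
    and h :: "real \<Rightarrow> real^3 \<Rightarrow> real^3^3"
    and e \<theta> :: "3 \<Rightarrow> real^3 \<Rightarrow> real^3"
    and g :: "real^4 \<Rightarrow> real^4^4" and M :: "(real^4) set"
  assumes "open I" and "is_interval I" and "t0 \<in> I"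
    and "M = heis_manifold I" and "g = heis_metric h" and "\<epsilon> = - 1"
    and "spacelike_heisenberg I h"
    and "quaternionic_parakaehler M g \<Lambda> \<sigma>"
    and "k > 0" and "adapted_frame (h t0) k e" and "dual_coframe e \<theta>"
    and "smooth_on_interval I a" and "smooth_on_interval I b"
    and "\<forall>t\<in>I. a t \<noteq> 0 \<and> b t \<noteq> 0" and "a t0 = 1" and "b t0 = 1"
    and "\<forall>t\<in>I. \<forall>x. h t x = diagonal_family a b \<theta> t x"
    and "\<forall>t\<in>I. deriv b t \<noteq> 0 \<longrightarrow>
           deriv a t = - (k^2 * (b t)^6 + (a t)^2 * (- \<Lambda> * (b t)^2 + (deriv b t)^2))
                         / (2 * a t * b t * deriv b t)"
    and "\<forall>t\<in>I. \<Lambda> = 3 * (k * (b t)^3 + a t * deriv b t)^3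
                     / ((a t)^2 * (b t)^2 * (3 * k * (b t)^3 + a t * deriv b t))"
  shows "(\<forall>p\<in>M. let \<omega> = (\<lambda>i. dual_form \<sigma> g a b \<theta> i p); \<nu> = nu k a b \<epsilon> (p $ 1) in
            inj \<omega> \<and> independent (range \<omega>) \<and> span (range \<omega>) = self_dual_forms \<sigma> (g p) \<and>
            weyl_op g p (\<omega> 1) = \<nu> *\<^sub>R \<omega> 1 \<and>
            weyl_op g p (\<omega> 2) = \<nu> *\<^sub>R \<omega> 2 \<and>
            weyl_op g p (\<omega> 3) = (- 2 * \<nu>) *\<^sub>R \<omega> 3) \<and>
         (\<exists>J1 J2. conformally_parakaehler M g J1 \<and> conformally_parakaehler M g J2 \<and>
            induces_orientation M g J1 \<sigma> \<and> induces_orientation M g J2 (- \<sigma>))"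
proof -
  have "k \<noteq> 0"
    using \<open>k > 0\<close> by simp
  obtain P11 P12 P21 P22 Q1 Q2 w where P: "P11 * P22 - P12 * P21 \<noteq> 0" "w = - 2 * k * (P11 * P22 - P12 * P21)"
    and \<theta>: "\<And>x. \<theta> 1 x = vector [P11, P12, 0]" "\<And>x. \<theta> 2 x = vector [P21, P22, 0]"
    "\<And>x. \<theta> 3 x = vector [Q1 + w / 2 * x $ 2, Q2 + (- w / 2) * x $ 1, w]"
    by (rule adapted_coframe [OF assms(10,11) \<open>k \<noteq> 0\<close>], rule that, assumption+)
  have ab: "a t \<noteq> 0" "b t \<noteq> 0" if "t \<in> I" for t
    using assms(14) that by blast+
  interpret heis_frame I a b k P11 P12 P21 P22 Q1 Q2 w
    by unfold_locales (use assms(1,12,13) ab \<open>k \<noteq> 0\<close> P in blast)+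
  have U: "M = U" and qpk: "quaternionic_parakaehler U g \<Lambda> \<sigma>"
    using assms(4,8) by simp_all
  have coframe: "coframe_at a b \<theta> 1 p = Theta p $ 2" "coframe_at a b \<theta> 2 p = Theta p $ 3"
    "coframe_at a b \<theta> 3 p = Theta p $ 4" for p
    unfolding coframe_at_def \<theta> pull_covector_vector vec_eq_iff forall_4
    by (simp_all add: Theta_def heis_part_def)
  have dt: "dt = Theta p $ 1" for p
    unfolding dt_def vec_eq_iff forall_4 by (simp add: Theta_def axis_nth)
  have g: "g p = transpose (Theta p) ** signature_matrix ** Theta p" if "p \<in> U" for p
  proof -
    have "h (p $ 1) (heis_part p) = diagonal_family a b \<theta> (p $ 1) (heis_part p)"
      using assms(17) that by (simp add: heis_manifold_def)
    then show ?thesis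
      unfolding assms(5) heis_metric_def diagonal_family_def \<theta> vec_eq_iff forall_4 matrix_congruence_nth(2) sum_4
      by (simp add: pull_form_nth sum_3 matrix_heis_part tensor_def dt_def axis_nth Theta_def signature_matrix_def
          heis_part_def power2_eq_square diff_divide_distrib [of _ _ "b (p $ 1) * b (p $ 1)"])
  qed
  have \<sigma>: "\<sigma> \<in> {1, - 1}" and "\<Lambda> \<noteq> 0" and metric: "metric_on U 2 g" and sd: "weyl_self_dual U g \<sigma>"
    and ein: "\<And>p. p \<in> U \<Longrightarrow> ricci g p = \<Lambda> *\<^sub>R g p"
    using qpk by (auto simp: quaternionic_parakaehler_def)
  have forms: "inj (\<lambda>i. dual_form \<sigma> g a b \<theta> i p) \<and> independent (range (\<lambda>i. dual_form \<sigma> g a b \<theta> i p)) \<and>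
      span (range (\<lambda>i. dual_form \<sigma> g a b \<theta> i p)) = self_dual_forms \<sigma> (g p) \<and>
      weyl_op g p (dual_form \<sigma> g a b \<theta> 1 p) = nu k a b \<epsilon> (p $ 1) *\<^sub>R dual_form \<sigma> g a b \<theta> 1 p \<and>
      weyl_op g p (dual_form \<sigma> g a b \<theta> 2 p) = nu k a b \<epsilon> (p $ 1) *\<^sub>R dual_form \<sigma> g a b \<theta> 2 p \<and>
      weyl_op g p (dual_form \<sigma> g a b \<theta> 3 p) = (- 2 * nu k a b \<epsilon> (p $ 1)) *\<^sub>R dual_form \<sigma> g a b \<theta> 3 p"
    if p: "p \<in> U" for p
  proof -
    define t where "t = p $ 1"
    have t: "t \<in> I"
      using p by (simp add: t_def heis_manifold_def)
    \<comment> \<open>Dividing \<open>x\<close> and \<open>y\<close> by \<open>a * b\<close> gives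
      \<kappa> and \<beta>, so the given formulas for \<Lambda> and \<nu> become those of the frame
      computation by homogeneity.\<close>
    define x y where "x = k * (b t)^3" and "y = a t * deriv b t"
    have \<Lambda>: "\<Lambda> = 3 * (x + y)^3 / ((a t)^2 * (b t)^2 * (3 * x + y))"
      using assms(19) t by (simp add: x_def y_def mult.assoc)
    \<comment> \<open>Division by zero yields 0, so a vanishing denominator would contradict
      \<Lambda> \<noteq> 0.\<close>
    then have xy: "3 * x + y \<noteq> 0"
      using \<open>\<Lambda> \<noteq> 0\<close> by auto
    have kb: "ka t = x / (a t * b t)" "be t = y / (a t * b t)"
      using ab [OF t] by (simp_all add: ka_def be_def x_def y_def field_simps power2_eq_square power3_eq_cube)
    have sum: "3 * ka t + be t = (3 * x + y) / (a t * b t)" "ka t + be t = (x + y) / (a t * b t)"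
      by (simp_all add: kb add_divide_distrib)
    have nz: "3 * ka t + be t \<noteq> 0"
      using xy ab [OF t] by (simp add: sum)
    have \<Lambda>': "\<Lambda> / 3 * (3 * ka t + be t) = (ka t + be t)^3"
    proof -
      have gen: "3 * v^3 / (A^2 * B^2 * z) / 3 * (z / (A * B)) = (v / (A * B))^3" if "z \<noteq> 0" "A \<noteq> 0" "B \<noteq> 0" for A B v z :: real
        using that by (simp add: field_simps power2_eq_square power3_eq_cube)
      show ?thesis
        unfolding sum \<Lambda> by (rule gen [OF xy ab [OF t]])
    qed
    have "nu k a b \<epsilon> t = - (16 * x^3 / ((a t)^2 * (b t)^2 * (3 * x + y)))"
    proof -
      have gen: "16 * k^3 * B^7 / (- 1 * (A^2 * z)) = - (16 * (k * B^3)^3 / (A^2 * B^2 * z))" if "z \<noteq> 0" "A \<noteq> 0" "B \<noteq> 0" for A B z :: real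
        using that by (simp add: field_simps eval_nat_numeral)
      show ?thesis
        unfolding nu_def assms(6) using gen [OF xy ab [OF t]] by (simp only: x_def y_def mult.assoc)
    qed
    also have "\<dots> = - 16 * (ka t)^3 / (3 * ka t + be t)"
    proof -
      have gen: "- (16 * v^3 / (A^2 * B^2 * z)) = - 16 * (v / (A * B))^3 / (z / (A * B))" if "z \<noteq> 0" "A \<noteq> 0" "B \<noteq> 0" for A B v z :: real
        using that by (simp add: field_simps power2_eq_square power3_eq_cube)
      show ?thesis
        unfolding sum unfolding kb(1) by (rule gen [OF xy ab [OF t]])
    qed
    finally have \<nu>: "nu k a b \<epsilon> t = - 16 * (ka t)^3 / (3 * ka t + be t)" .
    have \<omega>: "dual_form \<sigma> g a b \<theta> i p = wedge (Theta p $ 1) (coframe_at a b \<theta> i p)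
        + hodge \<sigma> (g p) (wedge (Theta p $ 1) (coframe_at a b \<theta> i p))" for i
      by (simp only: dual_form_def dt [symmetric])
    show ?thesis
      by (intro conjI heis_eigenforms [OF g p ein [OF p] sd \<sigma> \<Lambda>' [unfolded t_def] nz [unfolded t_def] \<nu> [unfolded t_def] \<omega> coframe])
  qed
  have cont: "continuous_on I a"
    using smooth_on_interval_differentiable(1) [OF smooth_a]
    by (intro continuous_at_imp_continuous_on ballI differentiable_imp_continuous_within) blast
  \<comment> \<open>\<open>a\<close> has no zero on the interval and equals 1 at \<open>t0\<close>.
    Its sign decides the orientation of the forms, whereas \<open>b\<close> enters them
    squared.\<close>
  have pos: "a t > 0" if "t \<in> I" for t
    by (rule nonzero_on_interval_pos [OF assms(2) cont ab(1) assms(3) _ that]) (simp_all add: \<open>a t0 = 1\<close>)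
  have "I \<noteq> {}"
    using assms(3) by blast
  then have conf: "conformally_parakaehler U g (J \<tau>)" if "\<tau> \<in> {1, - 1}" for \<tau>
    using that by (intro conformally_parakaehler_J [OF assms(2) _ _ g metric]) auto
  have orient: "induces_orientation U g (J \<tau>) (- \<tau>)" if "\<tau> \<in> {1, - 1}" for \<tau>
    by (rule J_orientation [OF pos \<open>k > 0\<close> that g])
  \<comment> \<open>\<open>J \<tau>\<close> induces the orientation -\<tau>, so the structure for
    \<sigma> itself is \<open>J (- \<sigma>)\<close>.\<close>
  have "conformally_parakaehler U g (J (- \<sigma>)) \<and> conformally_parakaehler U g (J \<sigma>) \<and>
      induces_orientation U g (J (- \<sigma>)) \<sigma> \<and> induces_orientation U g (J \<sigma>) (- \<sigma>)"
    using conf [of "- \<sigma>"] conf [of \<sigma>] orient [of "- \<sigma>"] orient [of \<sigma>] \<sigma> by fastforce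
  then have ex: "\<exists>J1 J2. conformally_parakaehler U g J1 \<and> conformally_parakaehler U g J2 \<and>
      induces_orientation U g J1 \<sigma> \<and> induces_orientation U g J2 (- \<sigma>)"
    by (intro exI)
  show ?thesis
    unfolding U Let_def by (rule conjI [OF ballI [OF forms] ex])
qed

end
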